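(* Let $L$ be a 2-bridge link universe $L(a_1,\dots,a_n)$, a pretzel link universe $L(b_1,\dots,b_n)$, or a Montesinos link universe $L(k;R^1,\dots,R^m)$, and let the lower segment be chosen as the distinguished segment $s$. Then there exists an ordered labeling $l$ of the crossing points of $L$ such that $L_{s;l}$ is an admissible link configuration. More precisely, the following labelings have this property. (a) 2-bridge: crossings in the $i$-th twist box receive lower labels than those in the $j$-th box whenever $i<j$; within each twist box labels increase from left to right. (b) Pretzel: crossings in the $i$-th twist box receive lower labels than those in the $j$-th box whenever $i<j$; in the first twist box labels increase from bottom to top, and in each subsequent twist box they increase from top to bottom. (c) Montesinos: the unique twist box (outside the rational tangles) receives the first $k$ labels; crossings in the $i$-th rational tangle receive lower labels than those in the $j$-th whenever $i<j$; within each rational tangle, crossings in the $i$-th twist box receive lower labels than those in the $j$-th box whenever $i<j$; in each horizontal twist box labels increase from left to right, and in each vertical twist box they increase from top to bottom.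
   Context: Universes. A link universe $L$ is a link diagram with over/under information forgotten, viewed as a 4-valent plane graph whose vertices are the crossings; its edges are called segments and its faces regions. Standing assumption: $L$ is connected and has no curls (regions with a single corner) and no nugatory crossings (crossings at which one region occupies two opposite corners). Regions are checkerboard coloured with the unbounded region white. The checkerboard graph $G_L$ has a vertex in each black region and, for each crossing $c$, an edge $e_c$ through $c$ joining the two black regions at $c$; $\overline G_L$ is its planar dual with vertices the white regions and edges $\overline e_c$. A universe is determined by its plane checkerboard graph (it is the medial graph), crossings corresponding to edges; segments correspond to corners of the plane graph. The families, described by their plane checkerboard graphs. All contain a bottom vertex $v$ incident to the unbounded face; the lower segment is the one bordering the black region of $v$ and the unbounded region (it corresponds to the corner of the unbounded face at $v$, between the last and first edges at $v$). (2-bridge) For positive integers $a_1,\dots,a_n$: above $v$ there are vertices from left to right; start at the leftmost of them as current vertex. For odd $i$, box $i$ consists of $a_i$ parallel edges between the current vertex and $v$, drawn from left to right. For even $i<n$, box $i$ is a path of $a_i$ edges running to the right from the current vertex to a new current vertex. If $n$ is even, box $n$ is a path of $a_n$ edges starting at the current vertex, the first $a_n-1$ running to the right to new vertices and the last ending at $v$. Edges at $v$ occur from left to right in the order of construction, and the order of construction is the left-to-right order. (Pretzel) For positive integers $b_1,\dots,b_n$: a top vertex $u$, the bottom vertex $v$, and $n$ internally disjoint vertical paths from $u$ to $v$, from left to right of lengths $b_1,\dots,b_n$; the $i$-th path is the $i$-th twist box. (Montesinos) For a positive integer $k$ and rational tangles $R^j(c^j_1,\dots,c^j_{n_j})$ with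 positive integer parameters: a top vertex $u$ and bottom vertex $v$ joined, from left to right, by $k$ parallel edges (the twist box, labelled from left to right) and then by plane two-terminal graphs $T^1,\dots,T^m$ with top terminal $u$ and bottom terminal $v$. For parameters $(c_1,\dots,c_n)$ the two-terminal graph $T=T_n$ is built from boxes $1,\dots,n$, where box $i$ is vertical if $n-i$ is even and horizontal if $n-i$ is odd: $T_1$ is a vertical path of $c_1$ edges, respectively $c_1$ parallel edges; $T_i$ is obtained from $T_{i-1}$ by adding below it, in series, a vertical path of $c_i$ edges (vertical box), respectively by adding on its right, in parallel between the two terminals, $c_i$ edges (horizontal box). Admissible configurations. An ordered labeling $l$ labels the $n$ crossings bijectively by $1,\dots,n$ and linearly orders the edges $e_j$, $\overline e_j$; a link configuration $L_{s;l}$ is a universe with a distinguished segment $s$ and an ordered labeling. The overlaid checkerboard graph has a vertex $v_c$ for each crossing, a vertex $v_R$ for each region, and a half-edge $h_{(c,R)}$ joining them iff $c$ is incident to $R$; $G^b_{L,s}$ is obtained by deleting the vertices $v_R$ of the two regions adjacent to $s$ and all incident half-edges. A spanning tree $T\subset G_L$ has the dual spanning tree $\overline T=\{\overline e_i:e_i\notin T\}$; $\widehat T=T\sqcup\overline T$ is a double spanning tree. An edge $\widehat e$ of $T$ (or $\overline T$) has letter $\alpha_{\widehat T}(\widehat e)=L$ if it is the lowest-ordered edge of its fundamental cocycle (the edges reconnecting the two components of that tree minus $\widehat e$), and $D$ otherwise. For $h=h_{(c,R)}$ let $\eta(h)$ be $e_c$ if $R$ is black, $\overline e_c$ if $R$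 is white; for a perfect matching $\mathcal P$ of $G^b_{L,s}$, $\eta(\mathcal P)$ is a double spanning tree. $L_{s;l}$ satisfies the EI-property if for each half-edge $h$ of $G^b_{L,s}$ the letter $\alpha_{\eta(\mathcal P)}(\eta(h))$ is the same for all perfect matchings $\mathcal P\ni h$. A bigon extension $E_{c_i}$ replaces $c_i$ by two crossings with a new bigon region between them, separating two opposite corners of $c_i$: one new crossing is incident to each of these two corner regions, and both are incident to the bigon and to the other two corner regions at $c_i$. The segment corresponding to $s$ is again called $s$. A natural ordered labeling $l'$ of the new universe $L'$ keeps labels $j<i$, raises labels $j>i$ by $1$, and gives the two new crossings labels $i,i+1$ in one of the two orders. If $L_{s;l}$ satisfies the EI-property, $E_{c_i}$ is admissible if some natural $l'$ makes $L'_{s;l'}$ satisfy the EI-property. The Hopf link universe $H$ is two circles crossing at two points. $L_{s;l}$ is admissible if it is obtained from some $H_{s;l_H}$ ($s$ any segment, $l_H$ any ordered labeling) by a sequence of admissible bigon extensions, with the corresponding labelings. *)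

theory Defs
  imports Main "HOL-Combinatorics.Orbits" "HOL-Combinatorics.Cycles"
begin

section \<open>Plane graphs as combinatorial maps\<close>

text \<open>
  A connected plane graph is given by its darts (half-edges): \<open>rot\<close> sends a dart to the next dart
  counterclockwise around its vertex and \<open>opp\<close> to the other half of its edge; both are the identity
  off \<open>darts\<close>. A dart \<open>d\<close> also stands for the corner swept out counterclockwise from \<open>d\<close> to
  \<open>rot d\<close>. Thus a vertex is the set of its darts, a region (face) is the set of its corners, and
  the edge through \<open>d\<close> separates the regions of \<open>d\<close> and \<open>opp d\<close>. The field \<open>outer\<close> is the
  unbounded region.
\<close>

record 'd plane_map =
  darts :: "'d set"
  rot :: "'d \<Rightarrow> 'd"
  opp :: "'d \<Rightarrow> 'd"
  outer :: "'d set"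

definition vertex :: "'d plane_map \<Rightarrow> 'd \<Rightarrow> 'd set" where
  "vertex M d = orbit (rot M) d"

definition vertices :: "'d plane_map \<Rightarrow> 'd set set" where
  "vertices M = vertex M ` darts M"

definition region :: "'d plane_map \<Rightarrow> 'd \<Rightarrow> 'd set" where
  "region M d = orbit (opp M \<circ> rot M) d"

definition regions :: "'d plane_map \<Rightarrow> 'd set set" where
  "regions M = region M ` darts M"

definition segments :: "'d plane_map \<Rightarrow> 'd set set" where
  "segments M = (\<lambda>d. {d, opp M d}) ` darts M"

definition connected_map :: "'d plane_map \<Rightarrow> bool" where
  "connected_map M \<longleftrightarrow>
     (\<forall>x\<in>darts M. \<forall>y\<in>darts M. (x, y) \<in> {(d, e). e = rot M d \<or> e = opp M d}\<^sup>*)"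

text \<open>For connected maps, planarity is Euler's formula.\<close>

definition plane_graph :: "'d plane_map \<Rightarrow> bool" where
  "plane_graph M \<longleftrightarrow>
     finite (darts M) \<and> rot M permutes darts M \<and> opp M permutes darts M \<and>
     (\<forall>d\<in>darts M. opp M d \<noteq> d \<and> opp M (opp M d) = d) \<and>
     outer M \<in> regions M \<and> connected_map M \<and>
     card (vertices M) + card (regions M) = card (segments M) + 2"


section \<open>Link universes\<close>

abbreviation crossing :: "'d plane_map \<Rightarrow> 'd \<Rightarrow> 'd set" where
  "crossing \<equiv> vertex"

abbreviation crossings :: "'d plane_map \<Rightarrow> 'd set set" where
  "crossings \<equiv> vertices"

definition has_curl :: "'d plane_map \<Rightarrow> bool" where
  "has_curl U \<longleftrightarrow> (\<exists>R\<in>regions U. card R = 1)"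

definition has_nugatory_crossing :: "'d plane_map \<Rightarrow> bool" where
  "has_nugatory_crossing U \<longleftrightarrow> (\<exists>d\<in>darts U. region U d = region U (rot U (rot U d)))"

definition link_universe :: "'d plane_map \<Rightarrow> bool" where
  "link_universe U \<longleftrightarrow>
     plane_graph U \<and> (\<forall>c\<in>crossings U. card c = 4) \<and> \<not> has_curl U \<and> \<not> has_nugatory_crossing U"

text \<open>The checkerboard colouring with the unbounded region white; it is unique by connectedness.\<close>

definition white_regions :: "'d plane_map \<Rightarrow> 'd set set" where
  "white_regions U =
     (THE W. W \<subseteq> regions U \<and> outer U \<in> W \<and>
        (\<forall>d\<in>darts U. region U d \<in> W \<longleftrightarrow> region U (opp U d) \<notin> W))"

definition black_regions :: "'d plane_map \<Rightarrow> 'd set set" where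
  "black_regions U = regions U - white_regions U"

definition incident :: "'d plane_map \<Rightarrow> 'd set \<Rightarrow> 'd set \<Rightarrow> bool" where
  "incident U c R \<longleftrightarrow> c \<in> crossings U \<and> R \<in> regions U \<and> c \<inter> R \<noteq> {}"


section \<open>The checkerboard graph, its dual, and activity letters\<close>

text \<open>\<open>Edge c\<close> is the edge $e_c$ of the checkerboard graph, \<open>Dual_Edge c\<close> the edge
  $\overline e_c$ of its dual.\<close>

datatype 'c cb_edge = Edge 'c | Dual_Edge 'c

primrec cb_crossing :: "'c cb_edge \<Rightarrow> 'c" where
  "cb_crossing (Edge c) = c"
| "cb_crossing (Dual_Edge c) = c"

text \<open>The vertices and the edges of the one of the two graphs to which the given edge belongs.\<close>

primrec graph_vertices :: "'d plane_map \<Rightarrow> 'd set cb_edge \<Rightarrow> 'd set set" where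
  "graph_vertices U (Edge c) = black_regions U"
| "graph_vertices U (Dual_Edge c) = white_regions U"

primrec graph_edges :: "'d plane_map \<Rightarrow> 'd set cb_edge \<Rightarrow> 'd set cb_edge set" where
  "graph_edges U (Edge c) = Edge ` crossings U"
| "graph_edges U (Dual_Edge c) = Dual_Edge ` crossings U"

definition ends :: "'d plane_map \<Rightarrow> 'd set cb_edge \<Rightarrow> 'd set set" where
  "ends U e = {R \<in> graph_vertices U e. incident U (cb_crossing e) R}"

definition connects :: "'d plane_map \<Rightarrow> 'd set cb_edge set \<Rightarrow> 'd set set \<Rightarrow> bool" where
  "connects U F V \<longleftrightarrow> (\<forall>R\<in>V. \<forall>S\<in>V. (R, S) \<in> {(R, S). \<exists>e\<in>F. ends U e = {R, S}}\<^sup>*)"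

text \<open>For a double spanning tree \<open>X\<close> and \<open>e \<in> X\<close>: the edges that reconnect the tree containing
  \<open>e\<close> after the removal of \<open>e\<close>.\<close>

definition fundamental_cocycle ::
  "'d plane_map \<Rightarrow> 'd set cb_edge set \<Rightarrow> 'd set cb_edge \<Rightarrow> 'd set cb_edge set" where
  "fundamental_cocycle U X e =
     {f \<in> graph_edges U e.
        connects U (insert f ((X \<inter> graph_edges U e) - {e})) (graph_vertices U e)}"

definition ordered_labeling :: "'d plane_map \<Rightarrow> ('d set \<Rightarrow> nat) \<Rightarrow> bool" where
  "ordered_labeling U l \<longleftrightarrow> bij_betw l (crossings U) {1..card (crossings U)}"

datatype letter = Letter_L | Letter_D

definition activity_letter ::
  "'d plane_map \<Rightarrow> ('d set \<Rightarrow> nat) \<Rightarrow> 'd set cb_edge set \<Rightarrow> 'd set cb_edge \<Rightarrow> letter" where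
  "activity_letter U l X e =
     (if \<forall>f\<in>fundamental_cocycle U X e. l (cb_crossing e) \<le> l (cb_crossing f)
      then Letter_L else Letter_D)"


section \<open>The balanced overlaid graph and the EI-property\<close>

text \<open>A half-edge of the overlaid checkerboard graph is the pair of its crossing and its region.
  The regions deleted from the balanced graph are those of the two darts of the segment \<open>s\<close>.\<close>

definition balanced_regions :: "'d plane_map \<Rightarrow> 'd set \<Rightarrow> 'd set set" where
  "balanced_regions U s = regions U - region U ` s"

definition balanced_half_edges :: "'d plane_map \<Rightarrow> 'd set \<Rightarrow> ('d set \<times> 'd set) set" where
  "balanced_half_edges U s = {(c, R). R \<in> balanced_regions U s \<and> incident U c R}"

definition perfect_matching ::
  "'d plane_map \<Rightarrow> 'd set \<Rightarrow> ('d set \<times> 'd set) set \<Rightarrow> bool" where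
  "perfect_matching U s P \<longleftrightarrow>
     P \<subseteq> balanced_half_edges U s \<and>
     (\<forall>c\<in>crossings U. \<exists>!h. h \<in> P \<and> fst h = c) \<and>
     (\<forall>R\<in>balanced_regions U s. \<exists>!h. h \<in> P \<and> snd h = R)"

definition eta :: "'d plane_map \<Rightarrow> 'd set \<times> 'd set \<Rightarrow> 'd set cb_edge" where
  "eta U h = (if snd h \<in> black_regions U then Edge (fst h) else Dual_Edge (fst h))"

text \<open>For a perfect matching \<open>P\<close>, the set \<open>eta U ` P\<close> is a double spanning tree, so activity
  letters are only compared for double spanning trees.\<close>

definition EI_property :: "'d plane_map \<Rightarrow> 'd set \<Rightarrow> ('d set \<Rightarrow> nat) \<Rightarrow> bool" where
  "EI_property U s l \<longleftrightarrow>
     (\<forall>h\<in>balanced_half_edges U s. \<forall>P Q.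
        perfect_matching U s P \<and> h \<in> P \<and> perfect_matching U s Q \<and> h \<in> Q \<longrightarrow>
        activity_letter U l (eta U ` P) (eta U h) = activity_letter U l (eta U ` Q) (eta U h))"


section \<open>Bigon extensions and admissible configurations\<close>

text \<open>
  The crossing with darts \<open>d, d1, d2, d3\<close> (counterclockwise) is replaced by two crossings with
  darts \<open>d, d1, p, p'\<close> and \<open>d2, d3, q, q'\<close>, joined by the segments \<open>{p, q'}\<close> and \<open>{p', q}\<close>,
  which bound the new bigon (corners \<open>p\<close> and \<open>q\<close>). The opposite corners \<open>d\<close> and \<open>d2\<close> are
  separated. Old darts are kept, so every old segment and every old crossing other than the
  replaced one is literally the same set in the new universe, whereas a region may acquire new
  corners.
\<close>

definition bigon_extension ::
  "'d plane_map \<Rightarrow> 'd \<Rightarrow> 'd \<Rightarrow> 'd \<Rightarrow> 'd \<Rightarrow> 'd \<Rightarrow> 'd plane_map \<Rightarrow> bool" where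
  "bigon_extension U d p p' q q' U' \<longleftrightarrow>
     d \<in> darts U \<and> distinct [p, p', q, q'] \<and> {p, p', q, q'} \<inter> darts U = {} \<and>
     darts U' = darts U \<union> {p, p', q, q'} \<and>
     rot U' = (let d1 = rot U d; d2 = rot U d1; d3 = rot U d2 in
       (rot U)(d1 := p, p := p', p' := d, d3 := q, q := q', q' := d2)) \<and>
     opp U' = (opp U)(p := q', q' := p, p' := q, q := p') \<and>
     outer U' \<in> regions U' \<and> outer U \<subseteq> outer U'"

text \<open>\<open>c\<close> is the crossing of \<open>U\<close> that is replaced by the crossings \<open>c1\<close> and \<open>c2\<close> of \<open>U'\<close>.\<close>

definition natural_labeling ::
  "'d plane_map \<Rightarrow> ('d set \<Rightarrow> nat) \<Rightarrow> 'd set \<Rightarrow> 'd set \<Rightarrow> 'd set \<Rightarrow> ('d set \<Rightarrow> nat) \<Rightarrow> bool" where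
  "natural_labeling U l c c1 c2 l' \<longleftrightarrow>
     (\<forall>x\<in>crossings U - {c}. l' x = (if l x < l c then l x else l x + 1)) \<and>
     (l' c1 = l c \<and> l' c2 = l c + 1 \<or> l' c1 = l c + 1 \<and> l' c2 = l c)"

text \<open>The crossings are \<open>{a0, a1, a2, a3}\<close> and \<open>{b0, b1, b2, b3}\<close>, placed as mirror images of each
  other; the circles run through \<open>a0, a2, b2, b0\<close> and through \<open>a1, a3, b3, b1\<close>.\<close>

definition hopf_universe :: "'d plane_map \<Rightarrow> bool" where
  "hopf_universe U \<longleftrightarrow>
     (\<exists>a0 a1 a2 a3 b0 b1 b2 b3.
        distinct [a0, a1, a2, a3, b0, b1, b2, b3] \<and>
        darts U = {a0, a1, a2, a3, b0, b1, b2, b3} \<and>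
        rot U = cycle_of_list [a0, a1, a2, a3] \<circ> cycle_of_list [b3, b2, b1, b0] \<and>
        opp U = transpose a0 b0 \<circ> transpose a1 b1 \<circ> transpose a2 b2 \<circ> transpose a3 b3 \<and>
        outer U \<in> regions U)"

inductive admissible :: "'d plane_map \<Rightarrow> 'd set \<Rightarrow> ('d set \<Rightarrow> nat) \<Rightarrow> bool" where
  hopf: "\<lbrakk>hopf_universe U; s \<in> segments U; ordered_labeling U l\<rbrakk> \<Longrightarrow> admissible U s l"
| extend: "\<lbrakk>admissible U s l; EI_property U s l;
     bigon_extension U d p p' q q' U';
     natural_labeling U l (crossing U d) (crossing U' p) (crossing U' q) l';
     EI_property U' s l'\<rbrakk> \<Longrightarrow> admissible U' s l'"


section \<open>Plane two-terminal graphs and medial universes\<close>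

text \<open>Edges are directed from top to bottom (in the two-bridge case, paths running to the right are
  directed to the right); an edge consists of the dart at its tail and the dart at its head.\<close>

datatype 'e dart = Tail 'e | Head 'e

primrec flip :: "'e dart \<Rightarrow> 'e dart" where
  "flip (Tail e) = Head e"
| "flip (Head e) = Tail e"

text \<open>A plane graph drawn between a top and a bottom terminal: the darts at each terminal from left
  to right, and for every other vertex its darts in counterclockwise order.\<close>

record 'e two_terminal =
  top_darts :: "'e dart list"
  bottom_darts :: "'e dart list"
  inner_vertices :: "'e dart list list"

definition path_box :: "'e list \<Rightarrow> 'e two_terminal" where
  "path_box es =
     \<lparr>top_darts = [Tail (hd es)], bottom_darts = [Head (last es)],
      inner_vertices = map (\<lambda>(e, f). [Head e, Tail f]) (zip es (tl es))\<rparr>"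

definition multi_edge_box :: "'e list \<Rightarrow> 'e two_terminal" where
  "multi_edge_box es =
     \<lparr>top_darts = map Tail es, bottom_darts = map Head es, inner_vertices = []\<rparr>"

definition parallel :: "'e two_terminal list \<Rightarrow> 'e two_terminal" where
  "parallel Bs =
     \<lparr>top_darts = concat (map top_darts Bs), bottom_darts = concat (map bottom_darts Bs),
      inner_vertices = concat (map inner_vertices Bs)\<rparr>"

text \<open>\<open>A\<close> above \<open>B\<close>. Counterclockwise around the vertex at which they are joined come the darts of
  \<open>B\<close> from left to right and then those of \<open>A\<close> from right to left.\<close>

definition series :: "'e two_terminal \<Rightarrow> 'e two_terminal \<Rightarrow> 'e two_terminal" where
  "series A B =
     \<lparr>top_darts = top_darts A, bottom_darts = bottom_darts B,
      inner_vertices = (top_darts B @ rev (bottom_darts A)) # inner_vertices A @ inner_vertices B\<rparr>"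

text \<open>The plane graph, with unbounded face at the corner below the bottom vertex, that is, from its
  leftmost dart counterclockwise to its rightmost dart.\<close>

definition to_plane_map :: "'e two_terminal \<Rightarrow> 'e dart plane_map" where
  "to_plane_map B =
     (let vs = top_darts B # rev (bottom_darts B) # inner_vertices B;
          D = \<Union>(set ` set vs);
          r = foldr (\<lambda>v f. cycle_of_list v \<circ> f) vs id;
          a = (\<lambda>d. if d \<in> D then flip d else d)
      in \<lparr>darts = D, rot = r, opp = a, outer = orbit (a \<circ> r) (hd (bottom_darts B))\<rparr>)"

text \<open>
  The medial graph. The corner between \<open>d\<close> and \<open>rot d\<close> becomes the segment
  \<open>{(d, True), (rot d, False)}\<close>, so that \<open>(d, True)\<close> and \<open>(d, False)\<close> are the ends, at the midpoint
  of the edge of \<open>d\<close>, of the segments on the left and on the right of \<open>d\<close>. The corner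
  \<open>(d, True)\<close> of the universe lies in the black region around the vertex of \<open>d\<close>, and
  \<open>(d, False)\<close> lies in the face on the right of \<open>d\<close>, which contains the corner from \<open>inv (rot M) d\<close>
  to \<open>d\<close>.
\<close>

definition medial :: "'d plane_map \<Rightarrow> ('d \<times> bool) plane_map" where
  "medial M =
     \<lparr>darts = darts M \<times> UNIV,
      rot = (\<lambda>(d, b). if d \<in> darts M then (if b then (d, False) else (opp M d, True)) else (d, b)),
      opp = (\<lambda>(d, b). if d \<in> darts M
                      then (if b then (rot M d, False) else (inv (rot M) d, True)) else (d, b)),
      outer = (\<lambda>d. (rot M d, False)) ` outer M\<rparr>"

definition universe :: "'e two_terminal \<Rightarrow> ('e dart \<times> bool) plane_map" where
  "universe B = medial (to_plane_map B)"

definition crossing_of_edge :: "'e \<Rightarrow> ('e dart \<times> bool) set" where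
  "crossing_of_edge e = {Tail e, Head e} \<times> UNIV"

text \<open>The segment of the corner of the unbounded face at the bottom vertex.\<close>

definition lower_segment :: "'e two_terminal \<Rightarrow> ('e dart \<times> bool) set" where
  "lower_segment B = {(hd (bottom_darts B), True), (last (bottom_darts B), False)}"


section \<open>The three families\<close>

text \<open>Boxes and the edges in a box are numbered from 0. Edges are numbered from left to right in
  boxes of parallel edges, and along the direction of the path in the other boxes.\<close>

definition box_edges :: "nat \<Rightarrow> nat \<Rightarrow> (nat \<times> nat) list" where
  "box_edges i a = map (Pair i) [0..<a]"

text \<open>\<open>two_bridge_from i as\<close> consists of the boxes from number \<open>i\<close> on, with parameters \<open>as\<close>. Its
  top terminal is the current vertex before box \<open>i\<close> and its bottom terminal is $v$. Since the
  numbering starts from 0, the boxes of parallel edges are those with \<open>i\<close> even.\<close>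

fun two_bridge_from :: "nat \<Rightarrow> nat list \<Rightarrow> (nat \<times> nat) two_terminal" where
  "two_bridge_from i [a] =
     (if even i then multi_edge_box (box_edges i a) else path_box (box_edges i a))"
| "two_bridge_from i (a # b # as) =
     (if even i
      then parallel [multi_edge_box (box_edges i a), two_bridge_from (Suc i) (b # as)]
      else series (path_box (box_edges i a)) (two_bridge_from (Suc i) (b # as)))"

definition two_bridge :: "nat list \<Rightarrow> (nat \<times> nat) two_terminal" where
  "two_bridge as = two_bridge_from 0 as"

definition pretzel :: "nat list \<Rightarrow> (nat \<times> nat) two_terminal" where
  "pretzel bs = parallel (map (\<lambda>i. path_box (box_edges i (bs ! i))) [0..<length bs])"

text \<open>\<open>tangle_graph t cs i\<close> is the stage of the construction with boxes \<open>0, \<dots>, i\<close>; the edges are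
  tagged with the number \<open>t\<close> of the tangle.\<close>

definition tangle_box :: "nat \<Rightarrow> nat list \<Rightarrow> nat \<Rightarrow> (nat \<times> nat \<times> nat) two_terminal" where
  "tangle_box t cs i =
     (let es = map (Pair t) (box_edges i (cs ! i))
      in if even (length cs - Suc i) then path_box es else multi_edge_box es)"

primrec tangle_graph :: "nat \<Rightarrow> nat list \<Rightarrow> nat \<Rightarrow> (nat \<times> nat \<times> nat) two_terminal" where
  "tangle_graph t cs 0 = tangle_box t cs 0"
| "tangle_graph t cs (Suc i) =
     (if even (length cs - Suc (Suc i))
      then series (tangle_graph t cs i) (tangle_box t cs (Suc i))
      else parallel [tangle_graph t cs i, tangle_box t cs (Suc i)])"

text \<open>The edges of the twist box are \<open>(0, 0, j)\<close>; the tangles are numbered from 1.\<close>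

definition montesinos :: "nat \<Rightarrow> nat list list \<Rightarrow> (nat \<times> nat \<times> nat) two_terminal" where
  "montesinos k css =
     parallel (multi_edge_box (map (Pair 0) (box_edges 0 k)) #
       map (\<lambda>t. tangle_graph (Suc t) (css ! t) (length (css ! t) - 1)) [0..<length css])"


section \<open>The labelings\<close>

definition two_bridge_labeling ::
  "nat list \<Rightarrow> (((nat \<times> nat) dart \<times> bool) set \<Rightarrow> nat) \<Rightarrow> bool" where
  "two_bridge_labeling as l \<longleftrightarrow>
     ordered_labeling (universe (two_bridge as)) l \<and>
     (\<forall>i i' j j'. i < i' \<and> i' < length as \<and> j < as ! i \<and> j' < as ! i' \<longrightarrow>
        l (crossing_of_edge (i, j)) < l (crossing_of_edge (i', j'))) \<and>
     (\<forall>i j j'. i < length as \<and> j < j' \<and> j' < as ! i \<longrightarrow>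
        l (crossing_of_edge (i, j)) < l (crossing_of_edge (i, j')))"

definition pretzel_labeling ::
  "nat list \<Rightarrow> (((nat \<times> nat) dart \<times> bool) set \<Rightarrow> nat) \<Rightarrow> bool" where
  "pretzel_labeling bs l \<longleftrightarrow>
     ordered_labeling (universe (pretzel bs)) l \<and>
     (\<forall>i i' j j'. i < i' \<and> i' < length bs \<and> j < bs ! i \<and> j' < bs ! i' \<longrightarrow>
        l (crossing_of_edge (i, j)) < l (crossing_of_edge (i', j'))) \<and>
     (\<forall>j j'. j < j' \<and> j' < bs ! 0 \<longrightarrow>
        l (crossing_of_edge (0, j')) < l (crossing_of_edge (0, j))) \<and>
     (\<forall>i j j'. 0 < i \<and> i < length bs \<and> j < j' \<and> j' < bs ! i \<longrightarrow>
        l (crossing_of_edge (i, j)) < l (crossing_of_edge (i, j')))"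

definition montesinos_labeling ::
  "nat \<Rightarrow> nat list list \<Rightarrow> (((nat \<times> nat \<times> nat) dart \<times> bool) set \<Rightarrow> nat) \<Rightarrow> bool" where
  "montesinos_labeling k css l \<longleftrightarrow>
     ordered_labeling (universe (montesinos k css)) l \<and>
     (\<forall>j<k. l (crossing_of_edge (0, 0, j)) = Suc j) \<and>
     (\<forall>t t' i i' j j'. t < t' \<and> t' < length css \<and>
        i < length (css ! t) \<and> i' < length (css ! t') \<and> j < css ! t ! i \<and> j' < css ! t' ! i' \<longrightarrow>
        l (crossing_of_edge (Suc t, i, j)) < l (crossing_of_edge (Suc t', i', j'))) \<and>
     (\<forall>t i i' j j'. t < length css \<and> i < i' \<and> i' < length (css ! t) \<and>
        j < css ! t ! i \<and> j' < css ! t ! i' \<longrightarrow>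
        l (crossing_of_edge (Suc t, i, j)) < l (crossing_of_edge (Suc t, i', j'))) \<and>
     (\<forall>t i j j'. t < length css \<and> i < length (css ! t) \<and> j < j' \<and> j' < css ! t ! i \<longrightarrow>
        l (crossing_of_edge (Suc t, i, j)) < l (crossing_of_edge (Suc t, i, j')))"

end

theory Submission
  imports Defs "HOL-Library.Multiset"
begin

text \<open>
  All three families are series-parallel: the universe is encoded by a binary tree of series and
  parallel compositions whose leaves are the crossings with their four corners, and contracting two
  neighbouring leaves is the inverse of a bigon extension. Since every part of such a tree occupies an
  interval of labels, the two leaves carry consecutive labels, so it is enough to prove the EI-property
  for every tree of a suitable class that is closed under contraction; the induction ends at the Hopf
  link.

  A perfect matching restricted to a part leaves exactly one of the four external regions of the part
  (above, below, left, right) matched from inside. This side is the only thing the letter of an edge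
  needs to know about the inside of a part; about the outside, it needs to know whether the part of
  the cocycle (or, dually, of the cycle) that lies outside contains a label below those of the part.
  The EI-property holds as soon as at every leaf the side determines this bit, which is checked by
  propagating the possible pairs (side, bit) from the root to the leaves. Planar duality exchanges
  series and parallel, so that both trees of a double spanning tree are treated at once.
\<close>

section \<open>Series-parallel trees\<close>

text \<open>A label outside a part is below all labels of the part or above all of them, which is
  why one bit suffices for the outside. The induction is stated for arbitrary trees with compatible
  labels and contexts, so nothing has to be known about the family to which a contracted tree
  belongs. The obstacle is the unbounded region: it touches both the \<open>West\<close> and the
  \<open>East\<close> side of the whole diagram, so the dual graph of the whole has its two
  terminals identified, whereas inside each of the parts that follow \<open>West\<close> and
  \<open>East\<close> are different regions. Hence the root is always a parallel node, its two
  children are treated as separate graphs with terminals, and in the dual the whole is connected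
  when every vertex merely reaches a terminal. The choice of the lower segment deletes the
  \<open>South\<close> region and the unbounded region. Only \<open>North\<close> can then be
  matched from inside at the root, and no label lies outside it; this is the origin of the root
  context \<open>{(North, False)}\<close>.\<close>

datatype side = North | West | South | East

datatype kind = Par | Ser

datatype 'a sp = Leaf 'a | Node kind bool "'a sp" "'a sp"

text \<open>In a node \<open>Node k f A B\<close> the part \<open>A\<close> lies to the left of \<open>B\<close> or above \<open>B\<close>; the side \<open>out k\<close>
  of \<open>A\<close> is glued to the side \<open>inn k\<close> of \<open>B\<close>. The flag \<open>f\<close> tells whether the labels of \<open>B\<close> are
  the lower ones.\<close>

primrec inn :: "kind \<Rightarrow> side" where
  "inn Par = West" | "inn Ser = North"

primrec out :: "kind \<Rightarrow> side" where
  "out Par = East" | "out Ser = South"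

primrec leaves :: "'a sp \<Rightarrow> 'a set" where
  "leaves (Leaf q) = {q}"
| "leaves (Node k f A B) = leaves A \<union> leaves B"

primrec order_ok :: "('a \<Rightarrow> nat) \<Rightarrow> 'a sp \<Rightarrow> bool" where
  "order_ok l (Leaf q) \<longleftrightarrow> True"
| "order_ok l (Node k f A B) \<longleftrightarrow>
     (\<forall>a\<in>leaves A. \<forall>b\<in>leaves B. if f then l b < l a else l a < l b) \<and>
     order_ok l A \<and> order_ok l B"

lemma side_all: "(\<forall>x. P x) \<longleftrightarrow> P North \<and> P West \<and> P South \<and> P East"
  by (metis side.exhaust)

lemma inn_neq_out [simp]: "inn k \<noteq> out k'" "out k' \<noteq> inn k"
  by (cases k; cases k'; simp)+

lemma inn_eq_iff [simp]: "inn k = inn k' \<longleftrightarrow> k = k'" and out_eq_iff [simp]: "out k = out k' \<longleftrightarrow> k = k'"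
  by (cases k; cases k'; simp)+

lemma leaves_nonempty [simp]: "leaves t \<noteq> {}"
  by (induction t) auto

lemma finite_leaves [simp]: "finite (leaves t)"
  by (induction t) auto


section \<open>Matchings and letters on series-parallel trees\<close>

text \<open>A leaf \<open>q\<close> is a crossing with corners \<open>q x\<close>, and \<open>M\<close> is a set of corners. The relation says
  that \<open>M\<close> has exactly one corner at each leaf and at each inner region, and that the remaining
  corner lies in the external region on the side \<open>y\<close>.\<close>

primrec state :: "'d set \<Rightarrow> (side \<Rightarrow> 'd) sp \<Rightarrow> side \<Rightarrow> bool" where
  "state M (Leaf q) y \<longleftrightarrow> (\<forall>x. q x \<in> M \<longleftrightarrow> x = y)"
| "state M (Node k f A B) y \<longleftrightarrow>
     state M A (out k) \<and> state M B y \<and> y \<noteq> inn k \<or> state M B (inn k) \<and> state M A y \<and> y \<noteq> out k"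

text \<open>The kind \<open>K\<close> is \<open>Ser\<close> for the checkerboard graph and \<open>Par\<close> for its dual: it is the kind of
  the nodes at which the parts are joined in series. With terminals \<open>inn K\<close> and \<open>out K\<close>, \<open>conn\<close>
  says that the edges \<open>F\<close> connect all vertices, and \<open>reach\<close> that they connect each vertex to a
  terminal.\<close>

fun conn reach :: "kind \<Rightarrow> 'a set \<Rightarrow> 'a sp \<Rightarrow> bool" where
  "conn K F (Leaf q) \<longleftrightarrow> q \<in> F"
| "conn K F (Node k f A B) \<longleftrightarrow>
     (if k = K then conn K F A \<and> conn K F B
      else conn K F A \<and> reach K F B \<or> reach K F A \<and> conn K F B)"
| "reach K F (Leaf q) \<longleftrightarrow> True"
| "reach K F (Node k f A B) \<longleftrightarrow>
     (if k = K then conn K F A \<and> reach K F B \<or> reach K F A \<and> conn K F B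
      else reach K F A \<and> reach K F B)"

definition chosen :: "kind \<Rightarrow> (side \<Rightarrow> 'd) set \<Rightarrow> 'd set \<Rightarrow> (side \<Rightarrow> 'd) set" where
  "chosen K Q M = {q \<in> Q. q (inn K) \<in> M \<or> q (out K) \<in> M}"

section \<open>Connectivity of the edges chosen by a matching\<close>

lemma conn_reach: "conn K F t \<Longrightarrow> reach K F t"
  by (induction t) (auto split: if_splits)

lemma conn_reach_mono:
  assumes "F \<inter> leaves t \<subseteq> F'"
  shows "conn K F t \<Longrightarrow> conn K F' t" "reach K F t \<Longrightarrow> reach K F' t"
  using assms by (induction t) (auto split: if_splits)

lemma conn_cong: "F \<inter> leaves t = F' \<inter> leaves t \<Longrightarrow> conn K F t = conn K F' t"
  by (metis conn_reach_mono(1) inf_le1)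

lemma reach_cong: "F \<inter> leaves t = F' \<inter> leaves t \<Longrightarrow> reach K F t = reach K F' t"
  by (metis conn_reach_mono(2) inf_le1)

primrec disjoint_leaves :: "'a sp \<Rightarrow> bool" where
  "disjoint_leaves (Leaf q) \<longleftrightarrow> True"
| "disjoint_leaves (Node k f A B) \<longleftrightarrow>
     leaves A \<inter> leaves B = {} \<and> disjoint_leaves A \<and> disjoint_leaves B"

text \<open>A state on a terminal side belongs to a spanning tree of the part; a state on one of the
  other two sides belongs to a spanning forest with two components, one at each terminal. This is
  the connectivity half of that correspondence: the two alternatives in \<open>state\<close> produce
  the right combinations of \<open>conn\<close> and \<open>reach\<close> at each node.\<close>

lemma chosen_conn:
  assumes "state M t y" "leaves t \<subseteq> Q"
  shows "if y = inn K \<or> y = out K then conn K (chosen K Q M) t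
         else reach K (chosen K Q M) t \<and> \<not> conn K (chosen K Q M) t"
  using assms
proof (induction t arbitrary: y)
  case (Leaf q)
  then show ?case by (auto simp: chosen_def)
next
  case (Node k f A B)
  have *: "conn K (chosen K Q M) A \<Longrightarrow> reach K (chosen K Q M) A"
    "conn K (chosen K Q M) B \<Longrightarrow> reach K (chosen K Q M) B" by (simp_all add: conn_reach)
  from Node.prems consider
      "state M A (out k)" "state M B y" "y \<noteq> inn k" | "state M B (inn k)" "state M A y" "y \<noteq> out k"
    by auto
  then show ?case
  proof cases
    case 1
    with Node.IH(1)[of "out k"] Node.IH(2)[of y] Node.prems * show ?thesis
      by (cases k; cases K; cases y; simp)
  next
    case 2
    with Node.IH(1)[of y] Node.IH(2)[of "inn k"] Node.prems * show ?thesis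
      by (cases k; cases K; cases y; simp)
  qed
qed

text \<open>The acyclic half of the correspondence with trees and two-component forests: no chosen
  edge can be spared.\<close>

lemma chosen_minimal:
  assumes "state M t y" "leaves t \<subseteq> Q" "disjoint_leaves t" "e \<in> leaves t" "e \<in> chosen K Q M"
  shows "if y = inn K \<or> y = out K then \<not> conn K (chosen K Q M - {e}) t
         else \<not> reach K (chosen K Q M - {e}) t"
  using assms
proof (induction t arbitrary: y)
  case (Leaf q)
  then show ?case by (auto simp: chosen_def)
next
  case (Node k f A B)
  let ?F = "chosen K Q M"
  have r: "conn K G s \<Longrightarrow> reach K G s" for G and s :: "(side \<Rightarrow> 'a) sp" by (rule conn_reach)
  have sub: "leaves A \<subseteq> Q" "leaves B \<subseteq> Q" "disjoint_leaves A" "disjoint_leaves B"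
    using Node.prems by auto
  have other: "conn K (?F - {e}) s = conn K ?F s" "reach K (?F - {e}) s = reach K ?F s"
    if "e \<notin> leaves s" for s
    using that by (auto intro!: conn_cong reach_cong)
  from Node.prems consider
      "state M A (out k)" "state M B y" "y \<noteq> inn k" | "state M B (inn k)" "state M A y" "y \<noteq> out k"
    by auto
  then obtain a b where ab: "state M A a" "state M B b"
    "a = out k \<and> b = y \<and> y \<noteq> inn k \<or> b = inn k \<and> a = y \<and> y \<noteq> out k" by metis
  note c = chosen_conn[OF ab(1) sub(1), of K] chosen_conn[OF ab(2) sub(2), of K]
  show ?case
  proof (cases "e \<in> leaves A")
    case True
    then have "e \<notin> leaves B" using Node.prems(3) by auto
    note o = other[OF this] and i = Node.IH(1)[OF ab(1) sub(1,3) True Node.prems(5)]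
    show ?thesis using ab(3) c(2) o i r[of "?F - {e}" A] r[of ?F B]
      by (cases k; cases K; cases a; cases b; auto)
  next
    case False
    then have "e \<in> leaves B" using Node.prems(4) by auto
    note o = other[OF False] and i = Node.IH(2)[OF ab(2) sub(2,4) this Node.prems(5)]
    show ?thesis using ab(3) c(1) o i r[of "?F - {e}" B] r[of ?F A]
      by (cases k; cases K; cases a; cases b; auto)
  qed
qed

text \<open>The part itself is connected, so one of its edges joins the two components of the
  forest. It is found in the child that inherits the state \<open>y\<close>. This guarantees that a
  sibling in such a state really contributes an edge to a cocycle.\<close>

lemma chosen_completable:
  assumes "state M t y" "leaves t \<subseteq> Q" "y \<noteq> inn K" "y \<noteq> out K"
  shows "\<exists>f\<in>leaves t. conn K (insert f (chosen K Q M)) t"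
  using assms
proof (induction t arbitrary: y)
  case (Leaf q)
  then show ?case by auto
next
  case (Node k f A B)
  let ?F = "chosen K Q M"
  have sub: "leaves A \<subseteq> Q" "leaves B \<subseteq> Q"
    using Node.prems by auto
  have mono: "conn K ?F s \<Longrightarrow> conn K (insert g ?F) s" "reach K ?F s \<Longrightarrow> reach K (insert g ?F) s"
    for g and s :: "(side \<Rightarrow> 'a) sp"
    using conn_reach_mono[of ?F s "insert g ?F"] by auto
  from Node.prems(1) consider
      "state M A (out k)" "state M B y" "y \<noteq> inn k" | "state M B (inn k)" "state M A y" "y \<noteq> out k"
    by auto
  then show ?case
  proof cases
    case 1
    obtain g where g: "g \<in> leaves B" "conn K (insert g ?F) B"
      using Node.IH(2)[OF 1(2) sub(2) Node.prems(3,4)] by auto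
    have "conn K (insert g ?F) (Node k f A B)"
      using g(2) mono[of A g] chosen_conn[OF 1(1) sub(1), of K] by (cases k; cases K; simp)
    with g(1) show ?thesis by auto
  next
    case 2
    obtain g where g: "g \<in> leaves A" "conn K (insert g ?F) A"
      using Node.IH(1)[OF 2(2) sub(1) Node.prems(3,4)] by auto
    have "conn K (insert g ?F) (Node k f A B)"
      using g(2) mono[of B g] chosen_conn[OF 2(1) sub(2), of K] by (cases k; cases K; simp)
    with g(1) show ?thesis by auto
  qed
qed

text \<open>A context is a set of pairs \<open>(y, lo)\<close>: outside the subtree \<open>t\<close>, the matching may be such that
  \<open>t\<close> has state \<open>y\<close> and, if a cocycle leaves \<open>t\<close>, then \<open>lo\<close> tells whether it contains a label
  below those of \<open>t\<close>. The next definition gives the context of a part of a node whose sibling has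
  lower labels iff \<open>lo\<close> and which is glued to the sibling along \<open>g\<close>.\<close>

definition part_context :: "kind \<Rightarrow> side \<Rightarrow> bool \<Rightarrow> (side \<times> bool) set \<Rightarrow> (side \<times> bool) set" where
  "part_context k g lo C =
     {(y, u). (y, u) \<in> C \<and> (y = inn k \<or> y = out k)} \<union>
     {(y, lo \<or> u) |y u. (y, u) \<in> C \<and> y \<noteq> inn k \<and> y \<noteq> out k} \<union>
     {(g, lo) |z u. (z, u) \<in> C \<and> z \<noteq> inn k \<and> z \<noteq> out k}"

primrec context_ok :: "(side \<times> bool) set \<Rightarrow> 'a sp \<Rightarrow> bool" where
  "context_ok C (Leaf q) \<longleftrightarrow> (\<forall>y u u'. (y, u) \<in> C \<longrightarrow> (y, u') \<in> C \<longrightarrow> u = u')"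
| "context_ok C (Node k f A B) \<longleftrightarrow>
     context_ok (part_context k (out k) f C) A \<and> context_ok (part_context k (inn k) (\<not> f) C) B"

text \<open>\<open>lower_in\<close>: the cocycle of \<open>e\<close> contains a label below that of \<open>e\<close>, for a matching whose
  restriction to \<open>t\<close> has state \<open>y\<close> and chooses the edges \<open>F\<close>.\<close>

definition lower_in ::
  "kind \<Rightarrow> ('a \<Rightarrow> nat) \<Rightarrow> 'a set \<Rightarrow> 'a sp \<Rightarrow> side \<Rightarrow> bool \<Rightarrow> 'a \<Rightarrow> bool" where
  "lower_in K l F t y lo e \<longleftrightarrow>
     (if y = inn K \<or> y = out K
      then (\<exists>f\<in>leaves t. l f < l e \<and> conn K (insert f (F - {e})) t) \<or> lo \<and> reach K (F - {e}) t
      else \<exists>f\<in>leaves t. l f < l e \<and> reach K (insert f (F - {e})) t)"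

text \<open>The two parts of a node play symmetric roles; \<open>A\<close> is the part containing \<open>e\<close>, and \<open>gA\<close> and
  \<open>gB\<close> are the glued sides.\<close>

lemma lower_in_part:
  fixes F :: "'a set"
  assumes comb: "\<And>G. conn K G t \<longleftrightarrow> (if k = K then conn K G A \<and> conn K G B
      else conn K G A \<and> reach K G B \<or> reach K G A \<and> conn K G B)"
    "\<And>G. reach K G t \<longleftrightarrow> (if k = K then conn K G A \<and> reach K G B \<or> reach K G A \<and> conn K G B
      else reach K G A \<and> reach K G B)"
    and lv: "leaves t = leaves A \<union> leaves B" "leaves A \<inter> leaves B = {}"
    and g: "gA = inn k \<and> gB = out k \<or> gA = out k \<and> gB = inn k"
    and ab: "a = gA \<and> b = y \<and> y \<noteq> gB \<or> b = gB \<and> a = y \<and> y \<noteq> gA"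
    and cA: "if a = inn K \<or> a = out K then \<not> conn K (F - {e}) A else \<not> reach K (F - {e}) A"
    and cB: "if b = inn K \<or> b = out K then conn K F B else reach K F B \<and> \<not> conn K F B"
    and compl: "b \<noteq> inn K \<Longrightarrow> b \<noteq> out K \<Longrightarrow> \<exists>f\<in>leaves B. conn K (insert f F) B"
    and ord: "\<And>f. f \<in> leaves B \<Longrightarrow> l f < l e \<longleftrightarrow> low"
    and e: "e \<in> leaves A" and C: "(y, lo) \<in> C"
  shows "\<exists>u. (a, u) \<in> part_context k gA low C \<and> lower_in K l F t y lo e = lower_in K l F A a u e"
proof -
  have r: "conn K G s \<Longrightarrow> reach K G s" for G and s :: "'a sp" by (rule conn_reach)
  have eB: "e \<notin> leaves B" using lv e by auto
  have B: "conn K (F - {e}) B = conn K F B" "reach K (F - {e}) B = reach K F B"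
    using eB by (auto intro!: conn_cong reach_cong)
  have BA: "conn K (insert f (F - {e})) B = conn K F B" "reach K (insert f (F - {e})) B = reach K F B"
    if "f \<in> leaves A" for f
    using eB lv that by (auto intro!: conn_cong reach_cong)
  have BB: "conn K (insert f (F - {e})) B = conn K (insert f F) B"
    "reach K (insert f (F - {e})) B = reach K (insert f F) B"
    "reach K F B \<Longrightarrow> reach K (insert f F) B" "conn K F B \<Longrightarrow> conn K (insert f F) B"
    if "f \<in> leaves B" for f
    using eB lv that conn_reach_mono[of F B "insert f F"] by (auto intro!: conn_cong reach_cong)
  have AB: "conn K (insert f (F - {e})) A = conn K (F - {e}) A"
     "reach K (insert f (F - {e})) A = reach K (F - {e}) A"
    if "f \<in> leaves B" for f
    using lv that by (auto intro!: conn_cong reach_cong)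
  let ?ct = "\<lambda>z. z = inn K \<or> z = out K"
  have split: "(\<exists>f\<in>leaves t. P f) \<longleftrightarrow> (\<exists>f\<in>leaves A. P f) \<or> (\<exists>f\<in>leaves B. P f)" for P
    using lv by auto
  have rA: "\<And>f. conn K (insert f (F - {e})) A \<Longrightarrow> reach K (insert f (F - {e})) A"
    "conn K (F - {e}) A \<Longrightarrow> reach K (F - {e}) A" "conn K F B \<Longrightarrow> reach K F B"
    using r by auto
  have low: "(\<exists>f\<in>leaves B. l f < l e \<and> P f) \<longleftrightarrow> low \<and> (\<exists>f\<in>leaves B. P f)" for P
    using ord by auto
  \<comment> \<open>The three cases are the three sets in \<open>part_context\<close>, valid
    whenever the bit matters at all. If the part takes the glued side and the sibling a side away
    from the gluing direction, the cocycle meets the sibling but stays inside the node. If both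
    parts share the state \<open>inn k\<close> or \<open>out k\<close>, the sibling contributes
    nothing. Otherwise the sibling and the outside both contribute.\<close>
  define u where "u = (if a = gA \<and> b \<noteq> inn k \<and> b \<noteq> out k then low
    else if y = inn k \<or> y = out k then lo else low \<or> lo)"
  have "(a, u) \<in> part_context k gA low C"
    using ab C g unfolding part_context_def u_def by auto
  moreover have "lower_in K l F t y lo e = lower_in K l F A a u e"
  proof -
    let ?EC = "\<exists>f\<in>leaves A. l f < l e \<and> conn K (insert f (F - {e})) A"
    let ?ER = "\<exists>f\<in>leaves A. l f < l e \<and> reach K (insert f (F - {e})) A"
    let ?R = "reach K (F - {e}) A"
    let ?b = "b = inn K \<or> b = out K"
    have nA: "\<not> conn K (F - {e}) A" using cA rA(2) by (auto split: if_splits)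
    have cb: "conn K F B \<longleftrightarrow> ?b" "reach K F B" using cB rA(3) by (auto split: if_splits)
    obtain f0 where f0: "f0 \<in> leaves B" using leaves_nonempty[of B] by (metis all_not_in_conv)
    \<comment> \<open>If the sibling is already connected, any of its edges will do; otherwise the
      two components of its forest are joined.\<close>
    have ex: "\<exists>f\<in>leaves B. conn K (insert f F) B"
    proof (cases ?b)
      case True
      then show ?thesis using f0 cb(1) BB(4) by blast
    qed (use compl in blast)
    have ex': "\<exists>f\<in>leaves B. reach K (insert f F) B" using f0 BB(3) cb(2) by blast
    have 4: "conn K (insert f (F - {e})) A \<and> reach K F B \<or>
        reach K (insert f (F - {e})) A \<and> conn K F B \<longleftrightarrow>
        (if ?b then reach K (insert f (F - {e})) A else conn K (insert f (F - {e})) A)" for f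
      using r[of "insert f (F - {e})" A] cb by auto
    have if_ex: "(\<exists>f\<in>leaves A. l f < l e \<and> (if c then P f else P' f)) \<longleftrightarrow>
        (if c then \<exists>f\<in>leaves A. l f < l e \<and> P f else \<exists>f\<in>leaves A. l f < l e \<and> P' f)"
      for c P P' by auto
    have 1: "(\<exists>f\<in>leaves t. l f < l e \<and> conn K (insert f (F - {e})) t) \<longleftrightarrow>
      (if k = K then ?EC \<and> ?b else (if ?b then ?ER else ?EC) \<or> low \<and> ?R)"
    proof (cases "k = K")
      case True
      show ?thesis unfolding split low comb using True nA cb
        by (auto simp: BA BB(1,2) AB)
    next
      case False
      have "(\<exists>f\<in>leaves A. l f < l e \<and> conn K (insert f (F - {e})) t) \<longleftrightarrow> (if ?b then ?ER else ?EC)"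
        unfolding comb if_ex[symmetric] 4[symmetric] using False by (simp add: BA cong: bex_cong conj_cong)
      moreover have "(\<exists>f\<in>leaves B. conn K (insert f (F - {e})) t) \<longleftrightarrow> ?R"
        unfolding comb using False nA ex by (auto simp add: BB(1,2) AB)
      ultimately show ?thesis unfolding split low using False by simp
    qed
    have 2: "(\<exists>f\<in>leaves t. l f < l e \<and> reach K (insert f (F - {e})) t) \<longleftrightarrow>
      (if k = K then (if ?b then ?ER else ?EC) \<or> low \<and> ?R else ?ER \<or> low \<and> ?R)"
    proof (cases "k = K")
      case True
      have "(\<exists>f\<in>leaves A. l f < l e \<and> reach K (insert f (F - {e})) t) \<longleftrightarrow> (if ?b then ?ER else ?EC)"
        unfolding comb if_ex[symmetric] 4[symmetric] using True by (simp add: BA cong: bex_cong conj_cong)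
      moreover have "(\<exists>f\<in>leaves B. reach K (insert f (F - {e})) t) \<longleftrightarrow> ?R"
        unfolding comb using True nA ex by (auto simp add: BB(1,2) AB)
      ultimately show ?thesis unfolding split low using True by simp
    next
      case False
      have "(\<exists>f\<in>leaves A. l f < l e \<and> reach K (insert f (F - {e})) t) \<longleftrightarrow> ?ER"
        unfolding comb using False cb(2) by (simp add: BA cong: bex_cong conj_cong)
      moreover have "(\<exists>f\<in>leaves B. reach K (insert f (F - {e})) t) \<longleftrightarrow> ?R"
        unfolding comb using False ex' by (auto simp add: BB(1,2) AB)
      ultimately show ?thesis unfolding split low using False by simp
    qed
    have 3: "reach K (F - {e}) t \<longleftrightarrow> ?R \<and> (k = K \<longrightarrow> ?b)"
      unfolding comb(2)[of "F - {e}"] B using nA cb by auto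
    \<comment> \<open>For a part whose state lies off the terminals, deleting \<open>e\<close> cuts
      a piece off from both terminals, so nothing outside can repair it and the outside bit is
      irrelevant.\<close>
    have R: "?R \<longrightarrow> a = inn K \<or> a = out K" using cA by (auto split: if_splits)
    show ?thesis
      unfolding lower_in_def 1 2 3 u_def using ab g R
      by (cases k; cases K; cases y) auto
  qed
  ultimately show ?thesis by blast
qed


text \<open>The question is passed down by \<open>lower_in_part\<close> from each node to the child
  containing \<open>e\<close>. At the leaf \<open>e\<close> both matchings use the same corner
  \<open>e x\<close>, so both states are \<open>x\<close>, and \<open>context_ok\<close> makes the
  two bits agree.\<close>

lemma lower_in_unique:
  fixes t :: "(side \<Rightarrow> 'd) sp"
  assumes "context_ok C t" "order_ok l t" "disjoint_leaves t" "leaves t \<subseteq> Q"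
    "state M t y" "(y, lo) \<in> C" "state M' t y'" "(y', lo') \<in> C"
    "e \<in> leaves t" "e x \<in> M" "e x \<in> M'" "x = inn K \<or> x = out K"
  shows "lower_in K l (chosen K Q M) t y lo e = lower_in K l (chosen K Q M') t y' lo' e"
  using assms
proof (induction t arbitrary: C y lo y' lo')
  case (Leaf q)
  then have "y = x" "y' = x" by auto
  with Leaf have "lo = lo'" by auto
  with \<open>y = x\<close> \<open>y' = x\<close> Leaf show ?case by (auto simp: lower_in_def)
next
  case (Node k f A B)
  let ?t = "Node k f A B"
  have sub: "leaves A \<subseteq> Q" "leaves B \<subseteq> Q" "disjoint_leaves A" "disjoint_leaves B"
    "order_ok l A" "order_ok l B"
    and lv: "leaves ?t = leaves A \<union> leaves B" "leaves A \<inter> leaves B = {}"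
      "leaves ?t = leaves B \<union> leaves A" "leaves B \<inter> leaves A = {}"
    using Node.prems(2-4) by auto
  have chosen: "e \<in> chosen K Q N" if "e x \<in> N" for N
    using that Node.prems(4,9,12) unfolding chosen_def by auto
  have parts: "\<exists>a b. state N A a \<and> state N B b \<and>
      (a = out k \<and> b = z \<and> z \<noteq> inn k \<or> b = inn k \<and> a = z \<and> z \<noteq> out k)"
    if "state N ?t z" for N z using that by auto
  have combA: "conn K G ?t \<longleftrightarrow> (if k = K then conn K G A \<and> conn K G B
      else conn K G A \<and> reach K G B \<or> reach K G A \<and> conn K G B)"
    "reach K G ?t \<longleftrightarrow> (if k = K then conn K G A \<and> reach K G B \<or> reach K G A \<and> conn K G B
      else reach K G A \<and> reach K G B)"
    and combB: "conn K G ?t \<longleftrightarrow> (if k = K then conn K G B \<and> conn K G A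
      else conn K G B \<and> reach K G A \<or> reach K G B \<and> conn K G A)"
    "reach K G ?t \<longleftrightarrow> (if k = K then conn K G B \<and> reach K G A \<or> reach K G B \<and> conn K G A
      else reach K G B \<and> reach K G A)" for G by auto
  show ?case
  proof (cases "e \<in> leaves A")
    case True
    have *: "\<exists>a u. state N A a \<and> (a, u) \<in> part_context k (out k) f C \<and>
       lower_in K l (chosen K Q N) ?t z lz e = lower_in K l (chosen K Q N) A a u e"
      if N: "state N ?t z" "(z, lz) \<in> C" "e x \<in> N" for N z lz
    proof -
      obtain a b where ab: "state N A a" "state N B b"
        "a = out k \<and> b = z \<and> z \<noteq> inn k \<or> b = inn k \<and> a = z \<and> z \<noteq> out k"
        using parts[OF N(1)] by blast
      have ord: "l g < l e \<longleftrightarrow> f" if "g \<in> leaves B" for g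
        proof -
        have "if f then l g < l e else l e < l g" using Node.prems(2) that True by simp
        then show ?thesis by (auto split: if_splits)
      qed
      have g: "out k = inn k \<and> inn k = out k \<or> out k = out k \<and> inn k = inn k" by simp
      have "\<exists>u. (a, u) \<in> part_context k (out k) f C \<and>
          lower_in K l (chosen K Q N) ?t z lz e = lower_in K l (chosen K Q N) A a u e"
        by (rule lower_in_part[OF combA lv(1,2) g ab(3)
              chosen_minimal[OF ab(1) sub(1,3) True chosen[OF N(3)]]
              chosen_conn[OF ab(2) sub(2)] _ _ True N(2)])
          (rule chosen_completable[OF ab(2) sub(2)] ord; assumption)+
      then show ?thesis using ab(1) by blast
    qed
    obtain a u where 1: "state M A a" "(a, u) \<in> part_context k (out k) f C"
      "lower_in K l (chosen K Q M) ?t y lo e = lower_in K l (chosen K Q M) A a u e"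
      using *[OF Node.prems(5,6,10)] by blast
    obtain a' u' where 2: "state M' A a'" "(a', u') \<in> part_context k (out k) f C"
      "lower_in K l (chosen K Q M') ?t y' lo' e = lower_in K l (chosen K Q M') A a' u' e"
      using *[OF Node.prems(7,8,11)] by blast
    show ?thesis
      using Node.IH(1)[OF _ sub(5,3,1) 1(1,2) 2(1,2) True Node.prems(10-12)] Node.prems(1) 1(3) 2(3)
      by simp
  next
    case False
    then have e: "e \<in> leaves B" using Node.prems(9) by simp
    have *: "\<exists>a u. state N B a \<and> (a, u) \<in> part_context k (inn k) (\<not> f) C \<and>
       lower_in K l (chosen K Q N) ?t z lz e = lower_in K l (chosen K Q N) B a u e"
      if N: "state N ?t z" "(z, lz) \<in> C" "e x \<in> N" for N z lz
    proof -
      obtain a b where ab: "state N A a" "state N B b"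
        "b = inn k \<and> a = z \<and> z \<noteq> out k \<or> a = out k \<and> b = z \<and> z \<noteq> inn k"
        using parts[OF N(1)] by blast
      have ord: "l g < l e \<longleftrightarrow> \<not> f" if "g \<in> leaves A" for g
        proof -
        have "if f then l e < l g else l g < l e" using Node.prems(2) that e by simp
        then show ?thesis by (auto split: if_splits)
      qed
      have g: "inn k = inn k \<and> out k = out k \<or> inn k = out k \<and> out k = inn k" by simp
      have "\<exists>u. (b, u) \<in> part_context k (inn k) (\<not> f) C \<and>
          lower_in K l (chosen K Q N) ?t z lz e = lower_in K l (chosen K Q N) B b u e"
        by (rule lower_in_part[OF combB lv(3,4) g ab(3)
              chosen_minimal[OF ab(2) sub(2,4) e chosen[OF N(3)]]
              chosen_conn[OF ab(1) sub(1)] _ _ e N(2)])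
          (rule chosen_completable[OF ab(1) sub(1)] ord; assumption)+
      then show ?thesis using ab(2) by blast
    qed
    obtain a u where 1: "state M B a" "(a, u) \<in> part_context k (inn k) (\<not> f) C"
      "lower_in K l (chosen K Q M) ?t y lo e = lower_in K l (chosen K Q M) B a u e"
      using *[OF Node.prems(5,6,10)] by blast
    obtain a' u' where 2: "state M' B a'" "(a', u') \<in> part_context k (inn k) (\<not> f) C"
      "lower_in K l (chosen K Q M') ?t y' lo' e = lower_in K l (chosen K Q M') B a' u' e"
      using *[OF Node.prems(7,8,11)] by blast
    show ?thesis
      using Node.IH(2)[OF _ sub(6,4,2) 1(1,2) 2(1,2) e Node.prems(10-12)] Node.prems(1) 1(3) 2(3)
      by simp
  qed
qed

section \<open>Connectivity of a union of two graphs\<close>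

definition con :: "('v \<times> 'v) set \<Rightarrow> 'v set \<Rightarrow> bool" where
  "con E V \<longleftrightarrow> (\<forall>x\<in>V. \<forall>y\<in>V. (x, y) \<in> E\<^sup>*)"

text \<open>For symmetric \<open>E\<close> this is connectivity after identifying \<open>s\<close>
  with \<open>t\<close>; it is the graph-theoretic counterpart of \<open>reach\<close>.\<close>

definition cov :: "('v \<times> 'v) set \<Rightarrow> 'v set \<Rightarrow> 'v \<Rightarrow> 'v \<Rightarrow> bool" where
  "cov E V s t \<longleftrightarrow> (\<forall>x\<in>V. (x, s) \<in> E\<^sup>* \<or> (x, t) \<in> E\<^sup>*)"

lemma rtrancl_sym: "sym E \<Longrightarrow> (x, y) \<in> E\<^sup>* \<Longrightarrow> (y, x) \<in> E\<^sup>*"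
  by (metis sym_rtrancl symD)

lemma rtrancl_within: "(x, y) \<in> E\<^sup>* \<Longrightarrow> x \<in> V \<Longrightarrow> E \<subseteq> V \<times> V \<Longrightarrow> y \<in> V"
  by (induction rule: rtrancl_induct) auto

lemma rtrancl_Un_mono: "(x, y) \<in> A\<^sup>* \<Longrightarrow> (x, y) \<in> (A \<union> B)\<^sup>*" "(x, y) \<in> B\<^sup>* \<Longrightarrow> (x, y) \<in> (A \<union> B)\<^sup>*"
  by (meson in_mono rtrancl_mono sup_ge1 sup_ge2)+

text \<open>Up to its first step in \<open>B\<close> the path runs inside \<open>A\<close>, and the
  vertex at which it takes that step belongs to both vertex sets.\<close>

lemma rtrancl_Un_exit:
  assumes "(x, y) \<in> (A \<union> B)\<^sup>*" "x \<in> VA" "A \<subseteq> VA \<times> VA" "B \<subseteq> VB \<times> VB"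
  shows "(x, y) \<in> A\<^sup>* \<or> (\<exists>z\<in>VA \<inter> VB. (x, z) \<in> A\<^sup>*)"
  using assms(1)
proof (induction rule: rtrancl_induct)
  case (step y w)
  then consider "(x, y) \<in> A\<^sup>*" "(y, w) \<in> A" | "(x, y) \<in> A\<^sup>*" "(y, w) \<in> B" | "\<exists>z\<in>VA \<inter> VB. (x, z) \<in> A\<^sup>*"
    by blast
  then show ?case
  proof cases
    case 2
    then show ?thesis using rtrancl_within[OF 2(1) assms(2,3)] assms(4) by blast
  qed (auto intro: rtrancl.rtrancl_into_rtrancl)
qed simp

text \<open>With a single common vertex, every excursion into \<open>B\<close> starts and ends at
  \<open>m\<close> and can be cut out; a path that ends in \<open>B\<close> must have passed through
  \<open>m\<close>.\<close>

lemma rtrancl_Un_through: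
  assumes "(x, y) \<in> (A \<union> B)\<^sup>*" "x \<in> VA" "A \<subseteq> VA \<times> VA" "B \<subseteq> VB \<times> VB" "VA \<inter> VB \<subseteq> {m}"
  shows "(y \<in> VA \<longrightarrow> (x, y) \<in> A\<^sup>*) \<and> (y \<in> VB \<longrightarrow> (x, m) \<in> A\<^sup>*)"
  using assms(1)
proof (induction rule: rtrancl_induct)
  case base
  then show ?case using assms(2,5) by auto
next
  case (step y w)
  from step(2) consider "(y, w) \<in> A" | "(y, w) \<in> B" by auto
  then show ?case
  proof cases
    case 1
    then have "y \<in> VA" "w \<in> VA" using assms(3) by auto
    then have "(x, w) \<in> A\<^sup>*" using step(3) 1 by (meson rtrancl.rtrancl_into_rtrancl)
    then show ?thesis using \<open>w \<in> VA\<close> assms(5) by auto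
  next
    case 2
    then have "y \<in> VB" "w \<in> VB" using assms(4) by auto
    then show ?thesis using step(3) assms(5) by auto
  qed
qed

text \<open>A path can change from one graph to the other only at \<open>s\<close> or
  \<open>t\<close>. If the union is connected, a connection from \<open>s\<close> to
  \<open>t\<close> exists inside one of the two graphs; that graph is connected, and the other only
  has to be covered from the terminals.\<close>

lemma con_cov_parallel:
  assumes "sym A" "sym B" "A \<subseteq> VA \<times> VA" "B \<subseteq> VB \<times> VB" "VA \<inter> VB \<subseteq> {s, t}"
    "s \<in> VA" "t \<in> VA" "s \<in> VB" "t \<in> VB"
  shows "con (A \<union> B) (VA \<union> VB) \<longleftrightarrow> con A VA \<and> cov B VB s t \<or> cov A VA s t \<and> con B VB"
    and "cov (A \<union> B) (VA \<union> VB) s t \<longleftrightarrow> cov A VA s t \<and> cov B VB s t"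
proof -
  let ?U = "(A \<union> B)\<^sup>*"
  have AU: "(x, y) \<in> A\<^sup>* \<Longrightarrow> (x, y) \<in> ?U" and BU: "(x, y) \<in> B\<^sup>* \<Longrightarrow> (x, y) \<in> ?U" for x y
    by (rule rtrancl_Un_mono; assumption)+
  have symU: "(x, y) \<in> ?U \<Longrightarrow> (y, x) \<in> ?U" for x y
    using assms(1,2) by (meson rtrancl_sym sym_Un)
  have exA: "(x, s) \<in> A\<^sup>* \<or> (x, t) \<in> A\<^sup>*" if "(x, s) \<in> ?U \<or> (x, t) \<in> ?U" "x \<in> VA" for x
    using that rtrancl_Un_exit[OF _ that(2) assms(3,4)] assms(5) by blast
  have exB: "(x, s) \<in> B\<^sup>* \<or> (x, t) \<in> B\<^sup>*" if "(x, s) \<in> ?U \<or> (x, t) \<in> ?U" "x \<in> VB" for x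
    using that rtrancl_Un_exit[of x _ B A VB VA] assms(3-5) by (auto simp: Un_commute Int_commute)
  show cov: "cov (A \<union> B) (VA \<union> VB) s t \<longleftrightarrow> cov A VA s t \<and> cov B VB s t"
    unfolding cov_def using exA exB AU BU by blast
  \<comment> \<open>Until \<open>t\<close> is reached, \<open>s\<close> is the only common vertex on
    offer, so edges of the two graphs need never be combined.\<close>
  have st: "(s, t) \<in> A\<^sup>* \<or> (s, t) \<in> B\<^sup>*" if "(s, t) \<in> ?U"
  proof (rule ccontr)
    assume n: "\<not> ?thesis"
    have "(s, y) \<in> A\<^sup>* \<or> (s, y) \<in> B\<^sup>*" if "(s, y) \<in> ?U" for y
      using that
    proof (induction rule: rtrancl_induct)
      case (step y w)
      show ?case
      proof (cases "y \<in> VA \<inter> VB")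
        case True
        then have "y = s" using n step(3) assms(5) by auto
        then show ?thesis using step(2) by auto
      next
        case False
        have "(s, y) \<in> A\<^sup>* \<Longrightarrow> y \<in> VA" "(s, y) \<in> B\<^sup>* \<Longrightarrow> y \<in> VB"
          using rtrancl_within assms by metis+
        then show ?thesis
          using False step(2,3) assms(3,4) by (auto intro: rtrancl.rtrancl_into_rtrancl)
      qed
    qed simp
    with that n show False by blast
  qed
  have conI: "con (A \<union> B) (VA \<union> VB)" if "(s, t) \<in> ?U" "cov (A \<union> B) (VA \<union> VB) s t"
  proof -
    have "(x, s) \<in> ?U" if "x \<in> VA \<union> VB" for x
      using that \<open>cov _ _ _ _\<close> \<open>(s, t) \<in> ?U\<close> symU unfolding cov_def by (meson rtrancl_trans)
    then show ?thesis unfolding con_def using symU by (meson rtrancl_trans)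
  qed
  have conA: "con A VA" if "(s, t) \<in> A\<^sup>*" "cov A VA s t"
  proof -
    have "(x, s) \<in> A\<^sup>*" if "x \<in> VA" for x
      using that \<open>cov _ _ _ _\<close> \<open>(s, t) \<in> A\<^sup>*\<close> rtrancl_sym[OF assms(1)] unfolding cov_def
      by (meson rtrancl_trans)
    then show ?thesis unfolding con_def using rtrancl_sym[OF assms(1)] by (meson rtrancl_trans)
  qed
  have conB: "con B VB" if "(s, t) \<in> B\<^sup>*" "cov B VB s t"
  proof -
    have "(x, s) \<in> B\<^sup>*" if "x \<in> VB" for x
      using that \<open>cov _ _ _ _\<close> \<open>(s, t) \<in> B\<^sup>*\<close> rtrancl_sym[OF assms(2)] unfolding cov_def
      by (meson rtrancl_trans)
    then show ?thesis unfolding con_def using rtrancl_sym[OF assms(2)] by (meson rtrancl_trans)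
  qed
  have ccA: "con A VA \<Longrightarrow> cov A VA s t \<and> (s, t) \<in> A\<^sup>*" and ccB: "con B VB \<Longrightarrow> cov B VB s t \<and> (s, t) \<in> B\<^sup>*"
    unfolding con_def cov_def using assms by blast+
  show "con (A \<union> B) (VA \<union> VB) \<longleftrightarrow> con A VA \<and> cov B VB s t \<or> cov A VA s t \<and> con B VB" (is "?l \<longleftrightarrow> ?r")
  proof
    assume ?l
    then have "cov (A \<union> B) (VA \<union> VB) s t" "(s, t) \<in> ?U"
      unfolding con_def cov_def using assms by blast+
    then show ?r using st conA conB cov by blast
  next
    assume ?r
    then show ?l using ccA ccB conI cov AU BU by blast
  qed
qed

text \<open>Here \<open>m\<close> is a cut vertex. For \<open>cov\<close>, the vertex
  \<open>m\<close> itself is linked to \<open>s\<close> or to \<open>t\<close>; the graph on that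
  side is then connected, while the other may consist of two pieces.\<close>

lemma con_cov_series:
  assumes "sym A" "sym B" "A \<subseteq> VA \<times> VA" "B \<subseteq> VB \<times> VB" "VA \<inter> VB \<subseteq> {m}"
    "m \<in> VA" "m \<in> VB" "s \<in> VA" "t \<in> VB"
  shows "con (A \<union> B) (VA \<union> VB) \<longleftrightarrow> con A VA \<and> con B VB"
    and "cov (A \<union> B) (VA \<union> VB) s t \<longleftrightarrow> con A VA \<and> cov B VB m t \<or> cov A VA s m \<and> con B VB"
proof -
  let ?U = "(A \<union> B)\<^sup>*"
  have AU: "(x, y) \<in> A\<^sup>* \<Longrightarrow> (x, y) \<in> ?U" and BU: "(x, y) \<in> B\<^sup>* \<Longrightarrow> (x, y) \<in> ?U" for x y
    by (rule rtrancl_Un_mono; assumption)+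
  have symU: "(x, y) \<in> ?U \<Longrightarrow> (y, x) \<in> ?U" for x y
    using assms(1,2) by (meson rtrancl_sym sym_Un)
  note sA = rtrancl_sym[OF assms(1)] and sB = rtrancl_sym[OF assms(2)]
  have thA: "(y \<in> VA \<longrightarrow> (x, y) \<in> A\<^sup>*) \<and> (y \<in> VB \<longrightarrow> (x, m) \<in> A\<^sup>*)" if "(x, y) \<in> ?U" "x \<in> VA" for x y
    using rtrancl_Un_through[OF that assms(3-5)] .
  have thB: "(y \<in> VB \<longrightarrow> (x, y) \<in> B\<^sup>*) \<and> (y \<in> VA \<longrightarrow> (x, m) \<in> B\<^sup>*)" if "(x, y) \<in> ?U" "x \<in> VB" for x y
    using rtrancl_Un_through[of x y B A VB VA m] that assms by (simp add: Un_commute Int_commute)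
  show "con (A \<union> B) (VA \<union> VB) \<longleftrightarrow> con A VA \<and> con B VB" (is "?l \<longleftrightarrow> ?r")
  proof
    assume ?l then show ?r unfolding con_def using thA thB by blast
  next
    assume ?r
    then have "(x, m) \<in> ?U" if "x \<in> VA \<union> VB" for x
      using that assms AU BU unfolding con_def by blast
    then show ?l unfolding con_def using symU by (meson rtrancl_trans)
  qed
  show "cov (A \<union> B) (VA \<union> VB) s t \<longleftrightarrow> con A VA \<and> cov B VB m t \<or> cov A VA s m \<and> con B VB" (is "?l \<longleftrightarrow> ?r")
  proof
    assume l: ?l
    then have cA: "cov A VA s m" and cB: "cov B VB m t"
      unfolding cov_def using thA thB assms by blast+
    have "(m, s) \<in> ?U \<or> (m, t) \<in> ?U" using l assms unfolding cov_def by blast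
    then show ?r
    proof
      assume "(m, s) \<in> ?U"
      then have "(m, s) \<in> A\<^sup>*" using thA assms by blast
      then have "(x, m) \<in> A\<^sup>*" if "x \<in> VA" for x
        using cA that sA unfolding cov_def by (meson rtrancl_trans)
      then have "con A VA" unfolding con_def using sA by (meson rtrancl_trans)
      then show ?thesis using cB by blast
    next
      assume "(m, t) \<in> ?U"
      then have "(m, t) \<in> B\<^sup>*" using thB assms by blast
      then have "(x, m) \<in> B\<^sup>*" if "x \<in> VB" for x
        using cB that sB unfolding cov_def by (meson rtrancl_trans)
      then have "con B VB" unfolding con_def using sB by (meson rtrancl_trans)
      then show ?thesis using cA by blast
    qed
  next
    assume ?r
    then show ?l
    proof
      assume h: "con A VA \<and> cov B VB m t"
      then have a: "(x, s) \<in> ?U" "(x, m) \<in> ?U" if "x \<in> VA" for x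
        using that assms AU unfolding con_def by blast+
      show ?thesis unfolding cov_def
      proof
        fix x assume "x \<in> VA \<union> VB"
        then consider "x \<in> VA" | "(x, m) \<in> ?U" | "(x, t) \<in> ?U" using h BU unfolding cov_def by blast
        then show "(x, s) \<in> ?U \<or> (x, t) \<in> ?U" by cases (use a assms in \<open>blast intro: rtrancl_trans\<close>)+
      qed
    next
      assume h: "cov A VA s m \<and> con B VB"
      then have a: "(x, t) \<in> ?U" "(x, m) \<in> ?U" if "x \<in> VB" for x
        using that assms BU unfolding con_def by blast+
      show ?thesis unfolding cov_def
      proof
        fix x assume "x \<in> VA \<union> VB"
        then consider "x \<in> VB" | "(x, m) \<in> ?U" | "(x, s) \<in> ?U" using h AU unfolding cov_def by blast
        then show "(x, s) \<in> ?U \<or> (x, t) \<in> ?U" by cases (use a assms in \<open>blast intro: rtrancl_trans\<close>)+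
      qed
    qed
  qed
qed


section \<open>The regions of a series-parallel tree\<close>

primrec corners :: "(side \<Rightarrow> 'd) sp \<Rightarrow> 'd set" where
  "corners (Leaf q) = range q"
| "corners (Node k f A B) = corners A \<union> corners B"

primrec wf_sp :: "(side \<Rightarrow> 'd) sp \<Rightarrow> bool" where
  "wf_sp (Leaf q) \<longleftrightarrow> inj q"
| "wf_sp (Node k f A B) \<longleftrightarrow> corners A \<inter> corners B = {} \<and> wf_sp A \<and> wf_sp B"

text \<open>The corners in the external region on the side \<open>x\<close>, clockwise around the vertex (for \<open>North\<close>
  and \<open>South\<close>) or the face (for \<open>West\<close> and \<open>East\<close>).\<close>

fun bnd :: "side \<Rightarrow> (side \<Rightarrow> 'd) sp \<Rightarrow> 'd list" where
  "bnd x (Leaf q) = [q x]"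
| "bnd North (Node k f A B) = (if k = Par then bnd North B @ bnd North A else bnd North A)"
| "bnd South (Node k f A B) = (if k = Par then bnd South A @ bnd South B else bnd South B)"
| "bnd West (Node k f A B) = (if k = Par then bnd West A else bnd West A @ bnd West B)"
| "bnd East (Node k f A B) = (if k = Par then bnd East B else bnd East B @ bnd East A)"

primrec inner_faces :: "(side \<Rightarrow> 'd) sp \<Rightarrow> 'd list list" where
  "inner_faces (Leaf q) = []"
| "inner_faces (Node k f A B) =
     (bnd (out k) A @ bnd (inn k) B) # inner_faces A @ inner_faces B"

text \<open>The lists at \<open>North\<close> and \<open>South\<close> are the black regions of the
  two terminals. The \<open>West\<close> and \<open>East\<close> lists are joined because both sides
  border the unbounded region.\<close>

definition faces :: "(side \<Rightarrow> 'd) sp \<Rightarrow> 'd list list" where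
  "faces t = bnd North t # bnd South t # (bnd West t @ bnd East t) # inner_faces t"

lemma set_bnd_Node:
  "set (bnd x (Node k f A B)) =
     (if x = inn k then set (bnd x A) else if x = out k then set (bnd x B)
      else set (bnd x A) \<union> set (bnd x B))"
  by (cases x; cases k) auto

lemma bnd_nonempty [simp]: "bnd x t \<noteq> []"
proof (induction t)
  case (Node k f A B)
  then show ?case by (cases x; cases k) auto
qed simp

lemma corners_leaves: "corners t = (\<Union>q\<in>leaves t. range q)"
  by (induction t) auto

lemma bnd_type: "d \<in> set (bnd x t) \<Longrightarrow> \<exists>q\<in>leaves t. d = q x"
proof (induction t)
  case (Node k f A B)
  then show ?case unfolding set_bnd_Node by (auto split: if_splits)
qed simp

lemma bnd_subset: "set (bnd x t) \<subseteq> corners t"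
  using bnd_type unfolding corners_leaves by fastforce

lemma inner_faces_subset: "c \<in> set (inner_faces t) \<Longrightarrow> set c \<subseteq> corners t"
  using bnd_subset by (induction t) fastforce+

lemma wf_leaf_inj:
  "wf_sp t \<Longrightarrow> q \<in> leaves t \<Longrightarrow> q' \<in> leaves t \<Longrightarrow> q x = q' y \<Longrightarrow> q = q' \<and> x = y"
proof (induction t)
  case (Leaf p)
  then show ?case by (auto dest: injD)
next
  case (Node k f A B)
  have "q \<in> leaves s \<Longrightarrow> q x \<in> corners s" for s q and x :: side unfolding corners_leaves by blast
  then have "\<not> (q \<in> leaves A \<and> q' \<in> leaves B)" "\<not> (q \<in> leaves B \<and> q' \<in> leaves A)"
    using Node.prems by (metis disjoint_iff wf_sp.simps(2))+
  then show ?case using Node by auto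
qed

lemma wf_disjoint_leaves: "wf_sp t \<Longrightarrow> disjoint_leaves t"
proof (induction t)
  case (Node k f A B)
  have "leaves A \<inter> leaves B = {}"
    using Node.prems by (simp add: corners_leaves) blast
  then show ?case using Node by simp
qed simp

lemma corners_cover:
  "d \<in> corners t \<Longrightarrow> (\<exists>x. d \<in> set (bnd x t)) \<or> (\<exists>c\<in>set (inner_faces t). d \<in> set c)"
proof (induction t)
  case (Node k f A B)
  then consider (A) x where "d \<in> set (bnd x A)" | (B) x where "d \<in> set (bnd x B)" |
      "\<exists>c\<in>set (inner_faces A) \<union> set (inner_faces B). d \<in> set c" by auto
  then show ?case
  proof cases
    case (A x)
    then show ?thesis unfolding set_bnd_Node
      by (cases "x = out k") (auto intro: exI[of _ x])
  next
    case (B x)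
    then show ?thesis unfolding set_bnd_Node
      by (cases "x = inn k") (auto intro: exI[of _ x])
  qed auto
qed auto

lemma bnd_disjoint: "wf_sp t \<Longrightarrow> d \<in> set (bnd x t) \<Longrightarrow> d \<in> set (bnd y t) \<Longrightarrow> x = y"
  using bnd_type wf_leaf_inj by metis

lemma inner_bnd_disjoint:
  "wf_sp t \<Longrightarrow> c \<in> set (inner_faces t) \<Longrightarrow> d \<in> set c \<Longrightarrow> d \<notin> set (bnd x t)"
proof (induction t)
  case (Node k f A B)
  have sep: "d \<in> corners A \<Longrightarrow> d \<notin> corners B" using Node.prems(1) by auto
  have A: "d \<in> set (bnd x (Node k f A B)) \<Longrightarrow> d \<in> corners A \<Longrightarrow> d \<in> set (bnd x A) \<and> x \<noteq> out k"
    and B: "d \<in> set (bnd x (Node k f A B)) \<Longrightarrow> d \<in> corners B \<Longrightarrow> d \<in> set (bnd x B) \<and> x \<noteq> inn k"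
    using sep bnd_subset[of x A] bnd_subset[of x B] unfolding set_bnd_Node by (auto split: if_splits)
  from Node.prems consider "d \<in> set (bnd (out k) A)" | "d \<in> set (bnd (inn k) B)" |
    "c \<in> set (inner_faces A)" | "c \<in> set (inner_faces B)" by auto
  then show ?case
  proof cases
    case 1
    then have "d \<in> corners A" by (rule subsetD[OF bnd_subset])
    then show ?thesis using A 1 bnd_disjoint[of A d "out k" x] Node.prems(1) by auto
  next
    case 2
    then have "d \<in> corners B" by (rule subsetD[OF bnd_subset])
    then show ?thesis using B 2 bnd_disjoint[of B d "inn k" x] Node.prems(1) by auto
  next
    case 3
    then have "d \<in> corners A" using inner_faces_subset Node.prems(3) by blast
    then show ?thesis using A 3 Node by auto
  next
    case 4
    then have "d \<in> corners B" using inner_faces_subset Node.prems(3) by blast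
    then show ?thesis using B 4 Node by auto
  qed
qed simp

section \<open>The graph of a series-parallel tree\<close>

definition classes :: "(side \<Rightarrow> 'd) sp \<Rightarrow> 'd set set" where
  "classes t = range (\<lambda>x. set (bnd x t)) \<union> set ` set (inner_faces t)"

text \<open>The map \<open>r\<close> sends corners to graph vertices, and no identifications beyond
  the classes are allowed. In particular the four external sides become four different vertices.
  This fails for the whole diagram, whose \<open>West\<close> and \<open>East\<close> sides lie in
  one region, but holds for the two children of a parallel root.\<close>

definition faithful :: "('d \<Rightarrow> 'v) \<Rightarrow> (side \<Rightarrow> 'd) sp \<Rightarrow> bool" where
  "faithful r t \<longleftrightarrow> (\<forall>c\<in>classes t. \<forall>d\<in>c. \<forall>d'\<in>corners t. r d = r d' \<longleftrightarrow> d' \<in> c)"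

definition terminal :: "('d \<Rightarrow> 'v) \<Rightarrow> side \<Rightarrow> (side \<Rightarrow> 'd) sp \<Rightarrow> 'v" where
  "terminal r x t = r (hd (bnd x t))"

definition vset :: "kind \<Rightarrow> ('d \<Rightarrow> 'v) \<Rightarrow> (side \<Rightarrow> 'd) sp \<Rightarrow> 'v set" where
  "vset K r t = (\<Union>q\<in>leaves t. {r (q (inn K)), r (q (out K))})"

definition eset :: "kind \<Rightarrow> ('d \<Rightarrow> 'v) \<Rightarrow> (side \<Rightarrow> 'd) set \<Rightarrow> (side \<Rightarrow> 'd) sp \<Rightarrow> ('v \<times> 'v) set" where
  "eset K r F t =
     (\<Union>q\<in>leaves t \<inter> F. {(r (q (inn K)), r (q (out K))), (r (q (out K)), r (q (inn K)))})"

lemma sym_eset: "sym (eset K r F t)"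
  unfolding eset_def sym_def by blast

lemma eset_subset: "eset K r F t \<subseteq> vset K r t \<times> vset K r t"
  unfolding eset_def vset_def by blast

lemma eset_Node: "eset K r F (Node k f A B) = eset K r F A \<union> eset K r F B"
  unfolding eset_def by auto

lemma vset_Node: "vset K r (Node k f A B) = vset K r A \<union> vset K r B"
  unfolding vset_def by auto

lemma hd_bnd: "hd (bnd x t) \<in> set (bnd x t)"
  by simp

lemma terminal_in_vset: "terminal r (inn K) t \<in> vset K r t" "terminal r (out K) t \<in> vset K r t"
  using bnd_type[OF hd_bnd[of "inn K" t]] bnd_type[OF hd_bnd[of "out K" t]]
  unfolding terminal_def vset_def by fastforce+

lemma hd_bnd_corner: "hd (bnd x t) \<in> corners t"
  by (rule subsetD[OF bnd_subset hd_bnd])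

lemma cov_swap: "cov E V s t = cov E V t s"
  unfolding cov_def by auto

lemma faithfulI:
  assumes "\<And>c. c \<in> classes s \<Longrightarrow> \<exists>c'. c = c' \<inter> S \<and> (\<forall>d\<in>c'. \<forall>d'\<in>S. r d = r d' \<longleftrightarrow> d' \<in> c')"
    "corners s \<subseteq> S"
  shows "faithful r s"
proof -
  have "c \<subseteq> corners s" if "c \<in> classes s" for c
    using that bnd_subset inner_faces_subset unfolding classes_def by fastforce
  then show ?thesis using assms unfolding faithful_def by blast
qed

lemma leaf_corner: "q \<in> leaves t \<Longrightarrow> q x \<in> corners t"
  unfolding corners_leaves by blast

lemma leaf_corner_bnd:
  assumes "wf_sp t" "q \<in> leaves t" "q x \<in> set (bnd y t)"
  shows "x = y"
  using bnd_type[OF assms(3)] wf_leaf_inj assms by metis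

text \<open>A vertex coming from an inner face of \<open>A\<close> is invisible from
  \<open>B\<close>, so a common vertex sits on an external side of \<open>A\<close>; the side of a
  corner at a leaf tells which one.\<close>

lemma vset_Int:
  assumes "wf_sp A" "corners A \<inter> corners B = {}"
    and "\<And>c d d'. c \<in> set (inner_faces A) \<Longrightarrow> d \<in> set c \<Longrightarrow> d' \<in> corners B \<Longrightarrow> r d \<noteq> r d'"
    and "\<And>x d d'. d \<in> set (bnd x A) \<Longrightarrow> d' \<in> set (bnd x A) \<Longrightarrow> r d = r d'"
    and "v \<in> vset K r A \<inter> vset K r B"
  shows "\<exists>x. (x = inn K \<or> x = out K) \<and> v = terminal r x A \<and> (\<exists>d'\<in>corners B. \<exists>d\<in>set (bnd x A). r d = r d')"
proof -
  obtain q x where q: "q \<in> leaves A" "x = inn K \<or> x = out K" "v = r (q x)"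
    using assms(5) unfolding vset_def by blast
  obtain d' where d': "d' \<in> corners B" "v = r d'"
    using assms(5) leaf_corner[of _ B] unfolding vset_def by blast
  from leaf_corner[OF q(1), of x] corners_cover obtain y where "q x \<in> set (bnd y A)"
    using assms(3) q(3) d' by metis
  then have "q x \<in> set (bnd x A)" using leaf_corner_bnd[OF assms(1) q(1)] by metis
  then show ?thesis
    using assms(4)[OF _ hd_bnd[of x A]] q(2,3) d' unfolding terminal_def by metis
qed

lemma faithful_Node:
  assumes "faithful r (Node k f A B)" "wf_sp (Node k f A B)"
  shows "faithful r A" "faithful r B"
proof -
  let ?t = "Node k f A B"
  have sep: "corners A \<inter> corners B = {}" using assms(2) by simp
  have F: "\<forall>d\<in>c. \<forall>d'\<in>corners ?t. r d = r d' \<longleftrightarrow> d' \<in> c" if "c \<in> classes ?t" for c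
    using assms(1) that unfolding faithful_def by blast
  let ?g = "set (bnd (out k) A) \<union> set (bnd (inn k) B)"
  have g: "?g \<in> classes ?t" and b: "set (bnd x ?t) \<in> classes ?t"
    and i: "c \<in> set (inner_faces A) \<union> set (inner_faces B) \<Longrightarrow> set c \<in> classes ?t" for x c
    unfolding classes_def by auto
  note sub = bnd_subset[of _ A] bnd_subset[of _ B]
  show "faithful r A"
  proof (rule faithfulI)
    fix c assume "c \<in> classes A"
    then consider x where "c = set (bnd x A)" | i where "i \<in> set (inner_faces A)" "c = set i"
      unfolding classes_def by auto
    then obtain c' where "c' \<in> classes ?t" "c = c' \<inter> corners A"
    proof cases
      case (1 x)
      show ?thesis
      proof (cases "x = out k")
        case True
        then show ?thesis using that[OF g] sep sub[of x] sub[of "inn k"] 1 by blast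
      next
        case False
        have "set (bnd x A) = set (bnd x ?t) \<inter> corners A"
          unfolding set_bnd_Node using sep sub(1)[of x] sub(2)[of x] False by auto
        with 1 show ?thesis by (intro that[OF b[of x]]) (rule trans)
      qed
    next
      case 2
      then show ?thesis using that[OF i] inner_faces_subset[of i A] by blast
    qed
    then show "\<exists>c'. c = c' \<inter> corners A \<and> (\<forall>d\<in>c'. \<forall>d'\<in>corners A. r d = r d' \<longleftrightarrow> d' \<in> c')"
      using F[of c'] by auto
  qed simp
  show "faithful r B"
  proof (rule faithfulI)
    fix c assume "c \<in> classes B"
    then consider x where "c = set (bnd x B)" | i where "i \<in> set (inner_faces B)" "c = set i"
      unfolding classes_def by auto
    then obtain c' where "c' \<in> classes ?t" "c = c' \<inter> corners B"
    proof cases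
      case (1 x)
      show ?thesis
      proof (cases "x = inn k")
        case True
        then show ?thesis using that[OF g] sep sub[of x] sub[of "out k"] 1 by blast
      next
        case False
        have "set (bnd x B) = set (bnd x ?t) \<inter> corners B"
          unfolding set_bnd_Node using sep sub(1)[of x] sub(2)[of x] False by auto
        with 1 show ?thesis by (intro that[OF b[of x]]) (rule trans)
      qed
    next
      case 2
      then show ?thesis using that[OF i] inner_faces_subset[of i B] by blast
    qed
    then show "\<exists>c'. c = c' \<inter> corners B \<and> (\<forall>d\<in>c'. \<forall>d'\<in>corners B. r d = r d' \<longleftrightarrow> d' \<in> c')"
      using F[of c'] by auto
  qed simp
qed

text \<open>Nodes of kind \<open>K\<close> join the two graphs at a cut vertex, the glued side;
  nodes of the other kind join them at both terminals. Thus the recursion of \<open>conn\<close> and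
  \<open>reach\<close> is the one given by the series and parallel lemmas.\<close>

lemma con_cov_faithful:
  assumes "faithful r t" "wf_sp t"
  shows "(con (eset K r F t) (vset K r t) \<longleftrightarrow> conn K F t) \<and>
    (cov (eset K r F t) (vset K r t) (terminal r (inn K) t) (terminal r (out K) t) \<longleftrightarrow> reach K F t)"
  using assms
proof (induction t)
  case (Leaf q)
  have "q (inn K) \<noteq> q (out K)" using Leaf.prems(2) by (auto dest: injD)
  then have ne: "r (q (inn K)) \<noteq> r (q (out K))"
    using Leaf.prems(1) unfolding faithful_def classes_def by auto
  show ?case
  proof (cases "q \<in> F")
    case True
    then have "con (eset K r F (Leaf q)) (vset K r (Leaf q))"
      unfolding con_def eset_def vset_def by auto
    then show ?thesis using True unfolding cov_def vset_def terminal_def by auto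
  next
    case False
    then show ?thesis using ne unfolding con_def cov_def eset_def vset_def terminal_def by auto
  qed
next
  case (Node k f A B)
  let ?t = "Node k f A B"
  let ?EA = "eset K r F A" and ?EB = "eset K r F B" and ?VA = "vset K r A" and ?VB = "vset K r B"
  let ?i = "terminal r (inn K)" and ?o = "terminal r (out K)"
  have wf: "wf_sp A" "wf_sp B" "corners A \<inter> corners B = {}" using Node.prems(2) by auto
  note fA = faithful_Node(1)[OF Node.prems] and fB = faithful_Node(2)[OF Node.prems]
  note IH = Node.IH(1)[OF fA wf(1)] Node.IH(2)[OF fB wf(2)]
  have same: "r d = r d' \<longleftrightarrow> d' \<in> c" if "c \<in> classes ?t" "d \<in> c" "d' \<in> corners ?t" for c d d'
    using that Node.prems(1) unfolding faithful_def by blast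
  have sameA: "r d = r d' \<longleftrightarrow> d' \<in> c" if "c \<in> classes A" "d \<in> c" "d' \<in> corners A" for c d d'
    using that fA unfolding faithful_def by blast
  have cl: "set (bnd x ?t) \<in> classes ?t" "set (bnd (out k) A) \<union> set (bnd (inn k) B) \<in> classes ?t"
    "c \<in> set (inner_faces A) \<Longrightarrow> set c \<in> classes ?t" "set (bnd x A) \<in> classes A" for x c
    unfolding classes_def by auto
  have glue: "terminal r (out k) A = terminal r (inn k) B"
    using same[OF cl(2), of "hd (bnd (out k) A)" "hd (bnd (inn k) B)"] hd_bnd_corner[of "inn k" B]
    unfolding terminal_def by simp
  have tA: "terminal r x ?t = terminal r x A" if "x \<noteq> out k" for x
    using same[OF cl(1), of "hd (bnd x ?t)" x "hd (bnd x A)"] hd_bnd_corner[of x A] hd_bnd[of x ?t] hd_bnd[of x A] that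
    unfolding terminal_def set_bnd_Node by (simp split: if_splits)
  have tB: "terminal r x ?t = terminal r x B" if "x \<noteq> inn k" for x
    using same[OF cl(1), of "hd (bnd x ?t)" x "hd (bnd x B)"] hd_bnd_corner[of x B] hd_bnd[of x ?t] hd_bnd[of x B] that
    unfolding terminal_def set_bnd_Node by (simp split: if_splits)
  have int: "\<exists>x. (x = inn K \<or> x = out K) \<and> v = terminal r x A \<and>
      (\<exists>d'\<in>corners B. \<exists>d\<in>set (bnd x A). r d = r d')"
    if "v \<in> ?VA \<inter> ?VB" for v
  proof (rule vset_Int[OF wf(1,3) _ _ that])
    fix c d d' assume "c \<in> set (inner_faces A)" "d \<in> set c" "d' \<in> corners B"
    then show "r d \<noteq> r d'"
      using same[OF cl(3), of c d d'] inner_faces_subset[of c A] wf(3) by auto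
  next
    fix x d d' assume "d \<in> set (bnd x A)" "d' \<in> set (bnd x A)"
    then show "r d = r d'" using sameA[OF cl(4)] bnd_subset[of x A] by blast
  qed
  note vA = terminal_in_vset[where t = A and r = r and K = K]
    and vB = terminal_in_vset[where t = B and r = r and K = K]
  show ?case
  proof (cases "k = K")
    case True
    have "?VA \<inter> ?VB \<subseteq> {?o A}"
    proof
      fix v assume "v \<in> ?VA \<inter> ?VB"
      then obtain x d d' where x: "x = inn K \<or> x = out K" "v = terminal r x A"
        "d' \<in> corners B" "d \<in> set (bnd x A)" "r d = r d'" using int by blast
      \<comment> \<open>The side \<open>inn K\<close> of \<open>A\<close> is an external side of the
        node to which \<open>B\<close> adds no corners, so no corner of \<open>B\<close> can share
        its vertex.\<close>
      have "x \<noteq> inn K"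
      proof
        assume "x = inn K"
        then have "set (bnd x ?t) = set (bnd x A)" using True unfolding set_bnd_Node by simp
        then have "d' \<in> set (bnd x A)" using same[OF cl(1), of d x d'] x by auto
        then show False using x(3) bnd_subset[of x A] wf(3) by auto
      qed
      then show "v \<in> {?o A}" using x by auto
    qed
    moreover have "?o A \<in> ?VB" using vB(1) glue True by simp
    ultimately have S: "con (?EA \<union> ?EB) (?VA \<union> ?VB) \<longleftrightarrow>
        con ?EA ?VA \<and> con ?EB ?VB"
      "cov (?EA \<union> ?EB) (?VA \<union> ?VB)
          (?i A) (?o B) \<longleftrightarrow>
        con ?EA ?VA \<and>
          cov ?EB ?VB (?o A) (?o B) \<or>
        cov ?EA ?VA (?i A) (?o A) \<and>
          con ?EB ?VB"
      by (rule con_cov_series[OF sym_eset sym_eset eset_subset eset_subset _ vA(2) _ vA(1) vB(2)])+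
    show ?thesis
      unfolding eset_Node vset_Node using S IH glue tA[of "inn K"] tB[of "out K"] True by simp
  next
    case False
    have "?VA \<inter> ?VB \<subseteq> {?i A, ?o A}"
      using int by blast
    moreover have "?i A = ?i B" "?o A = ?o B"
      using tA[of "inn K"] tB[of "inn K"] tA[of "out K"] tB[of "out K"] False by simp_all
    ultimately have S: "con (?EA \<union> ?EB) (?VA \<union> ?VB) \<longleftrightarrow>
        con ?EA ?VA \<and>
          cov ?EB ?VB (?i B) (?o B) \<or>
        cov ?EA ?VA (?i A) (?o A) \<and>
          con ?EB ?VB"
      "cov (?EA \<union> ?EB) (?VA \<union> ?VB)
          (?i A) (?o A) \<longleftrightarrow>
        cov ?EA ?VA (?i A) (?o A) \<and>
        cov ?EB ?VB (?i B) (?o B)"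
      using con_cov_parallel[of "?EA" "?EB" "?VA" "?VB"
          "?i A" "?o A"] vA vB by (simp_all add: sym_eset eset_subset)
    show ?thesis
      unfolding eset_Node vset_Node using S IH tA[of "inn K"] tA[of "out K"] False by simp
  qed
qed


section \<open>Universes of series-parallel trees\<close>

primrec nx :: "side \<Rightarrow> side" where
  "nx North = West" | "nx West = South" | "nx South = East" | "nx East = North"

lemma range_side: "range q = {q North, q West, q South, q East}"
  by (auto, metis side.exhaust)

text \<open>The hypothesis says that \<open>g\<close> advances cyclically along \<open>c\<close>;
  its \<open>n\<close>-th power therefore acts on \<open>c\<close> as rotation by
  \<open>n\<close>.\<close>

lemma orbit_cyclic_list:
  assumes "map g c = rotate1 c" "d \<in> set c"
  shows "orbit g d = set c"
proof -
  have iter: "map (g ^^ n) c = rotate n c" for n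
  proof (induction n)
    case (Suc n)
    have "map (g ^^ Suc n) c = map g (map (g ^^ n) c)" unfolding map_map funpow.simps(2) ..
    also have "\<dots> = map g (rotate n c)" unfolding Suc ..
    also have "\<dots> = rotate n (map g c)" by (rule rotate_map[symmetric])
    also have "\<dots> = rotate (Suc n) c" unfolding assms(1) rotate_Suc rotate1_rotate_swap ..
    finally show ?case .
  qed simp
  obtain i where i: "i < length c" "d = c ! i" using assms(2) by (metis in_set_conv_nth)
  have step: "(g ^^ n) d = c ! ((n + i) mod length c)" for n
  proof -
    have "map (g ^^ n) c ! i = rotate n c ! i" unfolding iter ..
    then show ?thesis unfolding nth_map[OF i(1)] nth_rotate[OF i(1)] i(2) .
  qed
  show ?thesis
  proof (intro set_eqI iffI)
    fix x assume "x \<in> set c"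
    then obtain j where j: "j < length c" "x = c ! j" by (metis in_set_conv_nth)
    \<comment> \<open>The exponent \<open>length c - i + j\<close> represents \<open>j - i\<close>
      modulo the length and is positive, as membership in \<open>orbit\<close> requires.\<close>
    have "length c - i + j + i = length c + j" using i(1) by arith
    then have "(length c - i + j + i) mod length c = j" using j(1) by simp
    then have "x = (g ^^ (length c - i + j)) d" unfolding step j(2) by (rule arg_cong[symmetric])
    moreover have "0 < length c - i + j" using i(1) by arith
    ultimately show "x \<in> orbit g d" unfolding orbit_altdef by blast
  next
    fix x assume "x \<in> orbit g d"
    then obtain n where n: "x = (g ^^ n) d" unfolding orbit_altdef by blast
    have "0 < length c" using i(1) by arith
    then show "x \<in> set c" unfolding n step by (intro nth_mem mod_less_divisor)
  qed
qed

text \<open>On the corners of \<open>t\<close>, \<open>opp U\<close> is prescribed only implicitly: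
  every list in \<open>faces t\<close> has to be traversed cyclically. Regions are then available as
  explicit lists, and contracting a bigon amounts to editing these lists.\<close>

locale sp_universe =
  fixes t :: "(side \<Rightarrow> 'd) sp" and U :: "'d plane_map"
  assumes wf: "wf_sp t"
    and darts: "darts U = corners t"
    and rot: "\<And>q x. q \<in> leaves t \<Longrightarrow> rot U (q x) = q (nx x)"
    and off: "\<And>d. d \<notin> corners t \<Longrightarrow> rot U d = d \<and> opp U d = d"
    and cyclic: "\<And>c. c \<in> set (faces t) \<Longrightarrow> map (opp U \<circ> rot U) c = rotate1 c"
    and outer: "outer U = set (bnd West t) \<union> set (bnd East t)"
begin

lemma faces_cover: "d \<in> corners t \<Longrightarrow> \<exists>c\<in>set (faces t). d \<in> set c"
proof -
  assume "d \<in> corners t"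
  from corners_cover[OF this] show ?thesis
  proof
    assume "\<exists>x. d \<in> set (bnd x t)"
    then obtain x where "d \<in> set (bnd x t)" by blast
    then show ?thesis unfolding faces_def by (cases x) auto
  qed (auto simp: faces_def)
qed

lemma region_face: "c \<in> set (faces t) \<Longrightarrow> d \<in> set c \<Longrightarrow> region U d = set c"
  unfolding region_def by (rule orbit_cyclic_list[OF cyclic])

lemma region_self: "d \<in> corners t \<Longrightarrow> d \<in> region U d"
  using faces_cover region_face by metis

lemma region_eq_iff:
  assumes "c \<in> set (faces t)" "d \<in> set c" "d' \<in> corners t"
  shows "region U d = region U d' \<longleftrightarrow> d' \<in> set c"
  using region_face[OF assms(1)] assms(2) region_self[OF assms(3)] by metis

lemma faces_subset: "c \<in> set (faces t) \<Longrightarrow> set c \<subseteq> corners t"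
  using inner_faces_subset[of c t] unfolding faces_def by (auto intro: subsetD[OF bnd_subset])

lemma faces_nonempty: "c \<in> set (faces t) \<Longrightarrow> c \<noteq> []"
proof -
  have "c \<in> set (inner_faces s) \<Longrightarrow> c \<noteq> []" for s :: "(side \<Rightarrow> 'd) sp" by (induction s) auto
  then show "c \<in> set (faces t) \<Longrightarrow> c \<noteq> []" unfolding faces_def
    using bnd_nonempty[of _ t] by (metis append_is_Nil_conv set_ConsD)
qed

lemma regions_eq: "regions U = set ` set (faces t)"
proof
  show "regions U \<subseteq> set ` set (faces t)"
    unfolding regions_def darts using faces_cover region_face by force
next
  show "set ` set (faces t) \<subseteq> regions U"
  proof
    fix R assume "R \<in> set ` set (faces t)"
    then obtain c where c: "c \<in> set (faces t)" "R = set c" by blast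
    then have "hd c \<in> set c" using faces_nonempty by simp
    then have "region U (hd c) = R" "hd c \<in> corners t" using c region_face faces_subset by blast+
    then show "R \<in> regions U" unfolding regions_def darts by blast
  qed
qed

lemma crossing_leaf: "q \<in> leaves t \<Longrightarrow> crossing U (q x) = range q"
proof -
  assume q: "q \<in> leaves t"
  have "map (rot U) [q North, q West, q South, q East] = rotate1 [q North, q West, q South, q East]"
    using rot[OF q] by simp
  from orbit_cyclic_list[OF this, of "q x"] show ?thesis
    unfolding vertex_def range_side by (cases x) auto
qed

lemma crossings_eq: "crossings U = range ` leaves t"
  unfolding vertices_def darts corners_leaves using crossing_leaf by force

lemma inj_on_range_leaves: "inj_on range (leaves t)"
proof (rule inj_onI)
  fix q q' :: "side \<Rightarrow> 'd" assume q: "q \<in> leaves t" "q' \<in> leaves t" "range q = range q'"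
  then obtain x where "q North = q' x" by (metis rangeI imageE)
  then show "q = q'" using wf_leaf_inj[OF wf q(1,2)] by blast
qed

lemma leaf_cases:
  assumes "d \<in> corners t" obtains q x where "q \<in> leaves t" "d = q x"
  using assms unfolding corners_leaves by auto

text \<open>The two sides glued at a node are both vertical or both horizontal, so every region is
  made of corners of one colour.\<close>

lemma face_sides:
  "c \<in> set (faces t) \<Longrightarrow> q \<in> leaves t \<Longrightarrow> q' \<in> leaves t \<Longrightarrow> q x \<in> set c \<Longrightarrow> q' y \<in> set c \<Longrightarrow>
     x \<in> {North, South} \<longleftrightarrow> y \<in> {North, South}"
proof -
  have inner: "(\<forall>d\<in>set c. \<exists>q\<in>leaves s. \<exists>x\<in>{North, South}. d = q x) \<or>
      (\<forall>d\<in>set c. \<exists>q\<in>leaves s. \<exists>x\<in>{West, East}. d = q x)" if "c \<in> set (inner_faces s)" for c s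
    using that
  proof (induction s)
    case (Node k f A B)
    then consider "c \<in> set (inner_faces A)" | "c \<in> set (inner_faces B)" | "c = bnd (out k) A @ bnd (inn k) B"
      by auto
    then show ?case
    proof cases
      case 3
      then have "\<forall>d\<in>set c. \<exists>q\<in>leaves A \<union> leaves B. \<exists>x\<in>{inn k, out k}. d = q x"
        using bnd_type[of _ "out k" A] bnd_type[of _ "inn k" B] by auto
      then show ?thesis by (cases k) auto
    qed (use Node.IH in \<open>simp; metis Un_iff\<close>)+
  qed simp
  have "(\<forall>d\<in>set c. \<exists>q\<in>leaves t. \<exists>x\<in>{North, South}. d = q x) \<or>
      (\<forall>d\<in>set c. \<exists>q\<in>leaves t. \<exists>x\<in>{West, East}. d = q x)" if "c \<in> set (faces t)" for c
    using that inner[of c t] bnd_type[of _ _ t] unfolding faces_def by (auto; metis)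
  then show "c \<in> set (faces t) \<Longrightarrow> q \<in> leaves t \<Longrightarrow> q' \<in> leaves t \<Longrightarrow> q x \<in> set c \<Longrightarrow> q' y \<in> set c \<Longrightarrow>
     x \<in> {North, South} \<longleftrightarrow> y \<in> {North, South}"
    using wf_leaf_inj[OF wf] by (smt (verit) insertCI insertE side.distinct empty_iff)
qed

lemma region_opp:
  assumes "q \<in> leaves t"
  shows "region U (opp U (q (nx x))) = region U (q x)"
proof -
  obtain c where c: "c \<in> set (faces t)" "q x \<in> set c"
    using faces_cover leaf_corner[OF assms] by blast
  have "opp U (q (nx x)) = (opp U \<circ> rot U) (q x)" using rot[OF assms] by simp
  also have "\<dots> \<in> set c" using cyclic[OF c(1)] c(2) by (metis image_eqI set_map set_rotate1)
  finally show ?thesis using region_face c by metis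
qed

lemma region_outer:
  "outer U = region U (hd (bnd West t))" "d \<in> set (bnd West t) \<Longrightarrow> region U d = outer U"
  "d \<in> set (bnd East t) \<Longrightarrow> region U d = outer U"
  using region_face[of "bnd West t @ bnd East t"] unfolding outer faces_def by auto

text \<open>Colours alternate around a crossing, which leaves one free bit per crossing. The glued
  region at each node forces the bits of its two parts to agree, and the unbounded region fixes the
  common value.\<close>

lemma white_regions_unique:
  assumes W: "\<forall>d\<in>darts U. region U d \<in> W \<longleftrightarrow> region U (opp U d) \<notin> W" and o: "outer U \<in> W"
    and q: "q \<in> leaves t"
  shows "region U (q x) \<in> W \<longleftrightarrow> x \<in> {West, East}"
proof -
  have nx: "region U (q (nx x)) \<in> W \<longleftrightarrow> region U (q x) \<notin> W" if "q \<in> leaves t" for q x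
    using W leaf_corner[OF that] region_opp[OF that] unfolding darts by metis
  have leaf: "\<exists>b. \<forall>x. region U (q x) \<in> W \<longleftrightarrow> (b \<longleftrightarrow> x \<in> {West, East})" if "q \<in> leaves t" for q
    using nx[OF that, of North] nx[OF that, of South] nx[OF that, of West]
    by (intro exI[of _ "region U (q West) \<in> W"]) (simp add: side_all)
  have sub: "\<exists>b. \<forall>q\<in>leaves s. \<forall>x. region U (q x) \<in> W \<longleftrightarrow> (b \<longleftrightarrow> x \<in> {West, East})"
    if "leaves s \<subseteq> leaves t" "set (inner_faces s) \<subseteq> set (inner_faces t)" for s
    using that
  proof (induction s)
    case (Leaf q)
    then show ?case using leaf by simp
  next
    case (Node k f A B)
    then obtain a b where
      a: "\<forall>q\<in>leaves A. \<forall>x. region U (q x) \<in> W \<longleftrightarrow> (a \<longleftrightarrow> x \<in> {West, East})" and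
      b: "\<forall>q\<in>leaves B. \<forall>x. region U (q x) \<in> W \<longleftrightarrow> (b \<longleftrightarrow> x \<in> {West, East})"
      by auto
    obtain p where p: "p \<in> leaves A" "p (out k) \<in> set (bnd (out k) A)"
      using bnd_type[OF hd_bnd[of "out k" A]] hd_bnd[of "out k" A] by metis
    obtain p' where p': "p' \<in> leaves B" "p' (inn k) \<in> set (bnd (inn k) B)"
      using bnd_type[OF hd_bnd[of "inn k" B]] hd_bnd[of "inn k" B] by metis
    have "bnd (out k) A @ bnd (inn k) B \<in> set (faces t)" using Node.prems(2) unfolding faces_def by simp
    then have "region U (p (out k)) = region U (p' (inn k))"
      using p(2) p'(2) region_face by (metis Un_iff set_append)
    moreover have "out k \<in> {West, East} \<longleftrightarrow> inn k \<in> {West, East}" by (cases k) auto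
    ultimately have "a = b" using a b p(1) p'(1) by metis
    then show ?case using a b by auto
  qed
  from sub[of t] obtain b where b: "\<And>q x. q \<in> leaves t \<Longrightarrow> region U (q x) \<in> W \<longleftrightarrow> (b \<longleftrightarrow> x \<in> {West, East})"
    by auto
  obtain p where "p \<in> leaves t" "hd (bnd West t) = p West"
    using bnd_type[OF hd_bnd[of West t]] by auto
  then have b using b[of p West] o region_outer(1) by simp
  then show ?thesis using b[OF q] by simp
qed

lemma vset_Par_iff:
  assumes q: "q \<in> leaves t"
  shows "region U (q x) \<in> vset Par (region U) t \<longleftrightarrow> x \<in> {West, East}" (is "_ \<in> ?W \<longleftrightarrow> _")
proof
  assume "region U (q x) \<in> ?W"
  then obtain q' y where q': "q' \<in> leaves t" "y \<in> {West, East}" "region U (q x) = region U (q' y)"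
    unfolding vset_def by auto
  obtain c where c: "c \<in> set (faces t)" "q x \<in> set c"
    using faces_cover leaf_corner[OF q] by blast
  then have "q' y \<in> set c" using region_eq_iff[OF c leaf_corner[OF q'(1), of y]] q'(3) by simp
  then show "x \<in> {West, East}" using face_sides[OF c(1) q q'(1) c(2)] q'(2) by (cases x) auto
qed (use q in \<open>auto simp: vset_def\<close>)

lemma white_regions_eq: "white_regions U = vset Par (region U) t" (is "_ = ?W")
proof -
  note side = vset_Par_iff
  have P: "?W \<subseteq> regions U \<and> outer U \<in> ?W \<and> (\<forall>d\<in>darts U. region U d \<in> ?W \<longleftrightarrow> region U (opp U d) \<notin> ?W)"
  proof (intro conjI ballI)
    show "?W \<subseteq> regions U" unfolding vset_def regions_def darts using leaf_corner by fastforce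
    obtain p where "p \<in> leaves t" "hd (bnd West t) = p West"
      using bnd_type[OF hd_bnd[of West t]] by auto
    then show "outer U \<in> ?W" using side[of p West] region_outer(1) by simp
  next
    fix d assume "d \<in> darts U"
    then obtain q x where q: "q \<in> leaves t" "d = q x" using leaf_cases unfolding darts by metis
    obtain y where y: "x = nx y" by (cases x) (metis nx.simps)+
    show "region U d \<in> ?W \<longleftrightarrow> region U (opp U d) \<notin> ?W"
      using side[OF q(1)] region_opp[OF q(1), of y] unfolding q(2) y by (cases y) auto
  qed
  show ?thesis unfolding white_regions_def
  proof (rule the_equality)
    fix W assume W: "W \<subseteq> regions U \<and> outer U \<in> W \<and>
      (\<forall>d\<in>darts U. region U d \<in> W \<longleftrightarrow> region U (opp U d) \<notin> W)"
    have "region U d \<in> W \<longleftrightarrow> region U d \<in> ?W" if d: "d \<in> corners t" for d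
      using leaf_cases[OF d] white_regions_unique[of W] W side by metis
    moreover have "R \<in> W \<Longrightarrow> \<exists>d\<in>corners t. R = region U d" "R \<in> ?W \<Longrightarrow> \<exists>d\<in>corners t. R = region U d" for R
      using W P unfolding regions_def darts by blast+
    ultimately show "W = ?W" by blast
  qed (rule P)
qed

lemma black_regions_eq: "black_regions U = vset Ser (region U) t"
proof (intro set_eqI iffI)
  fix R assume R: "R \<in> black_regions U"
  then obtain q x where q: "q \<in> leaves t" "R = region U (q x)"
    unfolding black_regions_def regions_def darts using leaf_cases by (metis DiffD1 imageE)
  then have "x \<notin> {West, East}" using R vset_Par_iff unfolding black_regions_def white_regions_eq by auto
  then show "R \<in> vset Ser (region U) t" using q unfolding vset_def by (cases x) auto
next
  fix R assume "R \<in> vset Ser (region U) t"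
  then obtain q x where q: "q \<in> leaves t" "R = region U (q x)" "x \<in> {North, South}"
    unfolding vset_def by auto
  then have "R \<notin> white_regions U" unfolding white_regions_eq using vset_Par_iff[of q x] by auto
  moreover have "R \<in> regions U" using q leaf_corner unfolding regions_def darts by blast
  ultimately show "R \<in> black_regions U" unfolding black_regions_def by blast
qed

end

section \<open>Perfect matchings and the EI-property\<close>

text \<open>The glued region of a node must receive exactly one corner, so exactly one of the two
  parts has its state there and the other part hands its state on to the node. The second conjunct
  carries the induction and also shows which external region is hit.\<close>

lemma state_exists:
  assumes "wf_sp t" "\<forall>q\<in>leaves t. \<exists>!x. q x \<in> M"
    "\<forall>c\<in>set (inner_faces t). \<exists>!d. d \<in> set c \<and> d \<in> M"
  shows "\<exists>y. state M t y \<and>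
    (\<forall>z. if z = y then \<exists>!d. d \<in> set (bnd z t) \<and> d \<in> M else set (bnd z t) \<inter> M = {})"
  using assms
proof (induction t)
  case (Leaf q)
  then obtain x where "\<forall>z. q z \<in> M \<longleftrightarrow> z = x" by auto
  then show ?case by (auto intro!: exI[of _ x])
next
  case (Node k f A B)
  let ?t = "Node k f A B"
  have wf: "wf_sp A" "wf_sp B" "corners A \<inter> corners B = {}" using Node.prems(1) by auto
  obtain a where a: "state M A a"
    "\<And>z. if z = a then \<exists>!d. d \<in> set (bnd z A) \<and> d \<in> M else set (bnd z A) \<inter> M = {}"
    using Node.IH(1)[OF wf(1)] Node.prems(2,3) by auto
  obtain b where b: "state M B b"
    "\<And>z. if z = b then \<exists>!d. d \<in> set (bnd z B) \<and> d \<in> M else set (bnd z B) \<inter> M = {}"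
    using Node.IH(2)[OF wf(2)] Node.prems(2,3) by auto
  have g: "\<exists>!d. (d \<in> set (bnd (out k) A) \<or> d \<in> set (bnd (inn k) B)) \<and> d \<in> M"
    using Node.prems(3) by auto
  consider "a = out k" "b = inn k" | "a = out k" "b \<noteq> inn k" | "a \<noteq> out k" "b = inn k"
    | "a \<noteq> out k" "b \<noteq> inn k" by blast
  then show ?case
  proof cases
    case 1
    then obtain d d' where "d \<in> set (bnd (out k) A)" "d \<in> M" "d' \<in> set (bnd (inn k) B)" "d' \<in> M"
      using a(2)[of a] b(2)[of b] by auto
    moreover from this have "d \<noteq> d'"
      using subsetD[OF bnd_subset, of d "out k" A] subsetD[OF bnd_subset, of d' "inn k" B] wf(3) by auto
    ultimately show ?thesis using g by blast
  next
    case 2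
    have "if z = b then \<exists>!d. d \<in> set (bnd z ?t) \<and> d \<in> M else set (bnd z ?t) \<inter> M = {}" for z
    proof (cases "z = out k")
      case False
      then have "set (bnd z A) \<inter> M = {}" using a(2)[of z] 2(1) by simp
      then have "d \<in> set (bnd z ?t) \<and> d \<in> M \<longleftrightarrow> z \<noteq> inn k \<and> d \<in> set (bnd z B) \<and> d \<in> M" for d
        using False unfolding set_bnd_Node by auto
      then show ?thesis using b(2)[of z] 2(2) unfolding disjoint_iff by (auto split: if_splits)
    next
      case True
      then have "set (bnd z ?t) = set (bnd z B)" by (simp add: set_bnd_Node)
      then show ?thesis using b(2)[of z] by (simp only:)
    qed
    moreover have "state M ?t b" using a(1) b(1) 2 by simp
    ultimately show ?thesis by (intro exI[of _ b] conjI allI)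
  next
    case 3
    have "if z = a then \<exists>!d. d \<in> set (bnd z ?t) \<and> d \<in> M else set (bnd z ?t) \<inter> M = {}" for z
    proof (cases "z = inn k")
      case False
      then have "set (bnd z B) \<inter> M = {}" using b(2)[of z] 3(2) by simp
      then have "d \<in> set (bnd z ?t) \<and> d \<in> M \<longleftrightarrow> z \<noteq> out k \<and> d \<in> set (bnd z A) \<and> d \<in> M" for d
        using False unfolding set_bnd_Node by auto
      then show ?thesis using a(2)[of z] 3(1) unfolding disjoint_iff by (auto split: if_splits)
    next
      case True
      then have "set (bnd z ?t) = set (bnd z A)" by (simp add: set_bnd_Node)
      then show ?thesis using a(2)[of z] by (simp only:)
    qed
    moreover have "state M ?t a" using a(1) b(1) 3 by simp
    ultimately show ?thesis by (intro exI[of _ a] conjI allI)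
  next
    case 4
    then show ?thesis using a(2)[of "out k"] b(2)[of "inn k"] g by auto
  qed
qed

lemma inner_face_leaf:
  assumes "wf_sp t" "c \<in> set (inner_faces t)" "q \<in> leaves t" "q x \<in> set c" "q y \<in> set c"
  shows "x = y"
  using assms
proof (induction t)
  case (Node k f A B)
  have wf: "wf_sp A" "wf_sp B" "corners A \<inter> corners B = {}" using Node.prems(1) by auto
  have sep: "\<And>d. d \<in> corners A \<Longrightarrow> d \<notin> corners B" using wf(3) by auto
  have qA: "q z \<in> corners A \<longleftrightarrow> q \<in> leaves A" and qB: "q z \<in> corners B \<longleftrightarrow> q \<in> leaves B" for z
    using Node.prems(3) sep leaf_corner[of q A] leaf_corner[of q B] by auto
  note bA = subsetD[OF bnd_subset[of _ A]] and bB = subsetD[OF bnd_subset[of _ B]]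
  consider "c \<in> set (inner_faces A)" | "c \<in> set (inner_faces B)" | "c = bnd (out k) A @ bnd (inn k) B"
    using Node.prems(2) by auto
  then show ?case
  proof cases
    case 1
    then have "q \<in> leaves A" using inner_faces_subset Node.prems(4) qA by blast
    then show ?thesis using Node.IH(1)[OF wf(1) 1] Node.prems(4,5) by blast
  next
    case 2
    then have "q \<in> leaves B" using inner_faces_subset Node.prems(4) qB by blast
    then show ?thesis using Node.IH(2)[OF wf(2) 2] Node.prems(4,5) by blast
  next
    case 3
    show ?thesis
    proof (cases "q \<in> leaves A")
      case True
      then have "q \<notin> leaves B" using qA qB sep by blast
      then have "q x \<in> set (bnd (out k) A)" "q y \<in> set (bnd (out k) A)"
        using 3 Node.prems(4,5) bB qB by auto
      then show ?thesis using leaf_corner_bnd[OF wf(1) True] by metis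
    next
      case False
      then have B: "q \<in> leaves B" using Node.prems(3) by simp
      have "q x \<in> set (bnd (inn k) B)" "q y \<in> set (bnd (inn k) B)"
        using 3 Node.prems(4,5) bA qA False by auto
      then show ?thesis using leaf_corner_bnd[OF wf(2) B] by metis
    qed
  qed
qed simp

definition edge_of :: "kind \<Rightarrow> (side \<Rightarrow> 'd) \<Rightarrow> 'd set cb_edge" where
  "edge_of K q = (if K = Ser then Edge (range q) else Dual_Edge (range q))"

locale sp_link = sp_universe t U for t :: "(side \<Rightarrow> 'd) sp" and U +
  fixes f A B
  assumes root: "t = Node Par f A B"
begin

text \<open>One dart lies in the black region at the bottom vertex, the other in the unbounded
  region. Deleting these two regions leaves \<open>North\<close> as the only external region to be
  matched.\<close>

definition bottom_segment :: "'d set" where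
  "bottom_segment = {hd (bnd South t), hd (bnd East t)}"

lemma parts: "wf_sp A" "wf_sp B" "corners A \<inter> corners B = {}"
  using wf root by auto

text \<open>As the root is parallel, the \<open>West\<close> boundary lies in \<open>A\<close> and
  the \<open>East\<close> boundary in \<open>B\<close>, so no crossing meets the unbounded region
  twice. Absence of nugatory crossings makes a half-edge, a pair of a crossing and a region,
  determine its corner.\<close>

lemma leaf_regions_distinct:
  assumes "q \<in> leaves t" "region U (q x) = region U (q y)"
  shows "x = y"
proof -
  obtain c where c: "c \<in> set (faces t)" "q x \<in> set c"
    using faces_cover leaf_corner[OF assms(1)] by blast
  have y: "q y \<in> set c" using region_eq_iff[OF c leaf_corner[OF assms(1)]] assms(2) by metis
  have *: False if "q West \<in> set (bnd West t)" "q East \<in> set (bnd East t)"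
  proof -
    have "q West \<in> corners A" "q East \<in> corners B"
      using that root subsetD[OF bnd_subset] by fastforce+
    moreover have "q \<in> leaves A \<or> q \<in> leaves B" using assms(1) root by auto
    ultimately show False using leaf_corner[of q A] leaf_corner[of q B] parts(3) by blast
  qed
  note L = leaf_corner_bnd[OF wf assms(1)]
  consider "c = bnd North t" | "c = bnd South t" | "c = bnd West t @ bnd East t" | "c \<in> set (inner_faces t)"
    using c(1) unfolding faces_def by auto
  then show ?thesis
  proof cases
    case 3
    then show ?thesis using c(2) y L[of x] L[of y] * by (auto; metis)
  next
    case 4
    then show ?thesis using inner_face_leaf[OF wf] assms(1) c(2) y by blast
  qed (use c(2) y L in metis)+
qed

lemma region_bottom: "region U ` bottom_segment = {set (bnd South t), outer U}"
  unfolding bottom_segment_def using region_outer(3)[OF hd_bnd] region_face[of "bnd South t"]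
  by (simp add: faces_def)

lemma balanced_face:
  assumes "c = bnd North t \<or> c \<in> set (inner_faces t)"
  shows "set c \<in> balanced_regions U bottom_segment"
proof -
  have c: "c \<in> set (faces t)" using assms unfolding faces_def by auto
  then have "hd c \<in> set c" using faces_nonempty by simp
  then have "hd c \<notin> set (bnd z t)" if "z \<noteq> North" for z
    using assms that bnd_disjoint[OF wf] inner_bnd_disjoint[OF wf] by metis
  then have "hd c \<notin> set (bnd South t)" "hd c \<notin> outer U" unfolding outer by auto
  then have "set c \<noteq> set (bnd South t)" "set c \<noteq> outer U" using \<open>hd c \<in> set c\<close> by auto
  then show ?thesis using c unfolding balanced_regions_def region_bottom regions_eq by blast
qed

lemma unbalanced:
  assumes "d \<in> set (bnd z t)" "z \<noteq> North"
  shows "region U d \<notin> balanced_regions U bottom_segment"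
proof -
  have "region U d \<in> {set (bnd South t), outer U}"
    using assms region_face[of "bnd South t" d] region_outer(2,3)[of d]
    by (cases z) (auto simp: faces_def)
  then show ?thesis unfolding balanced_regions_def region_bottom by blast
qed

definition matched :: "('d set \<times> 'd set) set \<Rightarrow> 'd set" where
  "matched P = {d \<in> corners t. (crossing U d, region U d) \<in> P}"

lemma half_edge:
  assumes "(c, R) \<in> balanced_half_edges U bottom_segment"
  obtains q x where "q \<in> leaves t" "c = range q" "R = region U (q x)"
proof -
  from assms have c: "c \<in> crossings U" and R: "R \<in> regions U" and "c \<inter> R \<noteq> {}"
    unfolding balanced_half_edges_def incident_def by auto
  then obtain d where d: "d \<in> c" "d \<in> R" by auto
  obtain q where q: "q \<in> leaves t" "c = range q" using c unfolding crossings_eq by auto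
  obtain x where x: "d = q x" using d(1) q(2) by auto
  obtain a where "a \<in> set (faces t)" "R = set a" using R unfolding regions_eq by auto
  then have "R = region U (q x)" using region_face[of a d] d(2) x by simp
  then show ?thesis using that q by simp
qed

lemma matched_leaf: "q \<in> leaves t \<Longrightarrow> q x \<in> matched P \<longleftrightarrow> (range q, region U (q x)) \<in> P"
  unfolding matched_def using crossing_leaf[of q x] leaf_corner[of q t x] by simp

context
  fixes P assumes P: "perfect_matching U bottom_segment P"
begin

lemma matching:
  "P \<subseteq> balanced_half_edges U bottom_segment"
  "c \<in> crossings U \<Longrightarrow> \<exists>!h. h \<in> P \<and> fst h = c"
  "R \<in> balanced_regions U bottom_segment \<Longrightarrow> \<exists>!h. h \<in> P \<and> snd h = R"
  using P unfolding perfect_matching_def by simp_all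

lemma matched_unique_leaf: "q \<in> leaves t \<Longrightarrow> \<exists>!x. q x \<in> matched P"
proof -
  assume q: "q \<in> leaves t"
  then have ex: "\<exists>!h. h \<in> P \<and> fst h = range q" by (intro matching(2)) (simp add: crossings_eq)
  then obtain R where h: "(range q, R) \<in> P" by (metis prod.collapse)
  obtain q' x where q': "q' \<in> leaves t" "range q = range q'" "R = region U (q' x)"
    by (rule half_edge[OF subsetD[OF matching(1) h]])
  have "q' = q" using inj_onD[OF inj_on_range_leaves _ q'(1) q] q'(2) by simp
  then have "q x \<in> matched P" using h q'(3) unfolding matched_leaf[OF q] by (simp only:)
  moreover have "x' = y'" if "q x' \<in> matched P" "q y' \<in> matched P" for x' y'
  proof -
    have "(range q, region U (q x')) \<in> P" "(range q, region U (q y')) \<in> P"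
      using that unfolding matched_leaf[OF q] .
    moreover have "h = h'" if "h \<in> P" "fst h = range q" "h' \<in> P" "fst h' = range q" for h h'
      using ex that by auto
    ultimately have "(range q, region U (q x')) = (range q, region U (q y'))" by (metis fst_conv)
    then show ?thesis using leaf_regions_distinct[OF q] by simp
  qed
  ultimately show ?thesis by (intro ex1I[of _ x])
qed

lemma matched_unique_face:
  assumes "c = bnd North t \<or> c \<in> set (inner_faces t)"
  shows "\<exists>!d. d \<in> set c \<and> d \<in> matched P"
proof -
  have c: "c \<in> set (faces t)" using assms unfolding faces_def by auto
  have ex: "\<exists>!h. h \<in> P \<and> snd h = set c"
    by (rule matching(3)[OF balanced_face[OF assms]])
  then obtain a where h: "(a, set c) \<in> P" by (metis prod.collapse)
  obtain q x where q: "q \<in> leaves t" "a = range q" "set c = region U (q x)"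
    by (rule half_edge[OF subsetD[OF matching(1) h]])
  then have "q x \<in> set c" using region_self leaf_corner by metis
  moreover have "q x \<in> matched P" using matched_leaf q h by simp
  moreover have "d = d'" if d: "d \<in> set c" "d \<in> matched P" "d' \<in> set c" "d' \<in> matched P" for d d'
  proof -
    from d have "d \<in> corners t" "d' \<in> corners t" unfolding matched_def by auto
    then obtain p y p' y' where p: "p \<in> leaves t" "d = p y" "p' \<in> leaves t" "d' = p' y'"
      using leaf_cases by metis
    then have "(range p, set c) \<in> P" "(range p', set c) \<in> P"
      using d matched_leaf region_face[OF c] by metis+
    then have "range p = range p'" using ex by (metis fst_conv snd_conv)
    then have "p = p'" using inj_onD[OF inj_on_range_leaves] p by metis
    moreover have "region U (p y) = region U (p y')" using d p \<open>p = p'\<close> region_face[OF c] by metis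
    ultimately show ?thesis using leaf_regions_distinct p by metis
  qed
  ultimately show ?thesis by blast
qed

lemma matched_state: "state (matched P) t North"
proof -
  obtain y where y: "state (matched P) t y"
    "\<And>z. if z = y then \<exists>!d. d \<in> set (bnd z t) \<and> d \<in> matched P else set (bnd z t) \<inter> matched P = {}"
  proof -
    have "\<forall>q\<in>leaves t. \<exists>!x. q x \<in> matched P" "\<forall>c\<in>set (inner_faces t). \<exists>!d. d \<in> set c \<and> d \<in> matched P"
      using matched_unique_leaf matched_unique_face by simp_all
    from state_exists[OF wf this] show ?thesis using that by blast
  qed
  \<comment> \<open>Any other side would use a half-edge at one of the two deleted regions.\<close>
  have "y = North"
  proof (rule ccontr)
    assume n: "y \<noteq> North"
    obtain d where d: "d \<in> set (bnd y t)" "d \<in> matched P" using y(2)[of y] by auto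
    then have "(crossing U d, region U d) \<in> P" unfolding matched_def by blast
    then have "region U d \<in> balanced_regions U bottom_segment"
      using matching(1) unfolding balanced_half_edges_def by blast
    then show False using unbalanced[OF d(1) n] by blast
  qed
  with y show ?thesis by simp
qed

lemma eta_leaf:
  assumes "q \<in> leaves t"
  shows "eta U (range q, region U (q x)) = edge_of (if x \<in> {North, South} then Ser else Par) q"
proof -
  have "region U (q x) \<in> regions U"
    using leaf_corner[OF assms] unfolding regions_def darts by blast
  then have "region U (q x) \<in> black_regions U \<longleftrightarrow> x \<notin> {West, East}"
    using vset_Par_iff[OF assms] unfolding black_regions_def white_regions_eq by blast
  then show ?thesis unfolding eta_def edge_of_def by (cases x) auto
qed

lemma eta_matching:
  assumes "q \<in> leaves t"
  shows "eta U ` P \<inter> graph_edges U (edge_of K q) = edge_of K ` chosen K (leaves t) (matched P)"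
proof (intro set_eqI iffI)
  fix e assume e: "e \<in> eta U ` P \<inter> graph_edges U (edge_of K q)"
  then obtain c R where h: "(c, R) \<in> P" "e = eta U (c, R)" by auto
  obtain p x where p: "p \<in> leaves t" "c = range p" "R = region U (p x)"
    by (rule half_edge[OF subsetD[OF matching(1) h(1)]])
  then have e': "e = edge_of (if x \<in> {North, South} then Ser else Par) p" using h eta_leaf by simp
  have K: "(if x \<in> {North, South} then Ser else Par) = K"
  proof -
    have "e \<in> graph_edges U (edge_of K q)" using e by simp
    then show ?thesis unfolding e' edge_of_def by (cases K; cases x) auto
  qed
  moreover have "p \<in> chosen K (leaves t) (matched P)"
  proof -
    have "p x \<in> matched P" using matched_leaf[OF p(1)] h(1) p(2,3) by simp
    moreover have "x = inn K \<or> x = out K" using K by (cases x) auto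
    ultimately show ?thesis using p(1) unfolding chosen_def by auto
  qed
  ultimately show "e \<in> edge_of K ` chosen K (leaves t) (matched P)" using e' by blast
next
  fix e assume "e \<in> edge_of K ` chosen K (leaves t) (matched P)"
  then obtain p x where p: "p \<in> leaves t" "x = inn K \<or> x = out K" "p x \<in> matched P" "e = edge_of K p"
    unfolding chosen_def by blast
  then have "(range p, region U (p x)) \<in> P" using matched_leaf[OF p(1)] by simp
  moreover have "eta U (range p, region U (p x)) = e" using p eta_leaf[OF p(1)] by (cases K) auto
  ultimately have "e \<in> eta U ` P" by (intro image_eqI[of _ _ "(range p, region U (p x))"]) simp_all
  moreover have "e \<in> graph_edges U (edge_of K q)"
    unfolding p(4) edge_of_def crossings_eq by (cases K) (simp_all add: p(1) crossings_eq)
  ultimately show "e \<in> eta U ` P \<inter> graph_edges U (edge_of K q)" by blast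
qed

end

text \<open>The parallel root separates the two white sides of each child: \<open>West\<close> of
  \<open>A\<close> joins \<open>East\<close> of \<open>B\<close> in the unbounded region, while
  \<open>East\<close> of \<open>A\<close> joins \<open>West\<close> of \<open>B\<close> in an inner
  one.\<close>

lemma faithful_parts: "faithful (region U) A" "faithful (region U) B"
proof -
  let ?g = "bnd East A @ bnd West B"
  have F: "?g \<in> set (faces t)" "bnd North t \<in> set (faces t)" "bnd South t \<in> set (faces t)"
    "bnd West t @ bnd East t \<in> set (faces t)"
    "c \<in> set (inner_faces A) \<Longrightarrow> c \<in> set (faces t)" "c \<in> set (inner_faces B) \<Longrightarrow> c \<in> set (faces t)" for c
    unfolding faces_def root by auto
  have sepA: "set (bnd x A) \<inter> corners A = set (bnd x A)" "set (bnd x A) \<inter> corners B = {}"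
    and sepB: "set (bnd x B) \<inter> corners B = set (bnd x B)" "set (bnd x B) \<inter> corners A = {}" for x
    using parts(3) subsetD[OF bnd_subset, of _ x A] subsetD[OF bnd_subset, of _ x B] by auto
  have same: "\<forall>d\<in>set c. \<forall>d'\<in>S. region U d = region U d' \<longleftrightarrow> d' \<in> set c"
    if "c \<in> set (faces t)" "S \<subseteq> corners t" for c S
    using region_eq_iff[OF that(1)] that(2) by blast
  show "faithful (region U) A"
  proof (rule faithfulI)
    fix c assume "c \<in> classes A"
    then consider x where "c = set (bnd x A)" | i where "i \<in> set (inner_faces A)" "c = set i"
      unfolding classes_def by auto
    then obtain c' where "c' \<in> set (faces t)" "c = set c' \<inter> corners A"
    proof cases
      case (1 x)
      then show ?thesis
        using that[OF F(1)] that[OF F(2)] that[OF F(3)] that[OF F(4)] sepA(1) sepB(2)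
        unfolding root by (cases x) (simp_all add: Int_Un_distrib2)
    next
      case 2
      then show ?thesis using that[OF F(5)] inner_faces_subset[of i A] by blast
    qed
    then show "\<exists>c'. c = c' \<inter> corners A \<and> (\<forall>d\<in>c'. \<forall>d'\<in>corners A. region U d = region U d' \<longleftrightarrow> d' \<in> c')"
      using same[of c' "corners A"] unfolding root by auto
  qed simp
  show "faithful (region U) B"
  proof (rule faithfulI)
    fix c assume "c \<in> classes B"
    then consider x where "c = set (bnd x B)" | i where "i \<in> set (inner_faces B)" "c = set i"
      unfolding classes_def by auto
    then obtain c' where "c' \<in> set (faces t)" "c = set c' \<inter> corners B"
    proof cases
      case (1 x)
      then show ?thesis
        using that[OF F(1)] that[OF F(2)] that[OF F(3)] that[OF F(4)] sepB(1) sepA(2)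
        unfolding root by (cases x) (simp_all add: Int_Un_distrib2)
    next
      case 2
      then show ?thesis using that[OF F(6)] inner_faces_subset[of i B] by blast
    qed
    then show "\<exists>c'. c = c' \<inter> corners B \<and> (\<forall>d\<in>c'. \<forall>d'\<in>corners B. region U d = region U d' \<longleftrightarrow> d' \<in> c')"
      using same[of c' "corners B"] unfolding root by auto
  qed simp
qed

text \<open>The children share both terminals in either graph: top and bottom in the checkerboard
  graph, and, in crossed order, both white sides in the dual. So the parallel lemma applies for both
  values of \<open>K\<close>. Its right-hand side is \<open>conn\<close> of the root for
  \<open>Ser\<close>, but \<open>reach\<close> of the root for \<open>Par\<close>, where the
  unbounded region identifies the two terminals.\<close>

lemma con_whole:
  "con (eset K (region U) F t) (vset K (region U) t) \<longleftrightarrow>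
     (if K = Ser then conn Ser F t else reach Par F t)"
proof -
  let ?r = "region U"
  let ?s = "terminal ?r (inn K) A" and ?s' = "terminal ?r (out K) A"
  have face: "?r d = ?r d'" if "c \<in> set (faces t)" "d \<in> set c" "d' \<in> set c" for c d d'
    using region_face that by metis
  have F: "bnd East A @ bnd West B \<in> set (faces t)" "bnd North t \<in> set (faces t)" "bnd South t \<in> set (faces t)"
    "bnd West t @ bnd East t \<in> set (faces t)"
    unfolding faces_def root by auto
  have tm: "{?s, ?s'} = {terminal ?r (inn K) B, terminal ?r (out K) B} \<and>
     (?s = terminal ?r (inn K) B \<and> ?s' = terminal ?r (out K) B \<or>
      ?s = terminal ?r (out K) B \<and> ?s' = terminal ?r (inn K) B)"
  proof (cases K)
    case Ser
    have "?r (hd (bnd North A)) = ?r (hd (bnd North B))" "?r (hd (bnd South A)) = ?r (hd (bnd South B))"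
      by (rule face[OF F(2)] face[OF F(3)]; simp add: root)+
    then show ?thesis using Ser unfolding terminal_def by simp
  next
    case Par
    have "?r (hd (bnd West A)) = ?r (hd (bnd East B))" "?r (hd (bnd East A)) = ?r (hd (bnd West B))"
      by (rule face[OF F(4)] face[OF F(1)]; simp add: root)+
    then show ?thesis using Par unfolding terminal_def by auto
  qed
  have int: "vset K ?r A \<inter> vset K ?r B \<subseteq> {?s, ?s'}"
  proof
    fix v assume v: "v \<in> vset K ?r A \<inter> vset K ?r B"
    have "\<exists>x. (x = inn K \<or> x = out K) \<and> v = terminal ?r x A \<and>
        (\<exists>d'\<in>corners B. \<exists>d\<in>set (bnd x A). ?r d = ?r d')"
    proof (rule vset_Int[OF parts(1,3) _ _ v])
      fix c d d' assume c: "c \<in> set (inner_faces A)" "d \<in> set c" "d' \<in> corners B"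
      then have "c \<in> set (faces t)" unfolding faces_def root by auto
      moreover have "d' \<notin> set c" using inner_faces_subset[OF c(1)] c(3) parts(3) by blast
      ultimately show "?r d \<noteq> ?r d'" using region_eq_iff[of c d d'] c root by simp
    next
      fix x d d' assume "d \<in> set (bnd x A)" "d' \<in> set (bnd x A)"
      then show "?r d = ?r d'"
        using face[OF F(1), of d d'] face[OF F(2), of d d'] face[OF F(3), of d d'] face[OF F(4), of d d']
        unfolding root by (cases x) auto
    qed
    then show "v \<in> {?s, ?s'}" by blast
  qed
  note v = terminal_in_vset[where r = ?r and K = K]
  have "?s \<in> vset K ?r B" "?s' \<in> vset K ?r B" using tm v[of B] by auto
  then have "con (eset K ?r F t) (vset K ?r t) \<longleftrightarrow>
      con (eset K ?r F A) (vset K ?r A) \<and> cov (eset K ?r F B) (vset K ?r B) ?s ?s' \<or>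
      cov (eset K ?r F A) (vset K ?r A) ?s ?s' \<and> con (eset K ?r F B) (vset K ?r B)"
    unfolding root eset_Node vset_Node
    by (intro con_cov_parallel(1)[OF sym_eset sym_eset eset_subset eset_subset int v])
  moreover have "cov (eset K ?r F B) (vset K ?r B) ?s ?s' \<longleftrightarrow> reach K F B"
    using tm con_cov_faithful[OF faithful_parts(2) parts(2), of K F] cov_swap by metis
  ultimately show ?thesis
    using con_cov_faithful[OF faithful_parts(1) parts(1), of K F]
      con_cov_faithful[OF faithful_parts(2) parts(2), of K F] root
    by (cases K) simp_all
qed

lemma ends_edge_of:
  assumes "q \<in> leaves t"
  shows "ends U (edge_of K q) = {region U (q (inn K)), region U (q (out K))}"
proof -
  have inc: "incident U (range q) R \<longleftrightarrow> (\<exists>x. R = region U (q x))" for R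
  proof
    assume "incident U (range q) R"
    then obtain x c where "q x \<in> R" "c \<in> set (faces t)" "R = set c"
      unfolding incident_def regions_eq by blast
    then show "\<exists>x. R = region U (q x)" using region_face by metis
  next
    assume "\<exists>x. R = region U (q x)"
    then obtain x where "R = region U (q x)" by blast
    then have "R \<in> regions U" "q x \<in> R"
      using leaf_corner[OF assms] region_self unfolding regions_def darts by auto
    then show "incident U (range q) R" using assms unfolding incident_def crossings_eq by blast
  qed
  have side: "region U (q x) \<in> graph_vertices U (edge_of K q) \<longleftrightarrow> x = inn K \<or> x = out K" for x
  proof -
    have "region U (q x) \<in> regions U" using leaf_corner[OF assms] unfolding regions_def darts by simp
    then show ?thesis
      using vset_Par_iff[OF assms, of x]
      unfolding edge_of_def black_regions_def white_regions_eq[symmetric] by (cases K; cases x) (simp_all add: black_regions_def)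
  qed
  have "R \<in> ends U (edge_of K q) \<longleftrightarrow> (\<exists>x. R = region U (q x) \<and> (x = inn K \<or> x = out K))" for R
  proof -
    have "cb_crossing (edge_of K q) = range q" unfolding edge_of_def by simp
    then have "R \<in> ends U (edge_of K q) \<longleftrightarrow>
        R \<in> graph_vertices U (edge_of K q) \<and> (\<exists>x. R = region U (q x))"
      unfolding ends_def by (simp add: inc)
    then show ?thesis using side by metis
  qed
  then show ?thesis by blast
qed

lemma connects_iff:
  assumes "F \<subseteq> leaves t"
  shows "connects U (edge_of K ` F) (vset K (region U) t) \<longleftrightarrow>
    (if K = Ser then conn Ser F t else reach Par F t)"
proof -
  have "(\<exists>e\<in>edge_of K ` F. ends U e = {R, S}) \<longleftrightarrow> (R, S) \<in> eset K (region U) F t" for R S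
  proof -
    have "(\<exists>e\<in>edge_of K ` F. ends U e = {R, S}) \<longleftrightarrow>
        (\<exists>q\<in>F. {region U (q (inn K)), region U (q (out K))} = {R, S})"
      using assms ends_edge_of by (auto, (metis subsetD)+)
    then show ?thesis using assms unfolding eset_def doubleton_eq_iff by auto
  qed
  then have "{(R, S). \<exists>e\<in>edge_of K ` F. ends U e = {R, S}} = eset K (region U) F t" by auto
  then show ?thesis using con_whole[of K F] unfolding connects_def con_def by simp
qed

lemma edge_of_inj: "inj_on (edge_of K) (leaves t)"
  using inj_on_range_leaves unfolding inj_on_def edge_of_def by auto

text \<open>The two branches of \<open>lower_in\<close> at the state \<open>North\<close> are
  exactly the two connectivity criteria for the whole: \<open>conn\<close> in the checkerboard graph
  and \<open>reach\<close> in the dual. The bit is \<open>False\<close> because there is nothing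
  outside the root.\<close>

lemma activity_letter_leaf:
  assumes P: "perfect_matching U bottom_segment P" and q: "q \<in> leaves t"
  shows "activity_letter U l (eta U ` P) (edge_of K q) =
    (if lower_in K (\<lambda>q. l (range q)) (chosen K (leaves t) (matched P)) t North False q
     then Letter_D else Letter_L)"
proof -
  let ?C = "chosen K (leaves t) (matched P)"
  have C: "?C \<subseteq> leaves t" unfolding chosen_def by blast
  have V: "graph_vertices U (edge_of K q) = vset K (region U) t"
    unfolding edge_of_def white_regions_eq[symmetric] black_regions_eq[symmetric]
    by (cases K) (simp_all add: white_regions_eq black_regions_eq)
  have E: "graph_edges U (edge_of K q) = edge_of K ` leaves t"
    unfolding edge_of_def crossings_eq by (cases K) (simp_all add: image_image crossings_eq)
  have "edge_of K ` ?C - {edge_of K q} = edge_of K ` (?C - {q})"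
    using inj_on_image_set_diff[OF edge_of_inj, of ?C "{q}" K] C q by auto
  then have X: "(eta U ` P \<inter> edge_of K ` leaves t) - {edge_of K q} = edge_of K ` (?C - {q})"
    using eta_matching[OF P q, of K] unfolding E by simp
  have "fundamental_cocycle U (eta U ` P) (edge_of K q) =
      {e \<in> edge_of K ` leaves t. connects U (insert e (edge_of K ` (?C - {q}))) (vset K (region U) t)}"
    unfolding fundamental_cocycle_def E V X ..
  also have "\<dots> = edge_of K ` {g \<in> leaves t. connects U (edge_of K ` (insert g (?C - {q}))) (vset K (region U) t)}"
    unfolding image_insert by blast
  also have "\<dots> = edge_of K ` {g \<in> leaves t.
      if K = Ser then conn Ser (insert g (?C - {q})) t else reach Par (insert g (?C - {q})) t}"
  proof -
    have "connects U (edge_of K ` (insert g (?C - {q}))) (vset K (region U) t) \<longleftrightarrow>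
        (if K = Ser then conn Ser (insert g (?C - {q})) t else reach Par (insert g (?C - {q})) t)"
      if "g \<in> leaves t" for g
      using that C by (intro connects_iff) auto
    then show ?thesis by (simp cong: conj_cong)
  qed
  finally have cocycle: "fundamental_cocycle U (eta U ` P) (edge_of K q) = \<dots>" .
  have cb: "cb_crossing (edge_of K' p) = range p" for K' p unfolding edge_of_def by simp
  have "(\<forall>e\<in>fundamental_cocycle U (eta U ` P) (edge_of K q). l (range q) \<le> l (cb_crossing e)) \<longleftrightarrow>
      \<not> lower_in K (\<lambda>q. l (range q)) ?C t North False q"
    unfolding cocycle lower_in_def by (cases K) (auto simp: cb not_less)
  then show ?thesis unfolding activity_letter_def cb by simp
qed

theorem EI_property_sp:
  assumes "order_ok (\<lambda>q. l (range q)) t" "context_ok {(North, False)} t"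
  shows "EI_property U bottom_segment l"
  unfolding EI_property_def
proof (intro ballI allI impI, elim conjE)
  fix h P Q
  assume h: "h \<in> balanced_half_edges U bottom_segment" "h \<in> P" "h \<in> Q"
    and P: "perfect_matching U bottom_segment P" and Q: "perfect_matching U bottom_segment Q"
  obtain q x where q: "q \<in> leaves t" "h = (range q, region U (q x))"
    using half_edge h(1) by (metis surj_pair)
  let ?K = "if x \<in> {North, South} then Ser else Par"
  have "q x \<in> matched P" "q x \<in> matched Q" using matched_leaf q h by auto
  moreover have "x = inn ?K \<or> x = out ?K" by (cases x) auto
  ultimately have "lower_in ?K (\<lambda>q. l (range q)) (chosen ?K (leaves t) (matched P)) t North False q =
      lower_in ?K (\<lambda>q. l (range q)) (chosen ?K (leaves t) (matched Q)) t North False q"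
    by (intro lower_in_unique[OF assms(2,1) wf_disjoint_leaves[OF wf] subset_refl
          matched_state[OF P] _ matched_state[OF Q] _ q(1)]) simp_all
  then show "activity_letter U l (eta U ` P) (eta U h) = activity_letter U l (eta U ` Q) (eta U h)"
    unfolding q(2) eta_leaf[OF P q(1)] activity_letter_leaf[OF P q(1)] activity_letter_leaf[OF Q q(1)]
    by simp
qed

end

section \<open>Contracting a bigon\<close>

text \<open>The crossing that remains when the bigon between \<open>a\<close> and \<open>b\<close> is contracted, as prescribed
  by \<open>bigon_extension\<close>.\<close>

definition merge_leaves :: "kind \<Rightarrow> (side \<Rightarrow> 'd) \<Rightarrow> (side \<Rightarrow> 'd) \<Rightarrow> side \<Rightarrow> 'd" where
  "merge_leaves k a b x = (if x = inn k \<or> x = nx (inn k) then a x else b x)"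

inductive contracts :: "kind \<Rightarrow> (side \<Rightarrow> 'd) \<Rightarrow> (side \<Rightarrow> 'd) \<Rightarrow> (side \<Rightarrow> 'd) sp \<Rightarrow> (side \<Rightarrow> 'd) sp \<Rightarrow> bool"
  for k a b where
  here: "contracts k a b (Node k f (Leaf a) (Leaf b)) (Leaf (merge_leaves k a b))"
| left: "contracts k a b A A' \<Longrightarrow> contracts k a b (Node k' f A B) (Node k' f A' B)"
| right: "contracts k a b B B' \<Longrightarrow> contracts k a b (Node k' f A B) (Node k' f A B')"

text \<open>The two regions beside the bigon gain one corner each. The new corner directly follows
  the old corner at the neighbouring crossing, so a region list of the contracted tree is turned
  back by replacing single entries with pairs.\<close>

definition expand :: "kind \<Rightarrow> (side \<Rightarrow> 'd) \<Rightarrow> (side \<Rightarrow> 'd) \<Rightarrow> 'd \<Rightarrow> 'd list" where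
  "expand k a b x =
     (if x = a (nx (inn k)) then [x, b (nx (inn k))]
      else if x = b (nx (out k)) then [x, a (nx (out k))] else [x])"

definition new_corners :: "kind \<Rightarrow> (side \<Rightarrow> 'd) \<Rightarrow> (side \<Rightarrow> 'd) \<Rightarrow> 'd set" where
  "new_corners k a b = {a (out k), a (nx (out k)), b (inn k), b (nx (inn k))}"

lemma contracts_exists: "\<nexists>q. t = Leaf q \<Longrightarrow> \<exists>k a b t'. contracts k a b t t'"
proof (induction t)
  case (Node k f A B)
  show ?case
  proof (cases "\<exists>q. A = Leaf q")
    case A: True
    show ?thesis
    proof (cases "\<exists>q. B = Leaf q")
      case True
      with A show ?thesis using contracts.here by blast
    next
      case False
      then show ?thesis using Node.IH(2) contracts.right by blast
    qed
  next
    case False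
    then show ?thesis using Node.IH(1) contracts.left by blast
  qed
qed simp

lemma contracts_size: "contracts k a b t t' \<Longrightarrow> size t' < size t"
  by (induction rule: contracts.induct) auto

lemma contracts_leaves: "contracts k a b t t' \<Longrightarrow> a \<in> leaves t \<and> b \<in> leaves t"
  by (induction rule: contracts.induct) auto

lemma nx_neq [simp]: "inn k \<noteq> nx (inn k)" "out k \<noteq> nx (inn k)" "inn k \<noteq> nx (out k)"
  "out k \<noteq> nx (out k)" "nx (inn k) \<noteq> inn k" "nx (inn k) \<noteq> out k" "nx (out k) \<noteq> inn k"
  "nx (out k) \<noteq> out k" "nx (inn k) \<noteq> nx (out k)" "nx (out k) \<noteq> nx (inn k)"
  "nx (nx (inn k)) = out k" "nx (nx (out k)) = inn k"
  by (cases k; simp)+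

lemma side_four: "x = inn k \<or> x = nx (inn k) \<or> x = out k \<or> x = nx (out k)"
  by (cases k; cases x) auto

lemma merge_leaves_simps [simp]:
  "merge_leaves k a b (inn k) = a (inn k)" "merge_leaves k a b (nx (inn k)) = a (nx (inn k))"
  "merge_leaves k a b (out k) = b (out k)" "merge_leaves k a b (nx (out k)) = b (nx (out k))"
  unfolding merge_leaves_def by simp_all

lemma range_merge: "range (merge_leaves k a b) = range a \<union> range b - new_corners k a b"
  if "inj a" "inj b" "range a \<inter> range b = {}"
proof -
  have ne: "a x \<noteq> b y" "b y \<noteq> a x" for x y using that(3) by auto
  have inj: "a x = a y \<longleftrightarrow> x = y" "b x = b y \<longleftrightarrow> x = y" for x y
    using that(1,2) by (auto dest: injD)
  show ?thesis
  proof (intro set_eqI iffI)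
    fix d assume "d \<in> range (merge_leaves k a b)"
    then obtain x where d: "d = merge_leaves k a b x" by auto
    show "d \<in> range a \<union> range b - new_corners k a b"
      using side_four[of x k] unfolding d new_corners_def
      by (elim disjE) (simp_all add: ne inj)
  next
    fix d assume d: "d \<in> range a \<union> range b - new_corners k a b"
    then consider x where "d = a x" | x where "d = b x" by auto
    then show "d \<in> range (merge_leaves k a b)"
    proof cases
      case (1 x)
      then have "x = inn k \<or> x = nx (inn k)" using side_four[of x k] d unfolding new_corners_def by auto
      then have "d = merge_leaves k a b x" unfolding merge_leaves_def 1 by simp
      then show ?thesis by simp
    next
      case (2 x)
      then have "x = out k \<or> x = nx (out k)" using side_four[of x k] d unfolding new_corners_def by auto
      then have "d = merge_leaves k a b x" unfolding 2 by auto
      then show ?thesis by simp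
    qed
  qed
qed

lemma contracts_inj:
  assumes "contracts k a b t t'" "wf_sp t"
  shows "inj a" "inj b" "range a \<inter> range b = {}"
  using assms by (induction rule: contracts.induct) auto

lemma expand_id:
  assumes "\<And>x. x \<in> set xs \<Longrightarrow> x \<notin> range a \<union> range b"
  shows "concat (map (expand k a b) xs) = xs"
  using assms by (induction xs) (auto simp: expand_def)

lemma contracts_bnd:
  assumes "contracts k a b t t'" "wf_sp t"
  shows "bnd y t = concat (map (expand k a b) (bnd y t'))"
  using assms
proof (induction arbitrary: y rule: contracts.induct)
  case (here f)
  then have "a x \<noteq> b y" "a x = a y \<longleftrightarrow> x = y" "b x = b y \<longleftrightarrow> x = y" "b x \<noteq> a y" for x y
    by (auto dest: injD)
  then show ?case by (cases k; cases y) (simp_all add: expand_def merge_leaves_def)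
next
  case (left A A' k' f B)
  have "x \<notin> range a \<union> range b" if "x \<in> set (bnd y B)" for x y
    using subsetD[OF bnd_subset that] contracts_leaves[OF left(1)] leaf_corner[of _ A] left.prems by auto
  then have B: "concat (map (expand k a b) (bnd y B)) = bnd y B" for y by (rule expand_id)
  show ?case using left.IH left.prems B by (cases y; cases k') simp_all
next
  case (right B B' k' f A)
  have "x \<notin> range a \<union> range b" if "x \<in> set (bnd y A)" for x y
    using subsetD[OF bnd_subset that] contracts_leaves[OF right(1)] leaf_corner[of _ B] right.prems by auto
  then have A: "concat (map (expand k a b) (bnd y A)) = bnd y A" for y by (rule expand_id)
  show ?case using right.IH right.prems A by (cases y; cases k') simp_all
qed

text \<open>The only region that disappears is the bigon, whose two corners are
  \<open>a (out k)\<close> and \<open>b (inn k)\<close>.\<close>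

lemma contracts_inner_faces:
  assumes "contracts k a b t t'" "wf_sp t"
  shows "set (inner_faces t) =
    insert [a (out k), b (inn k)] ((\<lambda>c. concat (map (expand k a b) c)) ` set (inner_faces t'))"
  using assms
proof (induction rule: contracts.induct)
  case (here f)
  show ?case by simp
next
  case (left A A' k' f B)
  have *: "x \<notin> range a \<union> range b" if "x \<in> corners B" for x
    using that contracts_leaves[OF left(1)] leaf_corner[of _ A] left.prems by auto
  have "concat (map (expand k a b) (bnd y B)) = bnd y B" for y
    by (rule expand_id, rule *, erule subsetD[OF bnd_subset])
  moreover have "(\<lambda>c. concat (map (expand k a b) c)) ` set (inner_faces B) = set (inner_faces B)"
  proof -
    have "concat (map (expand k a b) c) = c" if "c \<in> set (inner_faces B)" for c
      by (rule expand_id, rule *, erule subsetD[OF inner_faces_subset[OF that]])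
    then show ?thesis by simp
  qed
  ultimately show ?case
    using left.IH left.prems contracts_bnd[OF left(1)] by (simp add: image_Un insert_commute)
next
  case (right B B' k' f A)
  have *: "x \<notin> range a \<union> range b" if "x \<in> corners A" for x
    using that contracts_leaves[OF right(1)] leaf_corner[of _ B] right.prems by auto
  have "concat (map (expand k a b) (bnd y A)) = bnd y A" for y
    by (rule expand_id, rule *, erule subsetD[OF bnd_subset])
  moreover have "(\<lambda>c. concat (map (expand k a b) c)) ` set (inner_faces A) = set (inner_faces A)"
  proof -
    have "concat (map (expand k a b) c) = c" if "c \<in> set (inner_faces A)" for c
      by (rule expand_id, rule *, erule subsetD[OF inner_faces_subset[OF that]])
    then show ?thesis by simp
  qed
  ultimately show ?case
    using right.IH right.prems contracts_bnd[OF right(1)] by (simp add: image_Un insert_commute)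
qed

lemma new_corners_subset: "new_corners k a b \<subseteq> range a \<union> range b"
  unfolding new_corners_def by auto

lemma contracts_corners:
  assumes "contracts k a b t t'" "wf_sp t"
  shows "corners t' = corners t - new_corners k a b \<and> wf_sp t'"
  using assms
proof (induction rule: contracts.induct)
  case (here f)
  then have ab: "inj a" "inj b" "range a \<inter> range b = {}" by auto
  have "inj (merge_leaves k a b)"
  proof (rule injI)
    fix x y assume "merge_leaves k a b x = merge_leaves k a b y"
    moreover have "a x \<noteq> b y" "b x \<noteq> a y" using ab(3) by auto
    ultimately show "x = y" using ab(1,2) unfolding merge_leaves_def by (auto split: if_splits dest: injD)
  qed
  then show ?case using range_merge[OF ab] by simp
next
  case (left A A' k' f B)
  have "range a \<union> range b \<subseteq> corners A" using contracts_leaves[OF left(1)] leaf_corner[of _ A] by blast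
  then have "corners B - new_corners k a b = corners B"
    using new_corners_subset[of k a b] left.prems by auto
  then show ?case using left.IH left.prems by auto
next
  case (right B B' k' f A)
  have "range a \<union> range b \<subseteq> corners B" using contracts_leaves[OF right(1)] leaf_corner[of _ B] by blast
  then have "corners A - new_corners k a b = corners A"
    using new_corners_subset[of k a b] right.prems by auto
  then show ?case using right.IH right.prems by auto
qed

lemma contracts_leaves_eq:
  assumes "contracts k a b t t'" "wf_sp t"
  shows "leaves t' = insert (merge_leaves k a b) (leaves t - {a, b})"
  using assms
proof (induction rule: contracts.induct)
  case (left A A' k' f B)
  have "leaves A \<inter> leaves B = {}" using wf_disjoint_leaves[OF left.prems] by simp
  then show ?case using left.IH left.prems contracts_leaves[OF left(1)] by auto
next
  case (right B B' k' f A)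
  have "leaves A \<inter> leaves B = {}" using wf_disjoint_leaves[OF right.prems] by simp
  then show ?case using right.IH right.prems contracts_leaves[OF right(1)] by auto
qed auto

text \<open>Of two siblings, the one with the lower labels sees a sibling with higher labels. Its
  context therefore contains all of \<open>C\<close> unchanged, so that functionality at this one
  leaf already gives functionality of \<open>C\<close>.\<close>

lemma part_context_functional:
  assumes "\<forall>y u u'. (y, u) \<in> part_context k (out k) f C \<longrightarrow> (y, u') \<in> part_context k (out k) f C \<longrightarrow> u = u'"
    "\<forall>y u u'. (y, u) \<in> part_context k (inn k) (\<not> f) C \<longrightarrow>
      (y, u') \<in> part_context k (inn k) (\<not> f) C \<longrightarrow> u = u'"
  shows "\<forall>y u u'. (y, u) \<in> C \<longrightarrow> (y, u') \<in> C \<longrightarrow> u = u'"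
proof -
  have "(y, u) \<in> part_context k g False C" if "(y, u) \<in> C" for y u g
    using that unfolding part_context_def by auto
  then show ?thesis using assms by (cases f) (simp, blast)+
qed

lemma contracts_context_ok:
  assumes "contracts k a b t t'" "context_ok C t"
  shows "context_ok C t'"
  using assms
proof (induction arbitrary: C rule: contracts.induct)
  case (here f)
  note parts = here[unfolded context_ok.simps]
  show ?case
    unfolding context_ok.simps by (rule part_context_functional[OF conjunct1[OF parts] conjunct2[OF parts]])
qed simp_all

text \<open>At the node where \<open>q\<close> is separated from the pair, the leaves
  \<open>a\<close> and \<open>b\<close> are on the same side, so they compare with \<open>q\<close>
  in the same way. Hence no label falls between theirs.\<close>

lemma contracts_order_gap:
  assumes "contracts k a b t t'" "order_ok l t" "q \<in> leaves t" "q \<noteq> a" "q \<noteq> b"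
  shows "l q < l a \<and> l q < l b \<or> l a < l q \<and> l b < l q"
  using assms
proof (induction rule: contracts.induct)
  case (left A A' k' f B)
  then show ?case using contracts_leaves[OF left(1)] by (auto split: if_splits)
next
  case (right B B' k' f A)
  then show ?case using contracts_leaves[OF right(1)] by (auto split: if_splits)
qed auto

lemma contracts_order_neq:
  assumes "contracts k a b t t'" "order_ok l t"
  shows "l a \<noteq> l b"
  using assms by (induction rule: contracts.induct) (auto split: if_splits)

text \<open>\<open>l\<close> and \<open>l'\<close> are the labels before and after the contraction.\<close>

lemma contracts_order_ok:
  assumes "contracts k a b t t'" "wf_sp t" "order_ok l t"
    and mono: "\<And>x y. x \<in> leaves t \<Longrightarrow> y \<in> leaves t \<Longrightarrow> l x < l y \<Longrightarrow>
      {x, y} \<noteq> {a, b} \<Longrightarrow> l' (if x = a \<or> x = b then merge_leaves k a b else x) <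
        l' (if y = a \<or> y = b then merge_leaves k a b else y)"
  shows "order_ok l' t'"
proof -
  define \<phi> where "\<phi> x = (if x = a \<or> x = b then merge_leaves k a b else x)" for x
  have "\<And>x y. x \<in> leaves t \<Longrightarrow> y \<in> leaves t \<Longrightarrow> l x < l y \<Longrightarrow> {x, y} \<noteq> {a, b} \<Longrightarrow> l' (\<phi> x) < l' (\<phi> y)"
    using mono unfolding \<phi>_def by blast
  with assms(1-3) show ?thesis
  proof (induction rule: contracts.induct)
    case (left A A' k' f B)
    have sep: "leaves A \<inter> leaves B = {}" using wf_disjoint_leaves[OF left.prems(1)] by simp
    have ab: "a \<in> leaves A" "b \<in> leaves A" using contracts_leaves[OF left(1)] by auto
    have B: "\<phi> x = x" if "x \<in> leaves B" for x using that sep ab unfolding \<phi>_def by auto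
    have A': "leaves A' = \<phi> ` leaves A"
      using contracts_leaves_eq[OF left(1)] left.prems(1) ab unfolding \<phi>_def by auto
    have "order_ok l' A'" using left.IH left.prems by auto
    moreover have "order_ok l' B"
    proof -
      have "l' x < l' y" if "x \<in> leaves B" "y \<in> leaves B" "l x < l y" for x y
      proof -
        have "{x, y} \<noteq> {a, b}" using that ab sep by auto
        then show ?thesis using left.prems(3)[of x y] that B by simp
      qed
      moreover have "order_ok l B" using left.prems by simp
      ultimately show ?thesis
      proof (induction B)
        case (Node k2 f2 B1 B2)
        then show ?case by (cases f2) auto
      qed simp
    qed
    moreover have "if f then l' y < l' x else l' x < l' y" if "x \<in> leaves A'" "y \<in> leaves B" for x y
    proof -
      have "x \<in> \<phi> ` leaves A" using that(1) A' by simp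
      then obtain x0 where x0: "x0 \<in> leaves A" "x = \<phi> x0" by auto
      have "{x0, y} \<noteq> {a, b}" "{y, x0} \<noteq> {a, b}" using that ab sep by auto
      moreover have "if f then l y < l x0 else l x0 < l y" using left.prems(2) x0(1) that(2) by simp
      ultimately show ?thesis
        using left.prems(3)[of x0 y] left.prems(3)[of y x0] x0 that(2) B[OF that(2)] by (cases f) auto
    qed
    ultimately show ?case by simp
  next
    case (right B B' k' f A)
    have sep: "leaves A \<inter> leaves B = {}" using wf_disjoint_leaves[OF right.prems(1)] by simp
    have ab: "a \<in> leaves B" "b \<in> leaves B" using contracts_leaves[OF right(1)] by auto
    have A: "\<phi> x = x" if "x \<in> leaves A" for x using that sep ab unfolding \<phi>_def by auto
    have B': "leaves B' = \<phi> ` leaves B"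
      using contracts_leaves_eq[OF right(1)] right.prems(1) ab unfolding \<phi>_def by auto
    have "order_ok l' B'" using right.IH right.prems by auto
    moreover have "order_ok l' A"
    proof -
      have "l' x < l' y" if "x \<in> leaves A" "y \<in> leaves A" "l x < l y" for x y
      proof -
        have "{x, y} \<noteq> {a, b}" using that ab sep by auto
        then show ?thesis using right.prems(3)[of x y] that A by simp
      qed
      moreover have "order_ok l A" using right.prems by simp
      ultimately show ?thesis
      proof (induction A)
        case (Node k2 f2 A1 A2)
        then show ?case by (cases f2) auto
      qed simp
    qed
    moreover have "if f then l' y < l' x else l' x < l' y" if "x \<in> leaves A" "y \<in> leaves B'" for x y
    proof -
      have "y \<in> \<phi> ` leaves B" using that(2) B' by simp
      then obtain y0 where y0: "y0 \<in> leaves B" "y = \<phi> y0" by auto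
      have "{x, y0} \<noteq> {a, b}" "{y0, x} \<noteq> {a, b}" using that ab sep by auto
      moreover have "if f then l y0 < l x else l x < l y0" using right.prems(2) y0(1) that(1) by simp
      ultimately show ?thesis
        using right.prems(3)[of x y0] right.prems(3)[of y0 x] y0 that(1) A[OF that(1)] by (cases f) auto
    qed
    ultimately show ?case by simp
  qed simp
qed

text \<open>Replacing each entry \<open>x\<close> by the block \<open>ex x\<close> subdivides the
  cycle, and \<open>g'\<close> jumps from the beginning of one block to the beginning of the next.
  The second conclusion recovers the steps of \<open>g\<close> inside the blocks, from which the
  values of \<open>opp\<close> at the new corners are read off.\<close>

lemma cyclic_expand:
  assumes "\<And>x. x \<in> set c \<Longrightarrow> ex x \<noteq> [] \<and> hd (ex x) = x \<and> g' x = g (last (ex x))" "c \<noteq> []"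
    "map g (concat (map ex c)) = tl (concat (map ex c)) @ [z]"
  shows "map g' c = tl c @ [z] \<and> (\<forall>x\<in>set c. map g (ex x) = tl (ex x) @ [g' x])"
  using assms
proof (induction c)
  case (Cons y c)
  obtain r where r: "ex y = y # r" using Cons.prems(1)[of y] by (cases "ex y") auto
  have g': "g' y = g (last (y # r))" using Cons.prems(1)[of y] r by simp
  show ?case
  proof (cases c)
    case Nil
    then have "map g (y # r) = r @ [z]" using Cons.prems(3) r by simp
    moreover from this have "last (map g (y # r)) = z" by simp
    then have "g' y = z" unfolding g' last_map[OF list.distinct(2)] .
    ultimately show ?thesis using Nil r by simp
  next
    case c: (Cons y' c')
    then have "ex y' \<noteq> []" "hd (ex y') = y'" using Cons.prems(1)[of y'] by auto
    then obtain s where s: "concat (map ex c) = y' # s" using c by (cases "ex y'") auto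
    then have "map g (y # r) @ map g (y' # s) = (r @ [y']) @ (s @ [z])"
      using Cons.prems(3) r by simp
    then have e: "map g (y # r) = r @ [y']" "map g (y' # s) = s @ [z]"
      by (subst (asm) append_eq_append_conv; simp)+
    then have "last (map g (y # r)) = y'" by simp
    then have "g' y = y'" unfolding g' last_map[OF list.distinct(2)] .
    moreover have "map g' c = tl c @ [z] \<and> (\<forall>x\<in>set c. map g (ex x) = tl (ex x) @ [g' x])"
    proof (rule Cons.IH)
      show "map g (concat (map ex c)) = tl (concat (map ex c)) @ [z]" unfolding s using e(2) by simp
    qed (use Cons.prems(1) c in auto)
    ultimately show ?thesis using c e(1) r by simp
  qed
qed simp

section \<open>The universe after contraction\<close>

lemma hd_concat_expand: "xs \<noteq> [] \<Longrightarrow> hd (concat (map (expand k a b) xs)) = hd xs"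
  by (cases xs) (simp_all add: expand_def)

lemma set_expand: "set xs \<subseteq> set (concat (map (expand k a b) xs))"
  unfolding expand_def by auto

lemma rotate1_tl: "xs \<noteq> [] \<Longrightarrow> rotate1 xs = tl xs @ [hd xs]"
  by (cases xs) auto

locale contraction = sp_universe t U for t :: "(side \<Rightarrow> 'd) sp" and U +
  fixes k a b t'
  assumes contracts: "contracts k a b t t'"
begin

definition smaller :: "'d plane_map" where
  "smaller = \<lparr>darts = corners t',
     rot = (\<lambda>d. if d \<in> new_corners k a b then d else if d = a (nx (inn k)) then b (out k)
       else if d = b (nx (out k)) then a (inn k) else rot U d),
     opp = (\<lambda>d. if d \<in> new_corners k a b then d else opp U d),
     outer = set (bnd West t') \<union> set (bnd East t')\<rparr>"

lemma smaller_simps [simp]: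
  "darts smaller = corners t'"
  "rot smaller = (\<lambda>d. if d \<in> new_corners k a b then d else if d = a (nx (inn k)) then b (out k)
       else if d = b (nx (out k)) then a (inn k) else rot U d)"
  "opp smaller = (\<lambda>d. if d \<in> new_corners k a b then d else opp U d)"
  "outer smaller = set (bnd West t') \<union> set (bnd East t')"
  unfolding smaller_def by simp_all

lemma ab_leaves: "a \<in> leaves t" "b \<in> leaves t"
  using contracts_leaves[OF contracts] by auto

lemma ab_inj: "a x = a y \<longleftrightarrow> x = y" "b x = b y \<longleftrightarrow> x = y" "a x \<noteq> b y" "b y \<noteq> a x"
  using contracts_inj[OF contracts wf] by (auto dest: injD) (metis disjoint_iff rangeI)+

lemma ab_neq: "a \<noteq> b"
  using ab_inj(3)[of North North] by auto

lemma rot_ab: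
  "rot U (a (inn k)) = a (nx (inn k))" "rot U (a (nx (inn k))) = a (out k)"
  "rot U (a (out k)) = a (nx (out k))" "rot U (a (nx (out k))) = a (inn k)"
  "rot U (b (inn k)) = b (nx (inn k))" "rot U (b (nx (inn k))) = b (out k)"
  "rot U (b (out k)) = b (nx (out k))" "rot U (b (nx (out k))) = b (inn k)"
  using rot[OF ab_leaves(1)] rot[OF ab_leaves(2)] by simp_all

lemma corners_smaller: "corners t' = corners t - new_corners k a b" and wf_smaller: "wf_sp t'"
  using contracts_corners[OF contracts wf] by auto

lemma leaves_smaller: "leaves t' = insert (merge_leaves k a b) (leaves t - {a, b})"
  by (rule contracts_leaves_eq[OF contracts wf])

lemma faces_expand:
  assumes "c \<in> set (faces t')"
  shows "concat (map (expand k a b) c) \<in> set (faces t)"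
proof -
  note B = contracts_bnd[OF contracts wf]
  consider "c = bnd North t'" | "c = bnd South t'" | "c = bnd West t' @ bnd East t'" | "c \<in> set (inner_faces t')"
    using assms unfolding faces_def by auto
  then show ?thesis
  proof cases
    case 4
    then show ?thesis using contracts_inner_faces[OF contracts wf] unfolding faces_def by simp
  qed (simp_all add: faces_def B)
qed

lemma rot_smaller_leaf:
  assumes "q \<in> leaves t'"
  shows "rot smaller (q x) = q (nx x)"
proof (cases "q = merge_leaves k a b")
  case True
  show ?thesis
    using side_four[of x k] unfolding True smaller_simps new_corners_def
    by (elim disjE) (simp_all add: ab_inj rot_ab)
next
  case False
  then have q: "q \<in> leaves t" "q \<noteq> a" "q \<noteq> b" using assms leaves_smaller by auto
  have "q x \<noteq> a y" "q x \<noteq> b y" for y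
    using wf_leaf_inj[OF wf q(1) ab_leaves(1)] wf_leaf_inj[OF wf q(1) ab_leaves(2)] q by blast+
  then show ?thesis using rot[OF q(1)] unfolding smaller_simps new_corners_def by simp
qed

lemma smaller_step:
  assumes "x \<in> corners t'"
  shows "expand k a b x \<noteq> [] \<and> hd (expand k a b x) = x \<and>
    (opp smaller \<circ> rot smaller) x = (opp U \<circ> rot U) (last (expand k a b x))"
proof -
  have x: "x \<notin> new_corners k a b" using assms corners_smaller by simp
  obtain q y where q: "q \<in> leaves t'" "x = q y" using assms unfolding corners_leaves by auto
  then have "rot smaller x \<in> corners t'" using rot_smaller_leaf leaf_corner by metis
  then have "rot smaller x \<notin> new_corners k a b" using corners_smaller by simp
  then have "(opp smaller \<circ> rot smaller) x = opp U (rot smaller x)"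
    unfolding smaller_simps(3) by simp
  moreover have "rot smaller x = rot U (last (expand k a b x))"
    using x unfolding smaller_simps(2) expand_def by (simp add: rot_ab ab_inj)
  ultimately show ?thesis unfolding expand_def by simp
qed

lemma cyclic_smaller:
  assumes "c \<in> set (faces t')"
  shows "map (opp smaller \<circ> rot smaller) c = rotate1 c \<and>
    (\<forall>x\<in>set c. map (opp U \<circ> rot U) (expand k a b x) = tl (expand k a b x) @ [(opp smaller \<circ> rot smaller) x])"
proof -
  have ne: "d \<noteq> []" if "d \<in> set (faces s)" for d and s :: "(side \<Rightarrow> 'd) sp"
  proof -
    have "d \<in> set (inner_faces s) \<Longrightarrow> d \<noteq> []" for s :: "(side \<Rightarrow> 'd) sp" by (induction s) auto
    then show ?thesis using that bnd_nonempty[of _ s] unfolding faces_def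
      by (metis append_is_Nil_conv set_ConsD)
  qed
  have sub: "set c \<subseteq> corners t'"
    using assms inner_faces_subset[of c t'] unfolding faces_def by (auto intro: subsetD[OF bnd_subset])
  let ?e = "concat (map (expand k a b) c)"
  have "map (opp U \<circ> rot U) ?e = tl ?e @ [hd ?e]"
    using cyclic[OF faces_expand[OF assms]] rotate1_tl[OF ne[OF faces_expand[OF assms]]] by simp
  from cyclic_expand[OF _ ne[OF assms] this, of "opp smaller \<circ> rot smaller"] smaller_step sub
  have "map (opp smaller \<circ> rot smaller) c = tl c @ [hd ?e] \<and>
      (\<forall>x\<in>set c. map (opp U \<circ> rot U) (expand k a b x) = tl (expand k a b x) @ [(opp smaller \<circ> rot smaller) x])"
    by blast
  then show ?thesis using hd_concat_expand[OF ne[OF assms]] rotate1_tl[OF ne[OF assms]] by metis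
qed

lemma sp_universe_smaller: "sp_universe t' smaller"
proof
  fix d assume d: "d \<notin> corners t'"
  show "rot smaller d = d \<and> opp smaller d = d"
  proof (cases "d \<in> new_corners k a b")
    case False
    then have "d \<notin> corners t" using d corners_smaller by simp
    moreover from this have "d \<noteq> a x" "d \<noteq> b x" for x
      using leaf_corner[OF ab_leaves(1)] leaf_corner[OF ab_leaves(2)] by auto
    ultimately show ?thesis using off False by simp
  qed simp
qed (use wf_smaller rot_smaller_leaf cyclic_smaller in simp_all)

text \<open>Two of the values are steps inside the blocks inserted into the neighbouring regions;
  the other two are the steps around the bigon.\<close>

lemma opp_new:
  "opp U (a (out k)) = b (nx (inn k))" "opp U (b (nx (inn k))) = a (out k)"
  "opp U (a (nx (out k))) = b (inn k)" "opp U (b (inn k)) = a (nx (out k))"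
proof -
  interpret S: sp_universe t' smaller by (rule sp_universe_smaller)
  have m: "merge_leaves k a b \<in> leaves t'" using leaves_smaller by simp
  have step: "(opp U \<circ> rot U) x = y" if "x \<in> corners t'" "expand k a b x = [x, y]" for x y
  proof -
    from S.faces_cover[OF that(1)] obtain c where c: "c \<in> set (faces t')" "x \<in> set c" by blast
    then have "map (opp U \<circ> rot U) [x, y] = [y] @ [(opp smaller \<circ> rot smaller) x]"
      using cyclic_smaller[OF c(1)] that(2) by (metis list.sel(3))
    then show ?thesis by simp
  qed
  have "a (nx (inn k)) \<in> corners t'" "b (nx (out k)) \<in> corners t'"
    using leaf_corner[OF m, of "nx (inn k)"] leaf_corner[OF m, of "nx (out k)"] by simp_all
  from step[OF this(1)] step[OF this(2)]
  show "opp U (a (out k)) = b (nx (inn k))" "opp U (b (inn k)) = a (nx (out k))"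
    by (simp_all add: expand_def ab_inj rot_ab)
  have "[a (out k), b (inn k)] \<in> set (faces t)"
    using contracts_inner_faces[OF contracts wf] unfolding faces_def by simp
  from cyclic[OF this] show "opp U (a (nx (out k))) = b (inn k)" "opp U (b (nx (inn k))) = a (out k)"
    by (simp_all add: rot_ab)
qed

lemma bigon_extension_smaller:
  "bigon_extension smaller (a (inn k)) (a (out k)) (a (nx (out k))) (b (inn k)) (b (nx (inn k))) U"
proof -
  interpret S: sp_universe t' smaller by (rule sp_universe_smaller)
  have m: "merge_leaves k a b \<in> leaves t'" using leaves_smaller by simp
  note R = S.rot[OF m, of "inn k"] S.rot[OF m, of "nx (inn k)"] S.rot[OF m, of "out k"]
  have r: "rot smaller (a (inn k)) = a (nx (inn k))" "rot smaller (a (nx (inn k))) = b (out k)"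
    "rot smaller (b (out k)) = b (nx (out k))" using R by simp_all
  have d: "a (inn k) \<in> darts smaller" using leaf_corner[OF m, of "inn k"] by simp
  have new: "{a (out k), a (nx (out k)), b (inn k), b (nx (inn k))} = new_corners k a b"
    unfolding new_corners_def ..
  have "new_corners k a b \<subseteq> corners t"
    unfolding new_corners_def using leaf_corner[OF ab_leaves(1)] leaf_corner[OF ab_leaves(2)] by simp
  then have D: "new_corners k a b \<inter> darts smaller = {}" "darts U = darts smaller \<union> new_corners k a b"
    using corners_smaller darts by auto
  have rotU: "rot U = (rot smaller)(a (nx (inn k)) := a (out k), a (out k) := a (nx (out k)),
      a (nx (out k)) := a (inn k), b (nx (out k)) := b (inn k), b (inn k) := b (nx (inn k)),
      b (nx (inn k)) := b (out k))"
    by (rule ext) (simp add: new_corners_def rot_ab ab_inj)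
  have oppU: "opp U = (opp smaller)(a (out k) := b (nx (inn k)), b (nx (inn k)) := a (out k),
      a (nx (out k)) := b (inn k), b (inn k) := a (nx (out k)))"
    by (rule ext) (simp add: new_corners_def opp_new ab_inj)
  have "bnd West t @ bnd East t \<in> set (faces t)" unfolding faces_def by simp
  then have "outer U \<in> regions U" unfolding outer regions_eq by (metis image_eqI set_append)
  moreover have "outer smaller \<subseteq> outer U"
    unfolding outer smaller_simps contracts_bnd[OF contracts wf] by (rule Un_mono[OF set_expand set_expand])
  ultimately show ?thesis
    unfolding bigon_extension_def new D(2) Let_def r
    using d D(1) rotU oppU by (simp add: ab_inj)
qed

text \<open>Undoes a natural labeling: the merged crossing gets the smaller of the two labels, and
  all labels above the pair drop by one. This is possible because the two labels are
  consecutive.\<close>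

lemma natural_labeling_smaller:
  assumes ord: "order_ok (\<lambda>q. l (range q)) t" and lab: "ordered_labeling U l"
  obtains l' where "ordered_labeling smaller l'" "order_ok (\<lambda>q. l' (range q)) t'"
    "natural_labeling smaller l' (crossing smaller (a (inn k)))
       (crossing U (a (out k))) (crossing U (b (inn k))) l"
proof -
  interpret S: sp_universe t' smaller by (rule sp_universe_smaller)
  let ?m = "merge_leaves k a b"
  have m: "?m \<in> leaves t'" using leaves_smaller by simp
  define n where "n = card (leaves t)"
  define i where "i = min (l (range a)) (l (range b))"
  have n: "card (crossings U) = n" unfolding crossings_eq n_def by (rule card_image[OF inj_on_range_leaves])
  have bij: "bij_betw (\<lambda>q. l (range q)) (leaves t) {1..n}"
  proof -
    have "bij_betw l (range ` leaves t) {1..n}"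
      using lab n unfolding ordered_labeling_def crossings_eq by simp
    from bij_betw_trans[OF inj_on_imp_bij_betw[OF inj_on_range_leaves] this]
    show ?thesis unfolding comp_def .
  qed
  note gap = contracts_order_gap[OF contracts ord] and neq = contracts_order_neq[OF contracts ord]
  have inj: "q = q'" if "q \<in> leaves t" "q' \<in> leaves t" "l (range q) = l (range q')" for q q'
    using bij that unfolding bij_betw_def inj_on_def by blast
  have rng: "l (range q) \<in> {1..n}" if "q \<in> leaves t" for q
    using bij that unfolding bij_betw_def by blast
  \<comment> \<open>Otherwise the crossing with label \<open>Suc i\<close> would lie strictly
    between \<open>a\<close> and \<open>b\<close>.\<close>
  have adj: "l (range a) = i \<and> l (range b) = Suc i \<or> l (range a) = Suc i \<and> l (range b) = i"
  proof (rule ccontr)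
    assume n': "\<not> ?thesis"
    then have lt: "Suc i < max (l (range a)) (l (range b))" using neq unfolding i_def by auto
    then have "Suc i \<in> {1..n}" using rng[OF ab_leaves(1)] rng[OF ab_leaves(2)] by auto
    then have "Suc i \<in> (\<lambda>q. l (range q)) ` leaves t" using bij unfolding bij_betw_def by simp
    then obtain q where q: "q \<in> leaves t" "l (range q) = Suc i" by auto
    then have "q \<noteq> a" "q \<noteq> b" using lt neq unfolding i_def by (auto split: if_splits)
    then show False using gap[OF q(1)] q(2) lt unfolding i_def by auto
  qed
  define l' where "l' c = (if c = range ?m then i else if l c < i then l c else l c - 1)" for c
  have val: "l (range q) < i \<or> Suc i < l (range q)" if "q \<in> leaves t" "q \<noteq> a" "q \<noteq> b" for q
    using gap[OF that] adj by auto
  have mr: "range q \<noteq> range ?m" if "q \<in> leaves t - {a, b}" for q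
  proof
    assume "range q = range ?m"
    then have "a (inn k) \<in> range q" using rangeI[of ?m "inn k"] by simp
    then obtain x where "q x = a (inn k)" by auto
    then show False using wf_leaf_inj[OF wf _ ab_leaves(1)] that by blast
  qed
  have l'q: "l' (range q) = (if l (range q) < i then l (range q) else l (range q) - 1)"
    if "q \<in> leaves t - {a, b}" for q using mr[OF that] unfolding l'_def by simp
  have l'm: "l' (range ?m) = i" unfolding l'_def by simp
  let ?\<phi> = "\<lambda>x. if x = a \<or> x = b then ?m else x"
  have mono: "l' (range (?\<phi> x)) < l' (range (?\<phi> y))"
    if "x \<in> leaves t" "y \<in> leaves t" "l (range x) < l (range y)" "{x, y} \<noteq> {a, b}" for x y
  proof -
    have "x \<notin> {a, b} \<or> y \<notin> {a, b}" using that(3,4) by auto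
    then show ?thesis
      using that(1-3) val[of x] val[of y] adj l'q[of x] l'q[of y] l'm by (auto split: if_splits)
  qed
  have ord': "order_ok (\<lambda>q. l' (range q)) t'"
    by (rule contracts_order_ok[OF contracts wf ord]) (rule mono)
  have card': "card (leaves t') = n - 1" "2 \<le> n"
  proof -
    have "?m \<notin> leaves t - {a, b}" using mr by blast
    moreover have "card (leaves t - {a, b}) = n - 2"
      using ab_leaves ab_neq unfolding n_def by (simp add: card_Diff_subset)
    moreover have "card {a, b} \<le> n" unfolding n_def using ab_leaves by (intro card_mono) auto
    ultimately show "card (leaves t') = n - 1" "2 \<le> n" using ab_neq unfolding leaves_smaller by auto
  qed
  have inj': "inj_on (\<lambda>q. l' (range q)) (leaves t')"
  proof (rule inj_onI)
    fix q q' assume q: "q \<in> leaves t'" "q' \<in> leaves t'" "l' (range q) = l' (range q')"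
    obtain p p' where p: "p \<in> leaves t" "q = ?\<phi> p" "p' \<in> leaves t" "q' = ?\<phi> p'"
      using q(1,2) ab_leaves unfolding leaves_smaller by (metis DiffD1 DiffD2 insertE insertI1 insertI2)
    show "q = q'"
    proof (cases "{p, p'} = {a, b}")
      case True
      then show ?thesis using p by auto
    next
      case False
      then have "\<not> l (range p) < l (range p')" "\<not> l (range p') < l (range p)"
        using mono[OF p(1,3)] mono[OF p(3,1)] q(3) unfolding p(2,4) by (auto simp: insert_commute)
      then show ?thesis using inj[OF p(1,3)] p by simp
    qed
  qed
  have "(\<lambda>q. l' (range q)) ` leaves t' \<subseteq> {1..n - 1}"
  proof
    fix v assume "v \<in> (\<lambda>q. l' (range q)) ` leaves t'"
    then consider "v = i" | q where "q \<in> leaves t - {a, b}" "v = l' (range q)"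
      unfolding leaves_smaller using l'm by auto
    then show "v \<in> {1..n - 1}"
    proof cases
      case 1
      then show ?thesis using adj rng[OF ab_leaves(1)] rng[OF ab_leaves(2)] by auto
    next
      case 2
      then show ?thesis using l'q[of q] val[of q] rng[of q] adj rng[OF ab_leaves(1)] rng[OF ab_leaves(2)]
        by auto
    qed
  qed
  then have "bij_betw (\<lambda>q. l' (range q)) (leaves t') {1..n - 1}"
    using inj' card' card_image[OF inj'] unfolding bij_betw_def by (metis card_atLeastAtMost card_subset_eq diff_Suc_1 finite_atLeastAtMost)
  moreover have "card (crossings smaller) = n - 1"
    unfolding S.crossings_eq card_image[OF S.inj_on_range_leaves] by (rule card'(1))
  ultimately have ol: "ordered_labeling smaller l'"
    unfolding ordered_labeling_def S.crossings_eq
    by (simp add: bij_betw_def inj_on_def image_image) metis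
  have cr: "crossing smaller (a (inn k)) = range ?m" "crossing U (a (out k)) = range a"
    "crossing U (b (inn k)) = range b"
    using S.crossing_leaf[OF m, of "inn k"] crossing_leaf ab_leaves by simp_all
  have "natural_labeling smaller l' (range ?m) (range a) (range b) l"
    unfolding natural_labeling_def
  proof (intro conjI ballI)
    fix x assume "x \<in> crossings smaller - {range ?m}"
    then obtain q where q: "q \<in> leaves t - {a, b}" "x = range q"
      unfolding S.crossings_eq leaves_smaller by auto
    then show "l x = (if l' x < l' (range ?m) then l' x else l' x + 1)"
      using l'q[OF q(1)] val[of q] l'm by auto
  next
    show "l (range a) = l' (range ?m) \<and> l (range b) = l' (range ?m) + 1 \<or>
      l (range a) = l' (range ?m) + 1 \<and> l (range b) = l' (range ?m)"
      unfolding l'm using adj by simp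
  qed
  then show ?thesis using that[OF ol ord'] cr by simp
qed

end

section \<open>Reduction to the Hopf link\<close>

lemma hopf_sp:
  assumes "sp_universe (Node Par f (Leaf a) (Leaf b)) U"
  shows "hopf_universe U"
proof -
  interpret sp_universe "Node Par f (Leaf a) (Leaf b)" U by (rule assms)
  have ab: "a x = a y \<longleftrightarrow> x = y" "b x = b y \<longleftrightarrow> x = y" "a x \<noteq> b y" "b y \<noteq> a x" for x y
    using wf by (auto dest: injD)
  have R: "rot U (a x) = a (nx x)" "rot U (b x) = b (nx x)" for x using rot by simp_all
  have F: "faces (Node Par f (Leaf a) (Leaf b)) =
      [[b North, a North], [a South, b South], [a West, b East], [a East, b West]]"
    unfolding faces_def by simp
  have O: "opp U (a North) = b West" "opp U (b West) = a North" "opp U (a West) = b North"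
      "opp U (b North) = a West" "opp U (a South) = b East" "opp U (b East) = a South"
      "opp U (a East) = b South" "opp U (b South) = a East"
    using cyclic[of "[b North, a North]"] cyclic[of "[a South, b South]"] cyclic[of "[a West, b East]"]
      cyclic[of "[a East, b West]"] unfolding F by (simp_all add: R)
  have "outer U \<in> regions U"
    unfolding regions_eq F outer by (simp add: insert_commute)
  have D: "darts U = {a North, a West, a South, a East, b West, b North, b East, b South}"
    unfolding darts by (auto simp: range_side)
  \<comment> \<open>The witnesses for \<open>b0\<close>, \<open>b1\<close>, \<open>b2\<close>,
    \<open>b3\<close> are \<open>b West\<close>, \<open>b North\<close>, \<open>b East\<close>,
    \<open>b South\<close>: the partners under \<open>opp\<close> of the corners of \<open>a\<close>
    taken counterclockwise, hence in clockwise order at \<open>b\<close>.\<close>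
  have "rot U = cycle_of_list [a North, a West, a South, a East] \<circ> cycle_of_list [b South, b East, b North, b West]"
  proof
    fix d show "rot U d = (cycle_of_list [a North, a West, a South, a East] \<circ>
        cycle_of_list [b South, b East, b North, b West]) d"
    proof (cases "d \<in> darts U")
      case True
      then show ?thesis unfolding D by (elim insertE emptyE) (simp_all add: R ab transpose_def)
    next
      case False
      then show ?thesis using off[of d] unfolding darts[symmetric] D by (simp add: transpose_def)
    qed
  qed
  moreover have "opp U = transpose (a North) (b West) \<circ> transpose (a West) (b North) \<circ>
      transpose (a South) (b East) \<circ> transpose (a East) (b South)"
  proof
    fix d show "opp U d = (transpose (a North) (b West) \<circ> transpose (a West) (b North) \<circ>
      transpose (a South) (b East) \<circ> transpose (a East) (b South)) d"
    proof (cases "d \<in> darts U")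
      case True
      then show ?thesis unfolding D by (elim insertE emptyE) (simp_all add: O ab transpose_def)
    next
      case False
      then show ?thesis using off[of d] unfolding darts[symmetric] D by (simp add: transpose_def)
    qed
  qed
  moreover have "distinct [a North, a West, a South, a East, b West, b North, b East, b South]"
    by (simp add: ab)
  ultimately show ?thesis unfolding hopf_universe_def using D \<open>outer U \<in> regions U\<close> by blast
qed

theorem admissible_sp:
  assumes "sp_universe (Node Par f A B) U" "order_ok (\<lambda>q. l (range q)) (Node Par f A B)"
    "context_ok {(North, False)} (Node Par f A B)" "ordered_labeling U l"
  shows "admissible U {hd (bnd South (Node Par f A B)), hd (bnd East (Node Par f A B))} l"
  using assms
proof (induction "size A + size B" arbitrary: A B U l rule: less_induct)
  case less
  let ?t = "Node Par f A B"
  interpret U: sp_link ?t U f A B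
    using less.prems(1) unfolding sp_link_def sp_link_axioms_def by simp
  show ?case
  proof (cases "(\<exists>a. A = Leaf a) \<and> (\<exists>b. B = Leaf b)")
    case True
    then obtain a b where ab: "A = Leaf a" "B = Leaf b" by blast
    have "hopf_universe U" using less.prems(1) hopf_sp unfolding ab by blast
    moreover have "{hd (bnd South ?t), hd (bnd East ?t)} \<in> segments U"
    proof -
      have "[a West, b East] \<in> set (faces ?t)" unfolding ab faces_def by simp
      from U.cyclic[OF this] have "opp U (a South) = b East"
        using U.rot[of a West] unfolding ab by simp
      moreover have "a South \<in> darts U" unfolding U.darts ab by simp
      ultimately show ?thesis unfolding segments_def ab by force
    qed
    ultimately show ?thesis using less.prems(4) by (rule admissible.hopf)
  next
    case False
    \<comment> \<open>The contraction takes place inside one of the children, so the root stays a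
      parallel node with the same flag.\<close>
    obtain k a b A' B' where c: "contracts k a b ?t (Node Par f A' B')"
      using False contracts_exists[of A] contracts_exists[of B] contracts.left contracts.right by metis
    interpret C: contraction ?t U k a b "Node Par f A' B'"
      using c less.prems(1) unfolding contraction_def contraction_axioms_def by simp
    let ?t' = "Node Par f A' B'"
    interpret U': sp_link ?t' C.smaller f A' B'
      using C.sp_universe_smaller unfolding sp_link_def sp_link_axioms_def by simp
    obtain l' where l': "ordered_labeling C.smaller l'" "order_ok (\<lambda>q. l' (range q)) ?t'"
      "natural_labeling C.smaller l' (crossing C.smaller (a (inn k)))
       (crossing U (a (out k))) (crossing U (b (inn k))) l"
      using C.natural_labeling_smaller[OF less.prems(2,4)] .
    have ctx: "context_ok {(North, False)} ?t'" by (rule contracts_context_ok[OF c less.prems(3)])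
    \<comment> \<open>Blocks begin with the old corner, so the first corners on the
      \<open>South\<close> and \<open>East\<close> sides survive and the distinguished segment is
      literally the same set.\<close>
    have s: "{hd (bnd South ?t), hd (bnd East ?t)} = {hd (bnd South ?t'), hd (bnd East ?t')}"
      unfolding contracts_bnd[OF c U.wf, of South] contracts_bnd[OF c U.wf, of East]
      by (simp only: hd_concat_expand[OF bnd_nonempty])
    have "admissible C.smaller {hd (bnd South ?t'), hd (bnd East ?t')} l'"
      using contracts_size[OF c] by (intro less.hyps[OF _ C.sp_universe_smaller l'(2) ctx l'(1)]) simp
    then show ?thesis
      unfolding s
    proof (rule admissible.extend[OF _ _ C.bigon_extension_smaller l'(3)])
      show "EI_property C.smaller {hd (bnd South ?t'), hd (bnd East ?t')} l'"
        using U'.EI_property_sp[OF l'(2) ctx] unfolding U'.bottom_segment_def .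
      show "EI_property U {hd (bnd South ?t'), hd (bnd East ?t')} l"
        using U.EI_property_sp[OF less.prems(2,3)] unfolding U.bottom_segment_def s .
    qed
  qed
qed

section \<open>Universes of two-terminal graphs\<close>

lemma flip_flip [simp]: "flip (flip d) = d"
  by (cases d) auto

lemma successively_cyclic:
  "xs \<noteq> [] \<Longrightarrow> map g xs = rotate1 xs \<longleftrightarrow> successively (\<lambda>x y. g x = y) xs \<and> g (last xs) = hd xs"
proof -
  have *: "map g xs = tl xs @ [z] \<longleftrightarrow> successively (\<lambda>x y. g x = y) xs \<and> g (last xs) = z"
    if "xs \<noteq> []" for xs z
    using that
  proof (induction xs)
    case (Cons x xs)
    then show ?case by (cases xs) auto
  qed simp
  show "xs \<noteq> [] \<Longrightarrow> ?thesis" using *[of xs "hd xs"] rotate1_tl[of xs] by simp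
qed

lemma cyclic_rotate: "map g xs = rotate1 xs \<Longrightarrow> map g (rotate n xs) = rotate1 (rotate n xs)"
  unfolding rotate_map[symmetric] by (simp only: rotate1_rotate_swap)

lemma cyclic_inv_rev:
  assumes "map r v = rotate1 v" "\<And>x. x \<in> set v \<Longrightarrow> i (r x) = x"
  shows "map i (rev v) = rotate1 (rev v)"
proof (cases v)
  case (Cons x xs)
  have "map i (map r v) = v" unfolding map_map using assms(2) by (intro map_idI) simp
  then have "map i (rotate1 v) = v" unfolding assms(1) .
  then have "map i (xs @ [x]) = x # xs" unfolding Cons by simp
  then have "rev (map i (xs @ [x])) = rev (x # xs)" by (rule arg_cong)
  then have "i x # map i (rev xs) = rev xs @ [x]" by (simp add: rev_map)
  then show ?thesis unfolding Cons by (cases "rev xs") auto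
qed simp

definition rotations :: "'a list \<Rightarrow> 'a list set" where
  "rotations v = range (\<lambda>n. rotate n v)"

lemma rotations_rotate1: "rotations (rotate1 v) = rotations v"
proof -
  have rot: "rotate n (rotate1 v) = rotate (Suc n) v" for n
    by (simp only: rotate_Suc rotate1_rotate_swap)
  have "rotate n v \<in> rotations (rotate1 v)" for n
  proof (cases n)
    case 0
    have "rotate (length v - 1) (rotate1 v) = v"
    proof (cases v)
      case (Cons x xs)
      then have "Suc (length v - 1) = length v" by simp
      then show ?thesis unfolding rot by simp
    qed simp
    then show ?thesis using 0 unfolding rotations_def by (metis rangeI rotate0 id_apply)
  next
    case (Suc m)
    then show ?thesis unfolding rotations_def using rot[of m] by (metis rangeI)
  qed
  moreover have "rotate n (rotate1 v) \<in> rotations v" for n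
    unfolding rotations_def rot by (rule rangeI)
  ultimately show ?thesis unfolding rotations_def by blast
qed

lemma rotations_eqD: "rotations v = rotations w \<Longrightarrow> \<exists>n. v = rotate n w"
proof -
  assume "rotations v = rotations w"
  moreover have "v \<in> rotations v" unfolding rotations_def by (metis rangeI rotate0 id_apply)
  ultimately show ?thesis unfolding rotations_def by auto
qed

text \<open>An inner vertex determines its list of darts only up to rotation, and the order in which the
  inner vertices are listed is immaterial.\<close>

definition eqv :: "'e two_terminal \<Rightarrow> 'e two_terminal \<Rightarrow> bool" where
  "eqv B B' \<longleftrightarrow> top_darts B = top_darts B' \<and> bottom_darts B = bottom_darts B' \<and>
     image_mset rotations (mset (inner_vertices B)) = image_mset rotations (mset (inner_vertices B'))"

lemma eqv_refl [simp]: "eqv B B"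
  unfolding eqv_def by simp

lemma eqv_trans: "eqv A B \<Longrightarrow> eqv B C \<Longrightarrow> eqv A C"
  unfolding eqv_def by simp

lemma eqv_series: "eqv A A' \<Longrightarrow> eqv B B' \<Longrightarrow> eqv (series A B) (series A' B')"
  unfolding eqv_def series_def by simp

lemma eqv_parallel: "eqv A A' \<Longrightarrow> eqv B B' \<Longrightarrow> eqv (parallel [A, B]) (parallel [A', B'])"
  unfolding eqv_def parallel_def by simp

lemma eqv_series_assoc: "eqv (series (series A B) C) (series A (series B C))"
  unfolding eqv_def series_def by simp

lemma parallel_assoc: "parallel [parallel [A, B], C] = parallel [A, parallel [B, C]]"
  unfolding parallel_def by simp

lemma parallel_single: "parallel [B] = B"
  unfolding parallel_def by simp

lemma parallel_Cons: "parallel (B # Bs) = parallel [B, parallel Bs]"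
  unfolding parallel_def by simp

lemma multi_edge_box_single: "multi_edge_box [e] = path_box [e]"
  unfolding multi_edge_box_def path_box_def by simp

lemma multi_edge_box_Cons: "multi_edge_box (e # es) = parallel [path_box [e], multi_edge_box es]"
  unfolding multi_edge_box_def path_box_def parallel_def by simp

lemma eqv_path_box_Cons:
  assumes "es \<noteq> []"
  shows "eqv (path_box (e # es)) (series (path_box [e]) (path_box es))"
proof -
  obtain e' es' where es: "es = e' # es'" using assms by (cases es) auto
  have "rotations [Head e, Tail e'] = rotations [Tail e', Head e]"
    using rotations_rotate1[of "[Head e, Tail e']"] by simp
  then show ?thesis unfolding eqv_def series_def path_box_def es by simp
qed

section \<open>From trees to plane graphs and their universes\<close>

primrec graph_of :: "'e sp \<Rightarrow> 'e two_terminal" where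
  "graph_of (Leaf e) = path_box [e]"
| "graph_of (Node k f A B) =
     (if k = Par then parallel [graph_of A, graph_of B] else series (graph_of A) (graph_of B))"

text \<open>Seen along the dart at the tail, which points down, the face on the right is the western
  one; along the dart at the head it is the eastern one. The flag \<open>True\<close> marks the
  corners in the regions of the two end vertices.\<close>

fun edge_corner :: "'e \<Rightarrow> side \<Rightarrow> 'e dart \<times> bool" where
  "edge_corner e North = (Tail e, True)"
| "edge_corner e West = (Tail e, False)"
| "edge_corner e South = (Head e, True)"
| "edge_corner e East = (Head e, False)"

abbreviation corner_tree :: "'e sp \<Rightarrow> (side \<Rightarrow> 'e dart \<times> bool) sp" where
  "corner_tree \<equiv> map_sp edge_corner"

lemma leaves_map: "leaves (map_sp h t) = h ` leaves t"
  by (induction t) auto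

lemma range_edge_corner: "range (edge_corner e) = crossing_of_edge e"
  unfolding range_side crossing_of_edge_def by auto

lemma corners_corner_tree: "corners (corner_tree t) = (Tail ` leaves t \<union> Head ` leaves t) \<times> UNIV"
  unfolding corners_leaves leaves_map by (auto simp: range_edge_corner crossing_of_edge_def)

lemma wf_corner_tree: "disjoint_leaves t \<Longrightarrow> wf_sp (corner_tree t)"
proof (induction t)
  case (Leaf e)
  have "edge_corner e x = edge_corner e y \<Longrightarrow> x = y" for x y by (cases x; cases y) auto
  then show ?case by (auto intro: injI)
next
  case (Node k f A B)
  then show ?case by (auto simp: corners_corner_tree)
qed

lemma graph_of_nonempty [simp]: "top_darts (graph_of t) \<noteq> []" "bottom_darts (graph_of t) \<noteq> []"
  by (induction t) (auto simp: path_box_def parallel_def series_def)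

definition vertex_lists :: "'e two_terminal \<Rightarrow> 'e dart list list" where
  "vertex_lists B = top_darts B # rev (bottom_darts B) # inner_vertices B"

lemma mset_vertex_lists_graph_of:
  "disjoint_leaves t \<Longrightarrow>
     mset (concat (vertex_lists (graph_of t))) = mset_set (Tail ` leaves t \<union> Head ` leaves t)"
proof (induction t)
  case (Leaf e)
  then show ?case by (simp add: vertex_lists_def path_box_def)
next
  case (Node k f A B)
  let ?D = "\<lambda>t. Tail ` leaves t \<union> Head ` leaves t"
  have "mset (concat (vertex_lists (graph_of (Node k f A B)))) =
      mset (concat (vertex_lists (graph_of A))) + mset (concat (vertex_lists (graph_of B)))"
    by (cases k) (simp_all add: vertex_lists_def parallel_def series_def)
  also have "\<dots> = mset_set (?D A) + mset_set (?D B)" using Node by simp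
  also have "\<dots> = mset_set (?D A \<union> ?D B)"
    using Node.prems by (intro mset_set_Union[symmetric]) auto
  also have "?D A \<union> ?D B = ?D (Node k f A B)" by auto
  finally show ?case .
qed

text \<open>All rotations of a list have the same multiset of entries, so this multiset can be
  computed from the class, and the multiset of the concatenation is the sum over the
  classes.\<close>

lemma mset_concat_rotations:
  assumes "image_mset rotations (mset vs) = image_mset rotations (mset ws)"
  shows "mset (concat vs) = mset (concat ws)"
proof -
  define m where "m c = mset (SOME v. v \<in> c)" for c :: "'a list set"
  have m: "m (rotations v) = mset v" for v :: "'a list"
  proof -
    have "v \<in> rotations v" unfolding rotations_def by (metis rangeI rotate0 id_apply)
    then have "(SOME u. u \<in> rotations v) \<in> rotations v" by (rule someI)
    then obtain n where "(SOME u. u \<in> rotations v) = rotate n v" unfolding rotations_def by auto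
    moreover have "mset (rotate1 w) = mset w" for w :: "'a list" by (cases w) simp_all
    then have "mset (rotate n v) = mset v" by (induction n) simp_all
    ultimately show ?thesis unfolding m_def by simp
  qed
  have "mset (concat us) = sum_mset (image_mset m (image_mset rotations (mset us)))" for us :: "'a list list"
    by (induction us) (simp_all add: m)
  then show ?thesis using assms by simp
qed

lemma mset_eq_mset_set:
  assumes "mset xs = mset_set S" "finite S"
  shows "distinct xs" "set xs = S"
proof -
  show "set xs = S" using assms by (metis finite_set_mset_mset_set set_mset_mset)
  show "distinct xs" unfolding distinct_count_atmost_1 assms(1) using assms by (auto simp: \<open>set xs = S\<close>)
qed

lemma foldr_cycles:
  assumes "distinct (concat vs)"
  shows "(\<forall>v\<in>set vs. \<forall>d\<in>set v. foldr (\<lambda>v g. cycle_of_list v \<circ> g) vs id d = cycle_of_list v d) \<and>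
    (\<forall>d. d \<notin> set (concat vs) \<longrightarrow> foldr (\<lambda>v g. cycle_of_list v \<circ> g) vs id d = d)"
  using assms
proof (induction vs)
  case (Cons v vs)
  define g where "g = foldr (\<lambda>v g. cycle_of_list v \<circ> g) vs id"
  have dis: "set v \<inter> set (concat vs) = {}" and "distinct (concat vs)" using Cons.prems by auto
  then have IH: "\<forall>v\<in>set vs. \<forall>d\<in>set v. g d = cycle_of_list v d" "\<forall>d. d \<notin> set (concat vs) \<longrightarrow> g d = d"
    using Cons.IH unfolding g_def by blast+
  have "cycle_of_list v (g d) = g d" if "d \<in> set w" "w \<in> set vs" for d w
  proof -
    have "g d = cycle_of_list w d" using IH(1) that by blast
    moreover have "cycle_of_list w d \<in> set w" using permutes_in_image[OF cycle_permutes[of w]] that by blast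
    ultimately show ?thesis using that dis by (intro id_outside_supp) auto
  qed
  moreover have "g d = d" if "d \<in> set v" for d using IH(2) dis that by blast
  moreover have eq: "foldr (\<lambda>v g. cycle_of_list v \<circ> g) (v # vs) id = cycle_of_list v \<circ> g"
    unfolding g_def by simp
  ultimately show ?case unfolding eq using IH by (auto simp: id_outside_supp)
qed simp

lemma cycle_of_list_cyclic: "distinct v \<Longrightarrow> map (cycle_of_list v) v = rotate1 v"
  using cyclic_rotation[of v 1] by simp

text \<open>\<open>r\<close> is the rotation of the plane graph and \<open>g\<close> moves to the next corner of a region of the
  universe.\<close>

lemma white_boundaries:
  assumes "\<And>d. d \<in> Tail ` leaves t \<union> Head ` leaves t \<Longrightarrow> g (flip d, False) = (r d, False)"
    and "\<And>v. v \<in> set (inner_vertices (graph_of t)) \<Longrightarrow> map r v = rotate1 v"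
    and "successively (\<lambda>x y. r x = y) (top_darts (graph_of t))"
    and "successively (\<lambda>x y. r x = y) (rev (bottom_darts (graph_of t)))"
  shows "successively (\<lambda>x y. g x = y) (bnd West (corner_tree t)) \<and>
    successively (\<lambda>x y. g x = y) (bnd East (corner_tree t)) \<and>
    hd (bnd West (corner_tree t)) = (hd (top_darts (graph_of t)), False) \<and>
    last (bnd West (corner_tree t)) = (flip (hd (bottom_darts (graph_of t))), False) \<and>
    hd (bnd East (corner_tree t)) = (last (bottom_darts (graph_of t)), False) \<and>
    last (bnd East (corner_tree t)) = (flip (last (top_darts (graph_of t))), False) \<and>
    (\<forall>c\<in>set (inner_faces (corner_tree t)). (\<forall>d\<in>set c. \<not> snd d) \<longrightarrow> map g c = rotate1 c)"
  using assms
proof (induction t)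
  case (Leaf e)
  then show ?case by (simp add: path_box_def)
next
  case (Node k f A B)
  let ?s = "successively (\<lambda>x y. r x = y)" and ?sg = "successively (\<lambda>x y. g x = y)"
  let ?A = "graph_of A" and ?B = "graph_of B" and ?CA = "corner_tree A" and ?CB = "corner_tree B"
  have D: "top_darts (graph_of t) \<noteq> [] \<and> set (top_darts (graph_of t)) \<subseteq> Tail ` leaves t \<and>
      bottom_darts (graph_of t) \<noteq> [] \<and> set (bottom_darts (graph_of t)) \<subseteq> Head ` leaves t" for t :: "'a sp"
    by (induction t) (auto simp: path_box_def parallel_def series_def)
  have in_D: "last (top_darts (graph_of t)) \<in> Tail ` leaves t" "hd (bottom_darts (graph_of t)) \<in> Head ` leaves t"
    for t :: "'a sp"
    using D[of t] last_in_set[of "top_darts (graph_of t)"] hd_in_set[of "bottom_darts (graph_of t)"] by blast+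
  have g: "g (flip (last (top_darts ?A)), False) = (r (last (top_darts ?A)), False)"
      "g (flip (last (top_darts ?B)), False) = (r (last (top_darts ?B)), False)"
      "g (flip (hd (bottom_darts ?A)), False) = (r (hd (bottom_darts ?A)), False)"
      "g (flip (hd (bottom_darts ?B)), False) = (r (hd (bottom_darts ?B)), False)"
    using in_D[of A] in_D[of B] by (auto intro!: Node.prems(1))
  have gA: "g (flip d, False) = (r d, False)" if "d \<in> Tail ` leaves A \<union> Head ` leaves A" for d
    using that by (intro Node.prems(1)) auto
  have gB: "g (flip d, False) = (r d, False)" if "d \<in> Tail ` leaves B \<union> Head ` leaves B" for d
    using that by (intro Node.prems(1)) auto
  show ?case
  proof (cases k)
    case Par
    have s: "?s (top_darts ?A)" "?s (top_darts ?B)" "r (last (top_darts ?A)) = hd (top_darts ?B)"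
      "?s (rev (bottom_darts ?A))" "?s (rev (bottom_darts ?B))"
      "r (hd (bottom_darts ?B)) = last (bottom_darts ?A)"
      using Node.prems(3,4) Par
      by (simp_all add: parallel_def successively_append_iff last_rev hd_rev)
    have iv: "map r v = rotate1 v" if "v \<in> set (inner_vertices ?A) \<union> set (inner_vertices ?B)" for v
      using Node.prems(2)[of v] that Par by (auto simp: parallel_def)
    note IH = Node.IH(1)[OF gA iv s(1,4), simplified] Node.IH(2)[OF gB iv s(2,5), simplified]
    have "map g (bnd East ?CA @ bnd West ?CB) = rotate1 (bnd East ?CA @ bnd West ?CB)"
      by (subst successively_cyclic) (simp_all add: successively_append_iff IH g s)
    then show ?thesis using IH D[of A] D[of B] Par by (auto simp: parallel_def)
  next
    case Ser
    have "map r (top_darts ?B @ rev (bottom_darts ?A)) = rotate1 (top_darts ?B @ rev (bottom_darts ?A))"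
      by (intro Node.prems(2)) (simp add: series_def Ser)
    then have s: "?s (top_darts ?B)" "?s (rev (bottom_darts ?A))"
      "r (last (top_darts ?B)) = last (bottom_darts ?A)" "r (hd (bottom_darts ?A)) = hd (top_darts ?B)"
      using D[of A] D[of B]
      by (subst (asm) successively_cyclic; simp add: successively_append_iff last_rev hd_rev)+
    have s': "?s (top_darts ?A)" "?s (rev (bottom_darts ?B))"
      using Node.prems(3,4) Ser by (simp_all add: series_def)
    have iv: "map r v = rotate1 v" if "v \<in> set (inner_vertices ?A) \<union> set (inner_vertices ?B)" for v
      using Node.prems(2)[of v] that Ser by (auto simp: series_def)
    note IH = Node.IH(1)[OF gA iv s'(1) s(2), simplified] Node.IH(2)[OF gB iv s(1) s'(2), simplified]
    have "snd (hd (bnd South ?CA))"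
      using bnd_type[OF hd_bnd[of South ?CA]] unfolding leaves_map by auto
    then have "\<exists>d\<in>set (bnd South ?CA). snd d" using hd_bnd by blast
    then show ?thesis
      using IH D[of A] D[of B] g s Ser by (auto simp: series_def successively_append_iff)
  qed
qed

text \<open>In a black region the next corner of the universe is given by the inverse rotation of
  the plane graph, so the dart lists at vertices appear reversed. The flag \<open>True\<close>
  distinguishes these inner faces from the white ones.\<close>

lemma black_boundaries:
  "bnd North (corner_tree t) = map (\<lambda>d. (d, True)) (rev (top_darts (graph_of t))) \<and>
   bnd South (corner_tree t) = map (\<lambda>d. (d, True)) (bottom_darts (graph_of t)) \<and>
   (\<forall>c\<in>set (inner_faces (corner_tree t)). (\<exists>d\<in>set c. snd d) \<longrightarrow>
     (\<exists>v\<in>set (inner_vertices (graph_of t)). c = map (\<lambda>d. (d, True)) (rev v)))"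
proof (induction t)
  case (Leaf e)
  then show ?case by (simp add: path_box_def)
next
  case (Node k f A B)
  show ?case
  proof (cases k)
    case Par
    have "\<not> snd d" if "d \<in> set (bnd East (corner_tree A) @ bnd West (corner_tree B))" for d
      using that bnd_type[of d East "corner_tree A"] bnd_type[of d West "corner_tree B"]
      unfolding leaves_map by auto
    then show ?thesis using Node Par by (auto simp: parallel_def)
  next
    case Ser
    then show ?thesis using Node by (auto simp: series_def rev_map)
  qed
qed

theorem sp_universe_universe:
  assumes e: "eqv B (graph_of t)" and dis: "disjoint_leaves t"
  shows "sp_universe (corner_tree t) (universe B)"
    and "lower_segment B = {hd (bnd South (corner_tree t)), hd (bnd East (corner_tree t))}"
proof -
  let ?D = "Tail ` leaves t \<union> Head ` leaves t"
  let ?M = "to_plane_map B"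
  let ?vs = "vertex_lists B"
  let ?U = "universe B"
  define r where "r = rot ?M"
  have top: "top_darts B = top_darts (graph_of t)" and bot: "bottom_darts B = bottom_darts (graph_of t)"
    and inn: "image_mset rotations (mset (inner_vertices B)) =
      image_mset rotations (mset (inner_vertices (graph_of t)))"
    using e unfolding eqv_def by auto
  have "mset (concat ?vs) = mset_set ?D"
    using mset_concat_rotations[OF inn] mset_vertex_lists_graph_of[OF dis] top bot
    unfolding vertex_lists_def by simp
  note vs = mset_eq_mset_set[OF this]
  have dvs: "distinct (concat ?vs)" and svs: "set (concat ?vs) = ?D" using vs by simp_all
  have opp: "opp ?M d = (if d \<in> ?D then flip d else d)" and darts: "darts ?M = ?D"
    and rot: "rot ?M = foldr (\<lambda>v g. cycle_of_list v \<circ> g) ?vs id"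
    and outer: "outer ?M = orbit (opp ?M \<circ> rot ?M) (hd (bottom_darts B))" for d
    using svs unfolding to_plane_map_def vertex_lists_def Let_def by auto
  have rD: "map r v = rotate1 v" if "v \<in> set ?vs" for v
  proof -
    have "distinct v" using dvs that by (simp add: distinct_concat_iff)
    have "map r v = map (cycle_of_list v) v"
      unfolding r_def rot using foldr_cycles[OF dvs] that by (intro map_cong refl) blast
    then show ?thesis using cycle_of_list_cyclic[OF \<open>distinct v\<close>] by simp
  qed
  have roff: "r d = d" if "d \<notin> ?D" for d
    unfolding r_def rot
    by (rule conjunct2[OF foldr_cycles[OF dvs], rule_format]) (use that svs in simp)
  have r_in: "r d \<in> ?D" if "d \<in> ?D" for d
  proof -
    from that have "d \<in> set (concat ?vs)" by (simp only: svs)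
    then obtain v where v: "v \<in> set ?vs" "d \<in> set v" by auto
    then have "r d \<in> set (map r v)" by simp
    then show ?thesis unfolding rD[OF v(1)] using v(1) svs by auto
  qed
  have "r ` ?D = ?D"
  proof
    show "?D \<subseteq> r ` ?D"
    proof
      fix d assume "d \<in> ?D"
      then have "d \<in> set (concat ?vs)" by (simp only: svs)
      then obtain v where v: "v \<in> set ?vs" "d \<in> set v" by auto
      then have "d \<in> set (map r v)" unfolding rD[OF v(1)] by simp
      moreover have "set v \<subseteq> ?D" unfolding svs[symmetric] using v(1) by auto
      ultimately show "d \<in> r ` ?D" unfolding set_map by blast
    qed
  qed (use r_in in blast)
  moreover have "finite ?D" by simp
  \<comment> \<open>A surjection of a finite set onto itself is injective; this makes
    \<open>inv r\<close>, which occurs in the medial graph, a genuine inverse.\<close>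
  ultimately have "inj_on r ?D" by (simp add: eq_card_imp_inj_on)
  then have "inj r" unfolding inj_on_def using roff r_in by metis
  then have inv_r: "inv r (r d) = d" for d by simp
  define g where "g = opp ?U \<circ> rot ?U"
  have U: "darts ?U = ?D \<times> UNIV"
    "rot ?U = (\<lambda>(d, b). if d \<in> ?D then (if b then (d, False) else (flip d, True)) else (d, b))"
    "opp ?U = (\<lambda>(d, b). if d \<in> ?D then (if b then (r d, False) else (inv r d, True)) else (d, b))"
    "outer ?U = (\<lambda>d. (r d, False)) ` outer ?M"
    unfolding universe_def medial_def darts opp r_def by (auto simp: fun_eq_iff)
  have flipD: "flip d \<in> ?D" if "d \<in> ?D" for d using that by auto
  have gT: "g (d, True) = (inv r d, True)" and gF: "g (flip d, False) = (r d, False)" if "d \<in> ?D" for d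
    using that flipD[OF that] unfolding g_def U by auto
  have iv: "map r v = rotate1 v" if "v \<in> set (inner_vertices (graph_of t))" for v
  proof -
    have "rotations v \<in># image_mset rotations (mset (inner_vertices B))" unfolding inn using that by simp
    then obtain w where w: "w \<in> set (inner_vertices B)" "rotations v = rotations w" by auto
    then obtain n where "v = rotate n w" using rotations_eqD by blast
    moreover have "map r w = rotate1 w" using rD[of w] w(1) unfolding vertex_lists_def by simp
    ultimately show ?thesis using cyclic_rotate by simp
  qed
  have cyc_top: "map r (top_darts (graph_of t)) = rotate1 (top_darts (graph_of t))"
    and cyc_bot: "map r (rev (bottom_darts (graph_of t))) = rotate1 (rev (bottom_darts (graph_of t)))"
    using rD[of "top_darts B"] rD[of "rev (bottom_darts B)"] unfolding top bot vertex_lists_def by simp_all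
  have top_s: "successively (\<lambda>x y. r x = y) (top_darts (graph_of t))"
      "r (last (top_darts (graph_of t))) = hd (top_darts (graph_of t))"
    using cyc_top successively_cyclic[of "top_darts (graph_of t)" r] by simp_all
  have bot_s: "successively (\<lambda>x y. r x = y) (rev (bottom_darts (graph_of t)))"
      "r (hd (bottom_darts (graph_of t))) = last (bottom_darts (graph_of t))"
    using cyc_bot successively_cyclic[of "rev (bottom_darts (graph_of t))" r]
    by (simp_all add: last_rev hd_rev)
  note W = white_boundaries[OF gF iv top_s(1) bot_s(1)]
  have ends_D: "last (top_darts (graph_of t)) \<in> ?D" "hd (bottom_darts (graph_of t)) \<in> ?D"
    unfolding svs[symmetric] vertex_lists_def top bot by simp_all
  have black: "map g (map (\<lambda>d. (d, True)) (rev v)) = rotate1 (map (\<lambda>d. (d, True)) (rev v))"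
    if v: "map r v = rotate1 v" "set v \<subseteq> ?D" for v
  proof -
    have "map g (map (\<lambda>d. (d, True)) (rev v)) = map (\<lambda>d. (d, True)) (map (inv r) (rev v))"
      using gT v(2) by (auto simp: rev_map)
    also have "\<dots> = map (\<lambda>d. (d, True)) (rotate1 (rev v))"
      unfolding cyclic_inv_rev[OF v(1) inv_r] ..
    finally show ?thesis by (simp add: rotate1_map)
  qed
  have sub: "set v \<subseteq> ?D" if "v \<in> set (vertex_lists (graph_of t))" for v
  proof -
    have "set (concat (vertex_lists (graph_of t))) = ?D"
      using mset_eq_mset_set[OF mset_vertex_lists_graph_of[OF dis]] by simp
    then show ?thesis using that by auto
  qed
  let ?t = "corner_tree t"
  have outer_cyc: "map g (bnd West ?t @ bnd East ?t) = rotate1 (bnd West ?t @ bnd East ?t)"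
    using W gF[OF ends_D(1)] gF[OF ends_D(2)] top_s(2) bot_s(2)
    by (subst successively_cyclic) (simp_all add: successively_append_iff)
  have cyclic: "map (opp ?U \<circ> rot ?U) c = rotate1 c" if "c \<in> set (faces ?t)" for c
  proof -
    from that consider "c = bnd North ?t" | "c = bnd South ?t" | "c = bnd West ?t @ bnd East ?t" |
      "c \<in> set (inner_faces ?t)" "\<exists>d\<in>set c. snd d" | "c \<in> set (inner_faces ?t)" "\<forall>d\<in>set c. \<not> snd d"
      unfolding faces_def by auto
    then have "map g c = rotate1 c"
    proof cases
      case 1
      then show ?thesis using black[OF cyc_top] sub black_boundaries[of t] unfolding vertex_lists_def by simp
    next
      case 2
      then show ?thesis using black[OF cyc_bot] sub[of "rev (bottom_darts (graph_of t))"] black_boundaries[of t]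
        unfolding vertex_lists_def by simp
    next
      case 3
      then show ?thesis using outer_cyc by simp
    next
      case 4
      then obtain v where v: "v \<in> set (inner_vertices (graph_of t))" "c = map (\<lambda>d. (d, True)) (rev v)"
        using black_boundaries[of t] by blast
      then show ?thesis using black[OF iv[OF v(1)]] sub[of v] unfolding vertex_lists_def by simp
    next
      case 5
      then show ?thesis using W by blast
    qed
    then show ?thesis unfolding g_def .
  qed
  have outerU: "outer ?U = set (bnd West ?t) \<union> set (bnd East ?t)"
  proof -
    let ?h = "\<lambda>d. (r d, False)" and ?x = "hd (bottom_darts B)"
    define f where "f = opp ?M \<circ> rot ?M"
    have f_in: "f d \<in> ?D" if "d \<in> ?D" for d
      using r_in[OF that] flipD unfolding f_def comp_def opp r_def[symmetric] by simp
    have x: "?x \<in> ?D" using ends_D(2) bot by simp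
    have fn: "(f ^^ n) ?x \<in> ?D" for n by (induction n) (use x f_in in auto)
    \<comment> \<open>The map \<open>?h\<close> carries the face permutation \<open>f\<close> of the
      plane graph to that of the universe, so it maps the orbit defining the unbounded face onto a
      region.\<close>
    have step: "g (?h d) = ?h (f d)" if "d \<in> ?D" for d
      using gF[OF flipD[OF r_in[OF that]]] r_in[OF that] unfolding f_def comp_def opp r_def[symmetric] by simp
    have iter: "(g ^^ n) (?h ?x) = ?h ((f ^^ n) ?x)" for n
    proof (induction n)
      case (Suc n)
      then show ?case using step[OF fn[of n]] by simp
    qed simp
    have "outer ?U = ?h ` orbit f ?x" unfolding U outer f_def ..
    also have "\<dots> = orbit g (?h ?x)" unfolding orbit_altdef using iter by (auto simp: image_iff)
    also have "?h ?x = hd (bnd East ?t)" using W bot_s(2) bot by simp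
    also have "orbit g (hd (bnd East ?t)) = set (bnd West ?t @ bnd East ?t)"
      by (rule orbit_cyclic_list[OF outer_cyc]) simp
    finally show ?thesis by simp
  qed
  show "sp_universe ?t ?U"
  proof
    fix q x assume "q \<in> leaves ?t"
    then obtain e where "e \<in> leaves t" "q = edge_corner e" unfolding leaves_map by blast
    then show "rot ?U (q x) = q (nx x)" unfolding U by (cases x) auto
  next
    fix d :: "'a dart \<times> bool" assume "d \<notin> corners ?t"
    then show "rot ?U d = d \<and> opp ?U d = d" unfolding corners_corner_tree U by (cases d) auto
  qed (use wf_corner_tree[OF dis] U(1) cyclic outerU corners_corner_tree[of t] in auto)
  show "lower_segment B = {hd (bnd South ?t), hd (bnd East ?t)}"
    unfolding lower_segment_def using W black_boundaries[of t] bot by (simp add: hd_map)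
qed

section \<open>Labelings of series-parallel graphs\<close>

primrec sorted_sp :: "('a \<Rightarrow> 'a \<Rightarrow> bool) \<Rightarrow> 'a sp \<Rightarrow> bool" where
  "sorted_sp lt (Leaf q) \<longleftrightarrow> True"
| "sorted_sp lt (Node k f A B) \<longleftrightarrow>
     (\<forall>a\<in>leaves A. \<forall>b\<in>leaves B. if f then lt b a else lt a b) \<and> sorted_sp lt A \<and> sorted_sp lt B"

lemma sorted_sp_order_ok:
  "sorted_sp lt t \<Longrightarrow> (\<And>x y. x \<in> leaves t \<Longrightarrow> y \<in> leaves t \<Longrightarrow> lt x y \<Longrightarrow> l x < l y) \<Longrightarrow> order_ok l t"
proof (induction t)
  case (Node k f A B)
  then show ?case by (cases f) simp_all
qed simp

lemma sorted_sp_disjoint_leaves: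
  "sorted_sp lt t \<Longrightarrow> irreflp lt \<Longrightarrow> disjoint_leaves t"
proof (induction t)
  case (Node k f A B)
  then have "leaves A \<inter> leaves B = {}" by (auto split: if_splits dest: irreflpD)
  then show ?case using Node by simp
qed simp

lemma order_ok_map: "order_ok l (map_sp h t) = order_ok (\<lambda>x. l (h x)) t"
  by (induction t) (simp_all add: leaves_map)

lemma context_ok_map: "context_ok C (map_sp h t) = context_ok C t"
  by (induction t arbitrary: C) simp_all

lemma crossings_universe:
  assumes "eqv B (graph_of t)" "disjoint_leaves t"
  shows "crossings (universe B) = crossing_of_edge ` leaves t"
    and "inj_on crossing_of_edge (leaves t)"
proof -
  interpret sp_universe "corner_tree t" "universe B" by (rule sp_universe_universe(1)[OF assms])
  show "crossings (universe B) = crossing_of_edge ` leaves t"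
    unfolding crossings_eq leaves_map image_image range_edge_corner ..
  show "inj_on crossing_of_edge (leaves t)"
    by (rule inj_onI) (auto simp: crossing_of_edge_def set_eq_iff)
qed

lemma sorted_admissible:
  assumes "eqv B (graph_of t)" "sorted_sp lt t" "irreflp lt" "t = Node Par f A' B'"
    and "context_ok {(North, False)} t" "ordered_labeling (universe B) l"
    and mono: "\<And>x y. x \<in> leaves t \<Longrightarrow> y \<in> leaves t \<Longrightarrow> lt x y \<Longrightarrow>
      l (crossing_of_edge x) < l (crossing_of_edge y)"
  shows "admissible (universe B) (lower_segment B) l"
proof -
  note dis = sorted_sp_disjoint_leaves[OF assms(2,3)]
  have node: "corner_tree t = Node Par f (corner_tree A') (corner_tree B')" using assms(4) by simp
  have "order_ok (\<lambda>q. l (range q)) (corner_tree t)"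
    unfolding order_ok_map range_edge_corner by (rule sorted_sp_order_ok[OF assms(2) mono])
  moreover have "context_ok {(North, False)} (corner_tree t)" unfolding context_ok_map by (rule assms(5))
  ultimately show ?thesis
    using admissible_sp sp_universe_universe[OF assms(1) dis] assms(6) unfolding node by metis
qed

text \<open>Each edge is labeled by its rank. The explicit formula is recorded because the twist box
  of a Montesinos universe has prescribed label values and not only a prescribed order.\<close>

lemma sorted_labeling:
  assumes "eqv B (graph_of t)" "sorted_sp lt t" "irreflp lt" "transp lt" "totalp lt"
  shows "\<exists>l. ordered_labeling (universe B) l \<and>
    (\<forall>e\<in>leaves t. l (crossing_of_edge e) = Suc (card {x \<in> leaves t. lt x e})) \<and>
    (\<forall>x\<in>leaves t. \<forall>y\<in>leaves t. lt x y \<longrightarrow> l (crossing_of_edge x) < l (crossing_of_edge y))"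
proof -
  note dis = sorted_sp_disjoint_leaves[OF assms(2,3)]
  note cr = crossings_universe[OF assms(1) dis]
  let ?E = "leaves t"
  have irr: "\<not> lt x x" and trans: "lt x y \<Longrightarrow> lt y z \<Longrightarrow> lt x z" and total: "x = y \<or> lt x y \<or> lt y x" for x y z
    using assms(3-5) by (auto dest: irreflpD transpD totalpD)
  define r where "r e = Suc (card {x \<in> ?E. lt x e})" for e
  have mono: "r x < r y" if "x \<in> ?E" "lt x y" for x y
  proof -
    have "{z \<in> ?E. lt z x} \<subset> {z \<in> ?E. lt z y}" using that trans irr by blast
    then show ?thesis unfolding r_def by (simp add: psubset_card_mono)
  qed
  have inj: "inj_on r ?E"
    by (rule inj_onI) (metis mono total less_irrefl)
  have "r ` ?E \<subseteq> {1..card ?E}"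
  proof
    fix v assume "v \<in> r ` ?E"
    then obtain e where e: "e \<in> ?E" "v = r e" by blast
    then have "{x \<in> ?E. lt x e} \<subset> ?E" using irr e(1) by blast
    then have "card {x \<in> ?E. lt x e} < card ?E" by (intro psubset_card_mono) simp_all
    then show "v \<in> {1..card ?E}" unfolding e r_def by simp
  qed
  then have "r ` ?E = {1..card ?E}"
    by (intro card_subset_eq) (simp_all add: card_image[OF inj])
  then have bij: "bij_betw r ?E {1..card ?E}" using inj unfolding bij_betw_def by blast
  define l where "l c = r (the_inv_into ?E crossing_of_edge c)" for c
  have l: "l (crossing_of_edge e) = r e" if "e \<in> ?E" for e
    unfolding l_def using the_inv_into_f_f[OF cr(2) that] by simp
  have "card (crossings (universe B)) = card ?E" unfolding cr(1) by (rule card_image[OF cr(2)])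
  moreover have "bij_betw l (crossing_of_edge ` ?E) {1..card ?E}"
    unfolding l_def
    using bij_betw_trans[OF bij_betw_the_inv_into[OF inj_on_imp_bij_betw[OF cr(2)]] bij]
    unfolding comp_def .
  ultimately have "ordered_labeling (universe B) l" unfolding ordered_labeling_def cr(1) by simp
  then show ?thesis using l mono unfolding r_def by (intro exI[of _ l]) simp
qed

text \<open>A top vertex of degree one yields a black region with a single corner, that is, a curl.
  This excludes the degenerate parameters for which the tree has no parallel root.\<close>

lemma curl_sp:
  assumes "eqv B (graph_of t)" "disjoint_leaves t" "length (bnd North (corner_tree t)) = 1"
  shows "\<not> link_universe (universe B)"
proof -
  interpret sp_universe "corner_tree t" "universe B" by (rule sp_universe_universe(1)[OF assms(1,2)])
  have "set (bnd North (corner_tree t)) \<in> regions (universe B)"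
    unfolding regions_eq faces_def by simp
  moreover have "card (set (bnd North (corner_tree t))) = 1"
    using assms(3) by (cases "bnd North (corner_tree t)") auto
  ultimately show ?thesis unfolding link_universe_def has_curl_def by blast
qed


section \<open>Chains of edges\<close>

definition box :: "kind \<Rightarrow> 'e list \<Rightarrow> 'e two_terminal" where
  "box k es = (if k = Par then multi_edge_box es else path_box es)"

definition join :: "kind \<Rightarrow> 'e two_terminal \<Rightarrow> 'e two_terminal \<Rightarrow> 'e two_terminal" where
  "join k A B = (if k = Par then parallel [A, B] else series A B)"

text \<open>Bracketing to the right serves the two-bridge boxes and the first pretzel path,
  bracketing to the left (\<open>lchain\<close>) the tangles and the remaining pretzel paths. By
  associativity the same plane graph results, up to \<open>eqv\<close>, but the contexts at the
  leaves depend on the bracketing.\<close>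

definition rchain :: "kind \<Rightarrow> bool \<Rightarrow> 'a list \<Rightarrow> 'a sp \<Rightarrow> 'a sp" where
  "rchain k f es t = foldr (\<lambda>e. Node k f (Leaf e)) es t"

definition rpath :: "kind \<Rightarrow> bool \<Rightarrow> 'a list \<Rightarrow> 'a sp" where
  "rpath k f es = rchain k f (butlast es) (Leaf (last es))"

definition lchain :: "kind \<Rightarrow> 'a sp \<Rightarrow> 'a list \<Rightarrow> 'a sp" where
  "lchain k t es = foldl (\<lambda>s e. Node k False s (Leaf e)) t es"

definition lpath :: "kind \<Rightarrow> 'a list \<Rightarrow> 'a sp" where
  "lpath k es = lchain k (Leaf (hd es)) (tl es)"

fun par_tree :: "'a sp list \<Rightarrow> 'a sp" where
  "par_tree [t] = t"
| "par_tree (t # u # ts) = Node Par False t (par_tree (u # ts))"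

lemma eqv_sym: "eqv A B \<Longrightarrow> eqv B A"
  unfolding eqv_def by simp

lemma eqv_join: "eqv A A' \<Longrightarrow> eqv B B' \<Longrightarrow> eqv (join k A B) (join k A' B')"
  unfolding join_def by (simp add: eqv_series eqv_parallel)

lemma eqv_join_assoc: "eqv (join k (join k A B) C) (join k A (join k B C))"
  unfolding join_def using eqv_series_assoc parallel_assoc by (auto simp: parallel_assoc)

lemma box_single: "box k [e] = path_box [e]"
  unfolding box_def by (simp add: multi_edge_box_single)

lemma eqv_box_Cons: "es \<noteq> [] \<Longrightarrow> eqv (box k (e # es)) (join k (path_box [e]) (box k es))"
  unfolding box_def join_def using eqv_path_box_Cons by (auto simp: multi_edge_box_Cons)

lemma graph_of_Node: "graph_of (Node k f A B) = join k (graph_of A) (graph_of B)"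
  unfolding join_def by simp

lemma graph_of_rchain:
  assumes "es \<noteq> []" "eqv B (graph_of t)"
  shows "eqv (join k (box k es) B) (graph_of (rchain k f es t))"
  using assms
proof (induction es rule: list_nonempty_induct)
  case (single e)
  then show ?case unfolding rchain_def box_single by (simp add: graph_of_Node eqv_join del: graph_of.simps(2))
next
  case (cons e es)
  have "eqv (join k (box k (e # es)) B) (join k (join k (path_box [e]) (box k es)) B)"
    by (intro eqv_join eqv_box_Cons cons.hyps eqv_refl)
  moreover have "eqv \<dots> (join k (path_box [e]) (join k (box k es) B))" by (rule eqv_join_assoc)
  moreover have "eqv \<dots> (graph_of (rchain k f (e # es) t))"
    using cons.IH[OF cons.prems] eqv_join[OF eqv_refl]
    unfolding rchain_def by (simp add: graph_of_Node del: graph_of.simps(2))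
  ultimately show ?case using eqv_trans by blast
qed

lemma graph_of_rpath:
  assumes "es \<noteq> []"
  shows "eqv (box k es) (graph_of (rpath k f es))"
  using assms
proof (induction es rule: list_nonempty_induct)
  case (single e)
  then show ?case unfolding rpath_def rchain_def by (simp add: box_single)
next
  case (cons e es)
  have "rpath k f (e # es) = Node k f (Leaf e) (rpath k f es)"
    using cons.hyps unfolding rpath_def rchain_def by simp
  then have "graph_of (rpath k f (e # es)) = join k (path_box [e]) (graph_of (rpath k f es))"
    by (simp add: graph_of_Node del: graph_of.simps(2))
  then show ?case using eqv_trans[OF eqv_box_Cons[OF cons.hyps] eqv_join[OF eqv_refl cons.IH]] by simp
qed

lemma graph_of_lchain:
  assumes "es \<noteq> []" "eqv B (graph_of t)"
  shows "eqv (join k B (box k es)) (graph_of (lchain k t es))"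
  using assms
proof (induction es arbitrary: B t rule: list_nonempty_induct)
  case (single e)
  then show ?case unfolding lchain_def box_single by (simp add: graph_of_Node eqv_join del: graph_of.simps(2))
next
  case (cons e es)
  have "eqv (join k B (box k (e # es))) (join k B (join k (path_box [e]) (box k es)))"
    by (intro eqv_join eqv_box_Cons cons.hyps eqv_refl)
  moreover have "eqv \<dots> (join k (join k B (path_box [e])) (box k es))" by (rule eqv_sym[OF eqv_join_assoc])
  moreover have "eqv \<dots> (graph_of (lchain k (Node k False t (Leaf e)) es))"
    by (intro cons.IH) (simp add: graph_of_Node eqv_join cons.prems del: graph_of.simps(2))
  moreover have "lchain k (Node k False t (Leaf e)) es = lchain k t (e # es)" unfolding lchain_def by simp
  ultimately show ?case using eqv_trans by metis
qed

lemma graph_of_lpath: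
  assumes "es \<noteq> []"
  shows "eqv (box k es) (graph_of (lpath k es))"
proof -
  obtain e es' where es: "es = e # es'" using assms by (cases es) auto
  show ?thesis
  proof (cases "es' = []")
    case True
    then show ?thesis unfolding es lpath_def lchain_def by (simp add: box_single)
  next
    case False
    then have "eqv (join k (path_box [e]) (box k es')) (graph_of (lpath k es))"
      using graph_of_lchain[OF False, of "path_box [e]" "Leaf e" k] unfolding es lpath_def by simp
    then show ?thesis using eqv_trans[OF eqv_box_Cons[OF False]] unfolding es by blast
  qed
qed

lemma graph_of_par_tree:
  assumes "list_all2 (\<lambda>B t. eqv B (graph_of t)) Bs ts" "ts \<noteq> []"
  shows "eqv (parallel Bs) (graph_of (par_tree ts))"
  using assms
proof (induction ts arbitrary: Bs rule: par_tree.induct)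
  case (1 t)
  then show ?case by (auto simp: list_all2_Cons2 parallel_single)
next
  case (2 t u ts)
  then obtain B Cs where B: "Bs = B # Cs" "eqv B (graph_of t)"
    "list_all2 (\<lambda>B t. eqv B (graph_of t)) Cs (u # ts)" by (auto simp: list_all2_Cons2)
  have "eqv (parallel [B, parallel Cs]) (parallel [graph_of t, graph_of (par_tree (u # ts))])"
    using B 2 by (intro eqv_parallel) simp_all
  then show ?case unfolding B(1) parallel_Cons[of B Cs] by simp
qed simp

lemma leaves_chains [simp]:
  "leaves (rchain k f es t) = set es \<union> leaves t"
  "leaves (lchain k t es) = leaves t \<union> set es"
  "es \<noteq> [] \<Longrightarrow> leaves (rpath k f es) = set es"
  "es \<noteq> [] \<Longrightarrow> leaves (lpath k es) = set es"
proof -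
  show r: "leaves (rchain k f es t) = set es \<union> leaves t" for es t
    unfolding rchain_def by (induction es) auto
  show l: "leaves (lchain k t es) = leaves t \<union> set es" for es t
    unfolding lchain_def by (induction es arbitrary: t) auto
  assume "es \<noteq> []"
  then have "set es = insert (last es) (set (butlast es))"
    by (metis append_butlast_last_id list.simps(15) rotate1.simps(2) set_rotate1)
  then show "leaves (rpath k f es) = set es" unfolding rpath_def r by simp
  show "leaves (lpath k es) = set es" using \<open>es \<noteq> []\<close> unfolding lpath_def l by (cases es) auto
qed

lemma leaves_par_tree: "ts \<noteq> [] \<Longrightarrow> leaves (par_tree ts) = (\<Union>t\<in>set ts. leaves t)"
  by (induction ts rule: par_tree.induct) auto

lemma sorted_sp_rchain:
  "sorted_sp lt (rchain k f es t) \<longleftrightarrow>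
     sorted_wrt (\<lambda>x y. if f then lt y x else lt x y) es \<and>
     (\<forall>e\<in>set es. \<forall>x\<in>leaves t. if f then lt x e else lt e x) \<and> sorted_sp lt t"
proof (induction es)
  case Nil
  then show ?case unfolding rchain_def by simp
next
  case (Cons e es)
  have "rchain k f (e # es) t = Node k f (Leaf e) (rchain k f es t)" unfolding rchain_def by simp
  then show ?case using Cons by (cases f) auto
qed

lemma sorted_sp_rpath:
  assumes "es \<noteq> []" "sorted_wrt (\<lambda>x y. if f then lt y x else lt x y) es"
  shows "sorted_sp lt (rpath k f es)"
proof -
  have "sorted_wrt (\<lambda>x y. if f then lt y x else lt x y) (butlast es @ [last es])" using assms by simp
  then show ?thesis unfolding rpath_def sorted_sp_rchain sorted_wrt_append by simp
qed

lemma sorted_sp_lchain: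
  "sorted_sp lt (lchain k t es) \<longleftrightarrow>
     sorted_sp lt t \<and> (\<forall>x\<in>leaves t. \<forall>e\<in>set es. lt x e) \<and> sorted_wrt lt es"
proof (induction es arbitrary: t)
  case Nil
  then show ?case unfolding lchain_def by simp
next
  case (Cons e es)
  have "lchain k t (e # es) = lchain k (Node k False t (Leaf e)) es" unfolding lchain_def by simp
  then show ?case using Cons[of "Node k False t (Leaf e)"] by auto
qed

lemma sorted_sp_lpath: "es \<noteq> [] \<Longrightarrow> sorted_wrt lt es \<Longrightarrow> sorted_sp lt (lpath k es)"
  unfolding lpath_def sorted_sp_lchain by (cases es) auto

lemma sorted_sp_par_tree:
  assumes "ts \<noteq> []" "\<And>t. t \<in> set ts \<Longrightarrow> sorted_sp lt t"
    "sorted_wrt (\<lambda>A B. \<forall>a\<in>leaves A. \<forall>b\<in>leaves B. lt a b) ts"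
  shows "sorted_sp lt (par_tree ts)"
  using assms
proof (induction ts rule: par_tree.induct)
  case (2 t u ts)
  then have "sorted_sp lt (par_tree (u # ts))" by simp
  then show ?case using 2 leaves_par_tree[of "u # ts"] by auto
qed auto


section \<open>Contexts\<close>

text \<open>Allows a context to be replaced by a larger one from a short list closed under
  descending the tree.\<close>

lemma context_ok_mono: "C \<subseteq> C' \<Longrightarrow> context_ok C' t \<Longrightarrow> context_ok C t"
proof (induction t arbitrary: C C')
  case (Node k f A B)
  have "part_context k g lo C \<subseteq> part_context k g lo C'" for g lo
    using Node.prems(1) unfolding part_context_def by blast
  then show ?case using Node.IH Node.prems(2) by (metis context_ok.simps(2))
qed auto

text \<open>The contexts of the last part and of the other parts of a parallel connection of edges and
  tangles, and the context of its first part.\<close>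

definition last_context :: "(side \<times> bool) set" where
  "last_context = {(North, True), (West, True)}"

definition middle_context :: "(side \<times> bool) set" where
  "middle_context = {(North, True), (West, True), (South, False), (East, False)}"

definition first_context :: "(side \<times> bool) set" where
  "first_context = {(North, False), (East, False)}"

lemma context_ok_Leaf:
  "context_ok last_context (Leaf e)" "context_ok middle_context (Leaf e)" "context_ok first_context (Leaf e)"
  unfolding last_context_def middle_context_def first_context_def by auto

lemma middle_last: "context_ok middle_context t \<Longrightarrow> context_ok last_context t"
  by (rule context_ok_mono) (auto simp: last_context_def middle_context_def)

text \<open>The origin of \<open>first_context\<close> and \<open>last_context\<close>: they are
  what \<open>part_context\<close> gives for the two children of a parallel root with increasing
  labels.\<close>

lemma context_ok_top:
  assumes "context_ok first_context A" "context_ok last_context B"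
  shows "context_ok {(North, False)} (Node Par False A B)"
proof -
  have "part_context Par East False {(North, False)} \<subseteq> first_context"
    "part_context Par West True {(North, False)} \<subseteq> last_context"
    unfolding part_context_def first_context_def last_context_def by auto
  then show ?thesis using assms by (auto intro: context_ok_mono)
qed

lemma context_ok_last:
  assumes "context_ok middle_context A" "context_ok last_context B"
  shows "context_ok last_context (Node k False A B)"
proof -
  have "part_context k (out k) False last_context \<subseteq> middle_context"
    "part_context k (inn k) True last_context \<subseteq> last_context"
    unfolding part_context_def middle_context_def last_context_def by (cases k; auto)+
  then show ?thesis using assms by (auto intro: context_ok_mono)
qed

text \<open>Descending to the left reproduces \<open>middle_context\<close>. The context on the
  right is still functional but lies outside the list, so the right part is taken to be a single
  edge; this fits tangles, which grow by one edge at a time.\<close>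

lemma context_ok_middle:
  assumes "context_ok middle_context A"
  shows "context_ok middle_context (Node k False A (Leaf e))"
proof -
  have "part_context k (out k) False middle_context \<subseteq> middle_context"
    unfolding part_context_def middle_context_def by (cases k; auto)
  moreover have "context_ok (part_context k (inn k) True middle_context) (Leaf e)"
    unfolding part_context_def middle_context_def by (cases k; auto)
  ultimately show ?thesis using assms by (auto intro: context_ok_mono)
qed

text \<open>This is where the reversed order in the first pretzel path comes from. With labels
  increasing downwards, the lower part would get both \<open>(North, False)\<close> and
  \<open>(North, True)\<close>; with the lower labels at the bottom the bits agree.\<close>

lemma context_ok_first:
  assumes "context_ok first_context B"
  shows "context_ok first_context (Node Ser True (Leaf e) B)"
proof -
  have "part_context Ser North False first_context \<subseteq> first_context"
    unfolding part_context_def first_context_def by auto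
  moreover have "context_ok (part_context Ser South True first_context) (Leaf e)"
    unfolding part_context_def first_context_def by auto
  ultimately show ?thesis using assms by (auto intro: context_ok_mono)
qed

lemma context_ok_rchain:
  "context_ok last_context t \<Longrightarrow> context_ok last_context (rchain k False es t)"
  unfolding rchain_def by (induction es) (simp_all add: context_ok_last context_ok_Leaf del: context_ok.simps)

lemma context_ok_rpath: "context_ok last_context (rpath k False es)"
  unfolding rpath_def by (intro context_ok_rchain context_ok_Leaf)

lemma context_ok_rpath_first: "context_ok first_context (rpath Ser True es)"
proof -
  have "context_ok first_context (rchain Ser True es (Leaf e))" for es :: "'a list" and e
    unfolding rchain_def by (induction es) (simp_all add: context_ok_first context_ok_Leaf del: context_ok.simps)
  then show ?thesis unfolding rpath_def by blast
qed

lemma context_ok_lchain: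
  "context_ok middle_context t \<Longrightarrow> context_ok middle_context (lchain k t es)"
  unfolding lchain_def by (induction es arbitrary: t) (simp_all add: context_ok_middle del: context_ok.simps)

lemma context_ok_lpath: "context_ok middle_context (lpath k es)"
  unfolding lpath_def by (intro context_ok_lchain context_ok_Leaf)

lemma context_ok_par_tree_last:
  assumes "ts \<noteq> []" "\<And>t. t \<in> set ts \<Longrightarrow> context_ok middle_context t"
  shows "context_ok last_context (par_tree ts)"
  using assms
proof (induction ts rule: par_tree.induct)
  case (2 t u ts)
  then show ?case by (simp add: context_ok_last del: context_ok.simps)
qed (simp_all add: middle_last)

lemma context_ok_par_tree:
  assumes "ts \<noteq> []" "context_ok first_context t" "\<And>t. t \<in> set ts \<Longrightarrow> context_ok middle_context t"
  shows "context_ok {(North, False)} (par_tree (t # ts))"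
proof -
  obtain u us where "ts = u # us" using assms(1) by (cases ts) auto
  then show ?thesis using context_ok_top[OF assms(2) context_ok_par_tree_last[OF assms(1,3)]] by simp
qed

lemma par_tree_Node: "ts \<noteq> [] \<Longrightarrow> par_tree (t # ts) = Node Par False t (par_tree ts)"
  by (cases ts) auto

section \<open>Two-bridge universes\<close>

abbreviation box_kind :: "nat \<Rightarrow> kind" where
  "box_kind i \<equiv> if even i then Par else Ser"

fun two_bridge_tree :: "nat \<Rightarrow> nat list \<Rightarrow> (nat \<times> nat) sp" where
  "two_bridge_tree i [a] = rpath (box_kind i) False (box_edges i a)"
| "two_bridge_tree i (a # b # as) =
     rchain (box_kind i) False (box_edges i a) (two_bridge_tree (Suc i) (b # as))"

definition lex2 :: "nat \<times> nat \<Rightarrow> nat \<times> nat \<Rightarrow> bool" where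
  "lex2 x y \<longleftrightarrow> fst x < fst y \<or> fst x = fst y \<and> snd x < snd y"

lemma set_box_edges: "set (box_edges i a) = {i} \<times> {..<a}"
  unfolding box_edges_def by auto

lemma box_edges_nonempty [simp]: "box_edges i a \<noteq> [] \<longleftrightarrow> 0 < a"
  unfolding box_edges_def by simp

lemma box_edges_eq_Nil [simp]: "box_edges i a = [] \<longleftrightarrow> a = 0"
  unfolding box_edges_def by simp

lemma sorted_box_edges: "sorted_wrt lex2 (box_edges i a)"
  unfolding box_edges_def lex2_def sorted_wrt_map by (simp add: sorted_wrt_upt)

lemma graph_of_two_bridge_tree:
  "as \<noteq> [] \<Longrightarrow> \<forall>a\<in>set as. 0 < a \<Longrightarrow> eqv (two_bridge_from i as) (graph_of (two_bridge_tree i as))"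
proof (induction i as rule: two_bridge_tree.induct)
  case (1 i a)
  then show ?case
    using graph_of_rpath[of "box_edges i a" "box_kind i" False] by (auto simp: box_def)
next
  case (2 i a b as)
  then have "eqv (join (box_kind i) (box (box_kind i) (box_edges i a)) (two_bridge_from (Suc i) (b # as)))
      (graph_of (two_bridge_tree i (a # b # as)))"
    unfolding two_bridge_tree.simps by (intro graph_of_rchain) simp_all
  then show ?case by (auto simp: box_def join_def)
qed simp

lemma leaves_two_bridge_tree:
  "as \<noteq> [] \<Longrightarrow> \<forall>a\<in>set as. 0 < a \<Longrightarrow>
     leaves (two_bridge_tree i as) = {(i + m, j) |m j. m < length as \<and> j < as ! m}"
proof (induction i as rule: two_bridge_tree.induct)
  case (1 i a)
  then show ?case by (auto simp: set_box_edges)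
next
  case (2 i a b as)
  have "{(i + m, j) |m j. m < length (a # b # as) \<and> j < (a # b # as) ! m} =
      {i} \<times> {..<a} \<union> {(Suc i + m, j) |m j. m < length (b # as) \<and> j < (b # as) ! m}" (is "?L = ?R")
  proof
    show "?L \<subseteq> ?R"
    proof
      fix x assume "x \<in> ?L"
      then obtain m j where "x = (i + m, j)" "m < length (a # b # as)" "j < (a # b # as) ! m" by auto
      then show "x \<in> ?R" by (cases m) auto
    qed
    show "?R \<subseteq> ?L"
    proof
      fix x assume "x \<in> ?R"
      then consider j where "x = (i, j)" "j < a"
        | m j where "x = (Suc i + m, j)" "m < length (b # as)" "j < (b # as) ! m" by auto
      then show "x \<in> ?L"
      proof cases
        case 1
        then show ?thesis by (auto intro!: exI[of _ 0])
      next
        case 2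
        then show ?thesis by (auto intro!: exI[of _ "Suc m"])
      qed
    qed
  qed
  then show ?case using 2 by (simp add: set_box_edges)
qed simp

lemma sorted_two_bridge_tree:
  "as \<noteq> [] \<Longrightarrow> \<forall>a\<in>set as. 0 < a \<Longrightarrow> sorted_sp lex2 (two_bridge_tree i as)"
proof (induction i as rule: two_bridge_tree.induct)
  case (1 i a)
  then show ?case by (auto intro!: sorted_sp_rpath sorted_box_edges)
next
  case (2 i a b as)
  then have "lex2 e x" if "e \<in> set (box_edges i a)" "x \<in> leaves (two_bridge_tree (Suc i) (b # as))" for e x
    using that leaves_two_bridge_tree[of "b # as" "Suc i"] by (auto simp: set_box_edges lex2_def)
  then show ?case using 2 by (simp add: sorted_sp_rchain sorted_box_edges)
qed simp

lemma context_ok_two_bridge_tree: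
  "as \<noteq> [] \<Longrightarrow> context_ok last_context (two_bridge_tree i as)"
proof (induction i as rule: two_bridge_tree.induct)
  case (1 i a)
  show ?case unfolding two_bridge_tree.simps by (rule context_ok_rpath)
next
  case (2 i a b as)
  then show ?case unfolding two_bridge_tree.simps by (intro context_ok_rchain) simp
qed simp

lemma rchain_Cons: "rchain k f (e # es) t = Node k f (Leaf e) (rchain k f es t)"
  unfolding rchain_def by simp

lemma rpath_Cons: "es \<noteq> [] \<Longrightarrow> rpath k f (e # es) = Node k f (Leaf e) (rpath k f es)"
  unfolding rpath_def by (simp add: rchain_Cons)

text \<open>The very first edge is split off as the left child of the root, so that
  \<open>first_context\<close> only has to be checked at a leaf. The parameter list
  \<open>[1]\<close> gives a single leaf and no root node.\<close>

lemma two_bridge_root: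
  assumes "as \<noteq> []" "\<forall>a\<in>set as. 0 < a" "as \<noteq> [1]"
  shows "\<exists>e t. two_bridge_tree 0 as = Node Par False (Leaf e) t \<and> context_ok last_context t"
proof -
  obtain a bs where as: "as = a # bs" using assms(1) by (cases as) auto
  define es where "es = map (Pair (0 :: nat)) [1..<a]"
  have es: "box_edges 0 a = (0, 0) # es"
    using assms(2) upt_conv_Cons[of 0 a] unfolding as box_edges_def es_def by simp
  show ?thesis
  proof (cases bs)
    case Nil
    then have "es \<noteq> []" using assms(2,3) unfolding as es_def by auto
    then show ?thesis unfolding as Nil using es by (simp add: rpath_Cons context_ok_rpath)
  next
    case (Cons b cs)
    then show ?thesis unfolding as Cons using es
      by (simp add: rchain_Cons context_ok_rchain context_ok_two_bridge_tree)
  qed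
qed

lemma lex2_order: "irreflp lex2" "transp lex2" "totalp lex2"
  by (auto intro!: irreflpI transpI totalpI simp: lex2_def prod_eq_iff)

lemma two_bridge_labeling_iff:
  assumes "as \<noteq> []" "\<forall>a\<in>set as. 0 < a"
  shows "two_bridge_labeling as l \<longleftrightarrow> ordered_labeling (universe (two_bridge as)) l \<and>
    (\<forall>x\<in>leaves (two_bridge_tree 0 as). \<forall>y\<in>leaves (two_bridge_tree 0 as).
       lex2 x y \<longrightarrow> l (crossing_of_edge x) < l (crossing_of_edge y))"
  unfolding two_bridge_labeling_def leaves_two_bridge_tree[OF assms] lex2_def
  by (intro conj_cong refl) (auto; metis less_trans)

lemma two_bridge_case:
  assumes "as \<noteq> []" "\<forall>a\<in>set as. 0 < a" "link_universe (universe (two_bridge as))"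
  shows "(\<exists>l. two_bridge_labeling as l \<and>
      admissible (universe (two_bridge as)) (lower_segment (two_bridge as)) l) \<and>
    (\<forall>l. two_bridge_labeling as l \<longrightarrow>
      admissible (universe (two_bridge as)) (lower_segment (two_bridge as)) l)"
proof -
  let ?t = "two_bridge_tree 0 as"
  have e: "eqv (two_bridge as) (graph_of ?t)"
    unfolding two_bridge_def by (rule graph_of_two_bridge_tree[OF assms(1,2)])
  note s = sorted_two_bridge_tree[OF assms(1,2), of 0]
  have "as \<noteq> [1]"
  proof
    assume "as = [1]"
    then have "length (bnd North (corner_tree ?t)) = 1" by (simp add: box_edges_def rpath_def rchain_def)
    then show False using curl_sp[OF e sorted_sp_disjoint_leaves[OF s lex2_order(1)]] assms(3) by blast
  qed
  then obtain e0 t0 where root: "?t = Node Par False (Leaf e0) t0" "context_ok last_context t0"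
    using two_bridge_root assms(1,2) by blast
  have ctx: "context_ok {(North, False)} ?t"
    unfolding root(1) by (rule context_ok_top[OF context_ok_Leaf(3) root(2)])
  show ?thesis
    unfolding two_bridge_labeling_iff[OF assms(1,2)]
    using sorted_labeling[OF e s lex2_order] sorted_admissible[OF e s lex2_order(1) root(1) ctx] by blast
qed


section \<open>Pretzel universes\<close>

definition pretzel_path :: "nat list \<Rightarrow> nat \<Rightarrow> (nat \<times> nat) sp" where
  "pretzel_path bs i =
     (if i = 0 then rpath Ser True (box_edges 0 (bs ! 0)) else lpath Ser (box_edges i (bs ! i)))"

definition pretzel_tree :: "nat list \<Rightarrow> (nat \<times> nat) sp" where
  "pretzel_tree bs = par_tree (map (pretzel_path bs) [0..<length bs])"

text \<open>Edges of a path are numbered from top to bottom, so labels increasing from bottom to top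
  in box 0 mean a reversed comparison there.\<close>

definition pretzel_less :: "nat \<times> nat \<Rightarrow> nat \<times> nat \<Rightarrow> bool" where
  "pretzel_less x y \<longleftrightarrow> fst x < fst y \<or>
     fst x = fst y \<and> (if fst x = 0 then snd y < snd x else snd x < snd y)"

lemma pretzel_less_order: "irreflp pretzel_less" "transp pretzel_less" "totalp pretzel_less"
  by (auto intro!: irreflpI transpI totalpI simp: pretzel_less_def prod_eq_iff split: if_splits)

context
  fixes bs :: "nat list"
  assumes bs: "bs \<noteq> []" "\<forall>b\<in>set bs. 0 < b"
begin

lemma pretzel_pos: "i < length bs \<Longrightarrow> 0 < bs ! i"
  using bs(2) by simp

lemma leaves_pretzel_path: "i < length bs \<Longrightarrow> leaves (pretzel_path bs i) = {i} \<times> {..<bs ! i}"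
  using pretzel_pos[of i] unfolding pretzel_path_def by (cases "i = 0") (simp_all add: set_box_edges)

lemma leaves_pretzel_tree: "leaves (pretzel_tree bs) = {(i, j) |i j. i < length bs \<and> j < bs ! i}"
  unfolding pretzel_tree_def using bs(1) by (auto simp: leaves_par_tree leaves_pretzel_path)

lemma graph_of_pretzel_tree: "eqv (pretzel bs) (graph_of (pretzel_tree bs))"
proof -
  have "eqv (path_box (box_edges i (bs ! i))) (graph_of (pretzel_path bs i))" if "i < length bs" for i
    using graph_of_rpath[of "box_edges 0 (bs ! 0)" Ser True] graph_of_lpath[of "box_edges i (bs ! i)" Ser]
      pretzel_pos[OF that]
    unfolding pretzel_path_def box_def by auto
  then show ?thesis
    unfolding pretzel_def pretzel_tree_def using bs(1)
    by (intro graph_of_par_tree) (auto simp: list_all2_conv_all_nth)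
qed

lemma sorted_pretzel_tree: "sorted_sp pretzel_less (pretzel_tree bs)"
  unfolding pretzel_tree_def
proof (rule sorted_sp_par_tree)
  fix t assume "t \<in> set (map (pretzel_path bs) [0..<length bs])"
  then obtain i where i: "i < length bs" "t = pretzel_path bs i" by auto
  have "sorted_wrt (\<lambda>x y. if True then pretzel_less y x else pretzel_less x y) (box_edges 0 a)" for a
    unfolding box_edges_def sorted_wrt_map pretzel_less_def by (simp add: sorted_wrt_upt)
  moreover have "sorted_wrt pretzel_less (box_edges i a)" if "i \<noteq> 0" for a
    unfolding box_edges_def sorted_wrt_map pretzel_less_def using that by (simp add: sorted_wrt_upt)
  ultimately show "sorted_sp pretzel_less t"
    unfolding i(2) pretzel_path_def using pretzel_pos[OF i(1)]
    by (auto intro!: sorted_sp_rpath sorted_sp_lpath)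
next
  have "sorted_wrt (\<lambda>i j. \<forall>a\<in>leaves (pretzel_path bs i). \<forall>b\<in>leaves (pretzel_path bs j). pretzel_less a b)
      [0..<length bs]"
    by (rule sorted_wrt_mono_rel[OF _ sorted_wrt_upt]) (auto simp: leaves_pretzel_path pretzel_less_def)
  then show "sorted_wrt (\<lambda>A B. \<forall>a\<in>leaves A. \<forall>b\<in>leaves B. pretzel_less a b)
      (map (pretzel_path bs) [0..<length bs])"
    unfolding sorted_wrt_map .
qed (use bs(1) in simp)

lemma pretzel_labeling_iff:
  "pretzel_labeling bs l \<longleftrightarrow> ordered_labeling (universe (pretzel bs)) l \<and>
    (\<forall>x\<in>leaves (pretzel_tree bs). \<forall>y\<in>leaves (pretzel_tree bs).
       pretzel_less x y \<longrightarrow> l (crossing_of_edge x) < l (crossing_of_edge y))"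
proof (intro iffI conjI ballI impI)
  assume l: "pretzel_labeling bs l"
  then show "ordered_labeling (universe (pretzel bs)) l" unfolding pretzel_labeling_def by blast
  fix x y assume x: "x \<in> leaves (pretzel_tree bs)" and y: "y \<in> leaves (pretzel_tree bs)" and xy: "pretzel_less x y"
  obtain i j where ij: "x = (i, j)" "i < length bs" "j < bs ! i" using x unfolding leaves_pretzel_tree by auto
  obtain i' j' where ij': "y = (i', j')" "i' < length bs" "j' < bs ! i'" using y unfolding leaves_pretzel_tree by auto
  from xy consider "i < i'" | "i = i'" "i = 0" "j' < j" | "i = i'" "0 < i" "j < j'"
    unfolding ij ij' pretzel_less_def by (auto split: if_splits)
  then show "l (crossing_of_edge x) < l (crossing_of_edge y)"
    using l ij ij' unfolding pretzel_labeling_def by cases simp_all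
next
  assume l: "ordered_labeling (universe (pretzel bs)) l \<and>
    (\<forall>x\<in>leaves (pretzel_tree bs). \<forall>y\<in>leaves (pretzel_tree bs).
       pretzel_less x y \<longrightarrow> l (crossing_of_edge x) < l (crossing_of_edge y))"
  have "l (crossing_of_edge (i, j)) < l (crossing_of_edge (i', j'))"
    if "pretzel_less (i, j) (i', j')" "i < length bs" "j < bs ! i" "i' < length bs" "j' < bs ! i'" for i j i' j'
    using l that unfolding leaves_pretzel_tree by blast
  then show "pretzel_labeling bs l"
    using l bs(1) unfolding pretzel_labeling_def pretzel_less_def by simp
qed

lemma pretzel_case:
  assumes "link_universe (universe (pretzel bs))"
  shows "(\<exists>l. pretzel_labeling bs l \<and>
      admissible (universe (pretzel bs)) (lower_segment (pretzel bs)) l) \<and>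
    (\<forall>l. pretzel_labeling bs l \<longrightarrow> admissible (universe (pretzel bs)) (lower_segment (pretzel bs)) l)"
proof -
  let ?t = "pretzel_tree bs"
  note e = graph_of_pretzel_tree and s = sorted_pretzel_tree
  have split: "[0..<length bs] = 0 # [1..<length bs]"
    using bs(1) by (simp add: upt_conv_Cons)
  have "length bs \<noteq> 1"
  proof
    assume "length bs = 1"
    then have t: "?t = rpath Ser True (box_edges 0 (bs ! 0))"
      unfolding pretzel_tree_def pretzel_path_def by simp
    \<comment> \<open>A series node takes its \<open>North\<close> boundary from its upper part
      alone, here a single edge.\<close>
    have "length (bnd North (corner_tree (rpath Ser True es))) = 1" for es :: "(nat \<times> nat) list"
      unfolding rpath_def rchain_def by (cases "butlast es") simp_all
    then show False
      using curl_sp[OF e sorted_sp_disjoint_leaves[OF s pretzel_less_order(1)]] assms unfolding t by blast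
  qed
  then have ne: "map (pretzel_path bs) [1..<length bs] \<noteq> []"
    using bs(1) by (cases bs) (auto simp: Suc_le_eq)
  have root: "?t = Node Par False (pretzel_path bs 0) (par_tree (map (pretzel_path bs) [1..<length bs]))"
    unfolding pretzel_tree_def split list.map par_tree_Node[OF ne] ..
  have ctx: "context_ok {(North, False)} ?t"
    unfolding root
  proof (rule context_ok_top[OF _ context_ok_par_tree_last[OF ne]])
    show "context_ok first_context (pretzel_path bs 0)"
      unfolding pretzel_path_def by (simp add: context_ok_rpath_first)
    show "context_ok middle_context t" if "t \<in> set (map (pretzel_path bs) [1..<length bs])" for t
      using that unfolding pretzel_path_def by (auto simp: context_ok_lpath)
  qed
  show ?thesis
    unfolding pretzel_labeling_iff
    using sorted_labeling[OF e s pretzel_less_order] sorted_admissible[OF e s pretzel_less_order(1) root ctx]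
    by blast
qed

end


section \<open>Montesinos universes\<close>

definition tangle_kind :: "nat list \<Rightarrow> nat \<Rightarrow> kind" where
  "tangle_kind cs i = (if even (length cs - Suc i) then Ser else Par)"

definition tangle_edges :: "nat \<Rightarrow> nat list \<Rightarrow> nat \<Rightarrow> (nat \<times> nat \<times> nat) list" where
  "tangle_edges t cs i = map (Pair t) (box_edges i (cs ! i))"

primrec tangle_tree :: "nat \<Rightarrow> nat list \<Rightarrow> nat \<Rightarrow> (nat \<times> nat \<times> nat) sp" where
  "tangle_tree t cs 0 = lpath (tangle_kind cs 0) (tangle_edges t cs 0)"
| "tangle_tree t cs (Suc i) =
     lchain (tangle_kind cs (Suc i)) (tangle_tree t cs i) (tangle_edges t cs (Suc i))"

text \<open>The edges of the twist box are separate members of the parallel composition, so the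
  first part is a single leaf, and every other part, edge or tangle, is tested against
  \<open>middle_context\<close>.\<close>

definition montesinos_tree :: "nat \<Rightarrow> nat list list \<Rightarrow> (nat \<times> nat \<times> nat) sp" where
  "montesinos_tree k css = par_tree (map Leaf (map (Pair 0) (box_edges 0 k)) @
     map (\<lambda>t. tangle_tree (Suc t) (css ! t) (length (css ! t) - 1)) [0..<length css])"

definition lex3 :: "nat \<times> nat \<times> nat \<Rightarrow> nat \<times> nat \<times> nat \<Rightarrow> bool" where
  "lex3 x y \<longleftrightarrow> fst x < fst y \<or> fst x = fst y \<and> lex2 (snd x) (snd y)"

lemma lex3_order: "irreflp lex3" "transp lex3" "totalp lex3"
  by (auto intro!: irreflpI transpI totalpI simp: lex3_def lex2_def prod_eq_iff)

lemma context_ok_tangle_tree: "context_ok middle_context (tangle_tree t cs i)"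
  by (induction i) (simp_all add: context_ok_lpath context_ok_lchain)

lemma sorted_Pair_box_edges: "sorted_wrt lex3 (map (Pair t) (box_edges i a))"
  unfolding sorted_wrt_map lex3_def
  by (rule sorted_wrt_mono_rel[OF _ sorted_box_edges]) simp

context
  fixes cs :: "nat list" and t :: nat
  assumes cs: "\<forall>c\<in>set cs. 0 < c"
begin

lemma tangle_edges_nonempty: "i < length cs \<Longrightarrow> tangle_edges t cs i \<noteq> []"
  using cs unfolding tangle_edges_def by simp

lemma tangle_box_eq: "tangle_box t cs i = box (tangle_kind cs i) (tangle_edges t cs i)"
  unfolding tangle_box_def box_def tangle_kind_def tangle_edges_def by (simp add: Let_def)

lemma graph_of_tangle_tree: "i < length cs \<Longrightarrow> eqv (tangle_graph t cs i) (graph_of (tangle_tree t cs i))"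
proof (induction i)
  case 0
  then show ?case using graph_of_lpath[OF tangle_edges_nonempty] by (simp add: tangle_box_eq)
next
  case (Suc i)
  have "tangle_graph t cs (Suc i) =
      join (tangle_kind cs (Suc i)) (tangle_graph t cs i) (tangle_box t cs (Suc i))"
    unfolding join_def tangle_kind_def by simp
  then show ?case
    using graph_of_lchain[OF tangle_edges_nonempty[OF Suc.prems]] Suc by (simp add: tangle_box_eq)
qed

lemma leaves_tangle_tree:
  "i < length cs \<Longrightarrow> leaves (tangle_tree t cs i) = {(t, m, j) |m j. m \<le> i \<and> j < cs ! m}"
proof (induction i)
  case 0
  then show ?case using tangle_edges_nonempty[of 0] by (auto simp: tangle_edges_def set_box_edges)
next
  case (Suc i)
  then show ?case by (auto simp: tangle_edges_def set_box_edges le_Suc_eq)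
qed

lemma sorted_tangle_tree: "i < length cs \<Longrightarrow> sorted_sp lex3 (tangle_tree t cs i)"
proof (induction i)
  case 0
  then show ?case
    using tangle_edges_nonempty[of 0] sorted_Pair_box_edges
    by (auto simp: tangle_edges_def intro!: sorted_sp_lpath)
next
  case (Suc i)
  then have "lex3 x e" if "x \<in> leaves (tangle_tree t cs i)" "e \<in> set (tangle_edges t cs (Suc i))" for x e
    using that leaves_tangle_tree[of i] by (auto simp: tangle_edges_def set_box_edges lex3_def lex2_def)
  then show ?case
    using Suc sorted_Pair_box_edges unfolding tangle_tree.simps sorted_sp_lchain
    by (simp add: tangle_edges_def)
qed

end

context
  fixes k :: nat and css :: "nat list list"
  assumes k: "0 < k" and css: "\<forall>cs\<in>set css. cs \<noteq> [] \<and> (\<forall>c\<in>set cs. 0 < c)"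
begin

abbreviation tangle :: "nat \<Rightarrow> (nat \<times> nat \<times> nat) sp" where
  "tangle t \<equiv> tangle_tree (Suc t) (css ! t) (length (css ! t) - 1)"

lemma montesinos_pos:
  assumes "t < length css"
  shows "\<forall>c\<in>set (css ! t). 0 < c" "length (css ! t) - 1 < length (css ! t)"
  using assms css nth_mem[OF assms] by (metis, metis diff_less length_greater_0_conv zero_less_one)

lemma leaves_tangle:
  assumes "t < length css"
  shows "leaves (tangle t) = {(Suc t, m, j) |m j. m < length (css ! t) \<and> j < css ! t ! m}"
  unfolding leaves_tangle_tree[OF montesinos_pos[OF assms]] using montesinos_pos(2)[OF assms] by auto

lemma leaves_montesinos_tree:
  "leaves (montesinos_tree k css) = {(0, 0, j) |j. j < k} \<union>
     {(Suc t, m, j) |t m j. t < length css \<and> m < length (css ! t) \<and> j < css ! t ! m}"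
proof -
  have "leaves (montesinos_tree k css) =
      (\<Union>x\<in>set (map (Pair 0) (box_edges 0 k)). {x}) \<union> (\<Union>t\<in>{..<length css}. leaves (tangle t))"
    unfolding montesinos_tree_def using k by (subst leaves_par_tree) (auto simp: lessThan_atLeast0)
  then show ?thesis by (auto simp: leaves_tangle[unfolded One_nat_def] set_box_edges)
qed

lemma graph_of_montesinos_tree: "eqv (montesinos k css) (graph_of (montesinos_tree k css))"
proof -
  have par: "parallel (multi_edge_box es # Bs) = parallel (map (\<lambda>e. path_box [e]) es @ Bs)"
    for es :: "(nat \<times> nat \<times> nat) list" and Bs
    unfolding parallel_def multi_edge_box_def path_box_def
    by (simp add: comp_def concat_map_singleton)
  have "eqv (tangle_graph (Suc t) (css ! t) (length (css ! t) - 1)) (graph_of (tangle t))"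
    if "t < length css" for t
    by (rule graph_of_tangle_tree[OF montesinos_pos[OF that]])
  then have "list_all2 (\<lambda>B t. eqv B (graph_of t))
      (map (\<lambda>e. path_box [e]) (map (Pair 0) (box_edges 0 k)) @
        map (\<lambda>t. tangle_graph (Suc t) (css ! t) (length (css ! t) - 1)) [0..<length css])
      (map Leaf (map (Pair 0) (box_edges 0 k)) @ map tangle [0..<length css])"
    by (intro list_all2_appendI) (auto simp: list_all2_conv_all_nth)
  then show ?thesis
    unfolding montesinos_def montesinos_tree_def par using k by (intro graph_of_par_tree) simp_all
qed

lemma sorted_montesinos_tree: "sorted_sp lex3 (montesinos_tree k css)"
  unfolding montesinos_tree_def
proof (rule sorted_sp_par_tree)
  show "map Leaf (map (Pair 0) (box_edges 0 k)) @ map tangle [0..<length css] \<noteq> []" using k by simp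
next
  fix t assume "t \<in> set (map Leaf (map (Pair 0) (box_edges 0 k)) @ map tangle [0..<length css])"
  then consider "\<exists>e. t = Leaf e" | m where "m < length css" "t = tangle m" by auto
  then show "sorted_sp lex3 t"
  proof cases
    case 2
    then show ?thesis using sorted_tangle_tree[OF montesinos_pos[OF 2(1)]] by simp
  qed auto
next
  let ?R = "\<lambda>A B. \<forall>a\<in>leaves A. \<forall>b\<in>leaves B. lex3 a b"
  have "sorted_wrt ?R (map Leaf (map (Pair 0) (box_edges 0 k)))"
    using sorted_Pair_box_edges[of 0 0 k] unfolding sorted_wrt_map by simp
  moreover have "sorted_wrt (\<lambda>i j. ?R (tangle i) (tangle j)) [0..<length css]"
    by (rule sorted_wrt_mono_rel[OF _ sorted_wrt_upt]) (auto simp: leaves_tangle[unfolded One_nat_def] lex3_def)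
  moreover have "?R A B" if "A \<in> set (map Leaf (map (Pair 0) (box_edges 0 k)))"
      "B \<in> set (map tangle [0..<length css])" for A B
    using that by (auto simp: leaves_tangle[unfolded One_nat_def] lex3_def)
  ultimately show "sorted_wrt ?R (map Leaf (map (Pair 0) (box_edges 0 k)) @ map tangle [0..<length css])"
    unfolding sorted_wrt_append sorted_wrt_map by blast
qed

lemma montesinos_labeling_less:
  assumes l: "montesinos_labeling k css l"
    and xy: "x \<in> leaves (montesinos_tree k css)" "y \<in> leaves (montesinos_tree k css)" "lex3 x y"
  shows "l (crossing_of_edge x) < l (crossing_of_edge y)"
proof -
  have ol: "ordered_labeling (universe (montesinos k css)) l"
    and first: "\<And>j. j < k \<Longrightarrow> l (crossing_of_edge (0, 0, j)) = Suc j"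
    using l unfolding montesinos_labeling_def by auto
  note dis = sorted_sp_disjoint_leaves[OF sorted_montesinos_tree lex3_order(1)]
  note cr = crossings_universe[OF graph_of_montesinos_tree dis]
  have inj: "inj_on (\<lambda>e. l (crossing_of_edge e)) (leaves (montesinos_tree k css))"
    using ol comp_inj_on[OF cr(2), of l] unfolding ordered_labeling_def cr(1) bij_betw_def comp_def by blast
  have pos: "1 \<le> l (crossing_of_edge e)" if "e \<in> leaves (montesinos_tree k css)" for e
    using ol that unfolding ordered_labeling_def cr(1) bij_betw_def by fastforce
  \<comment> \<open>The labels \<open>1\<close> to \<open>k\<close> are used up by the twist box,
    and the labeling is injective.\<close>
  have rest: "k < l (crossing_of_edge y)" if y: "y \<in> leaves (montesinos_tree k css)" "fst y \<noteq> 0" for y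
  proof (rule ccontr)
    assume "\<not> ?thesis"
    then obtain j where j: "l (crossing_of_edge y) = Suc j" "j < k"
      using pos[OF y(1)] by (cases "l (crossing_of_edge y)") auto
    have "(0, 0, j) \<in> leaves (montesinos_tree k css)" unfolding leaves_montesinos_tree using j by simp
    then have "y = (0, 0, j)" using inj_onD[OF inj _ y(1)] j first by metis
    then show False using y(2) by simp
  qed
  consider j j' where "x = (0, 0, j)" "y = (0, 0, j')" "j < j'" "j' < k"
    | j where "x = (0, 0, j)" "j < k" "fst y \<noteq> 0"
    | t m j t' m' j' where "x = (Suc t, m, j)" "y = (Suc t', m', j')" "t < length css" "t' < length css"
        "m < length (css ! t)" "m' < length (css ! t')" "j < css ! t ! m" "j' < css ! t' ! m'"
    using xy unfolding leaves_montesinos_tree lex3_def lex2_def by auto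
  then show ?thesis
  proof cases
    case 1
    then show ?thesis using first by simp
  next
    case 2
    then show ?thesis using first rest[OF xy(2)] by simp
  next
    case 3
    then consider "t < t'" | "t = t'" "m < m'" | "t = t'" "m = m'" "j < j'"
      using xy(3) unfolding lex3_def lex2_def by auto
    then show ?thesis using l 3 unfolding montesinos_labeling_def by cases simp_all
  qed
qed

text \<open>Exactly \<open>j\<close> edges precede \<open>(0, 0, j)\<close> in the order
  \<open>lex3\<close>, so its rank is the prescribed label \<open>Suc j\<close>.\<close>

lemma montesinos_labelingI:
  assumes "ordered_labeling (universe (montesinos k css)) l"
    and less: "\<And>x y. x \<in> leaves (montesinos_tree k css) \<Longrightarrow> y \<in> leaves (montesinos_tree k css) \<Longrightarrow>
      lex3 x y \<Longrightarrow> l (crossing_of_edge x) < l (crossing_of_edge y)"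
    and rank: "\<And>e. e \<in> leaves (montesinos_tree k css) \<Longrightarrow>
      l (crossing_of_edge e) = Suc (card {x \<in> leaves (montesinos_tree k css). lex3 x e})"
  shows "montesinos_labeling k css l"
proof -
  have "l (crossing_of_edge (0, 0, j)) = Suc j" if "j < k" for j
  proof -
    have "{x \<in> leaves (montesinos_tree k css). lex3 x (0, 0, j)} = (\<lambda>i. (0 :: nat, 0 :: nat, i)) ` {..<j}"
      unfolding leaves_montesinos_tree lex3_def lex2_def using that by auto
    moreover have "inj_on (\<lambda>i. (0 :: nat, 0 :: nat, i)) {..<j}" by (rule inj_onI) simp
    ultimately have "card {x \<in> leaves (montesinos_tree k css). lex3 x (0, 0, j)} = j"
      by (simp add: card_image)
    moreover have "(0, 0, j) \<in> leaves (montesinos_tree k css)" unfolding leaves_montesinos_tree using that by simp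
    ultimately show ?thesis using rank by simp
  qed
  then show ?thesis
    unfolding montesinos_labeling_def using assms(1)
    by (auto intro!: less simp: leaves_montesinos_tree lex3_def lex2_def)
qed

lemma montesinos_case:
  assumes "link_universe (universe (montesinos k css))"
  shows "(\<exists>l. montesinos_labeling k css l \<and>
      admissible (universe (montesinos k css)) (lower_segment (montesinos k css)) l) \<and>
    (\<forall>l. montesinos_labeling k css l \<longrightarrow>
      admissible (universe (montesinos k css)) (lower_segment (montesinos k css)) l)"
proof -
  let ?t = "montesinos_tree k css"
  note e = graph_of_montesinos_tree and s = sorted_montesinos_tree
  have split: "box_edges 0 k = (0, 0) # map (Pair 0) [1..<k]"
    unfolding box_edges_def using k by (simp add: upt_conv_Cons)
  let ?ts = "map Leaf (map (Pair 0) (map (Pair 0) [1..<k])) @ map tangle [0..<length css]"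
  have t: "?t = par_tree (Leaf (0, 0, 0) # ?ts)"
    unfolding montesinos_tree_def split by simp
  have ne: "?ts \<noteq> []"
  proof
    assume "?ts = []"
    then have "?t = Leaf (0, 0, 0)" unfolding t by (simp only: par_tree.simps)
    then have "length (bnd North (corner_tree ?t)) = 1" by simp
    then show False
      using curl_sp[OF e sorted_sp_disjoint_leaves[OF s lex3_order(1)]] assms by blast
  qed
  have ctx: "context_ok {(North, False)} ?t"
    unfolding t by (rule context_ok_par_tree[OF ne context_ok_Leaf(3)])
      (auto simp: context_ok_tangle_tree context_ok_Leaf simp del: context_ok.simps)
  have root: "?t = Node Par False (Leaf (0, 0, 0)) (par_tree ?ts)" unfolding t by (rule par_tree_Node[OF ne])
  obtain l where "ordered_labeling (universe (montesinos k css)) l"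
    "\<forall>e\<in>leaves ?t. l (crossing_of_edge e) = Suc (card {x \<in> leaves ?t. lex3 x e})"
    "\<forall>x\<in>leaves ?t. \<forall>y\<in>leaves ?t. lex3 x y \<longrightarrow> l (crossing_of_edge x) < l (crossing_of_edge y)"
    using sorted_labeling[OF e s lex3_order] by blast
  then have "montesinos_labeling k css l" by (intro montesinos_labelingI) blast+
  moreover have "admissible (universe (montesinos k css)) (lower_segment (montesinos k css)) l"
    if "montesinos_labeling k css l" for l
  proof (rule sorted_admissible[OF e s lex3_order(1) root ctx])
    show "ordered_labeling (universe (montesinos k css)) l"
      using that unfolding montesinos_labeling_def by blast
  qed (rule montesinos_labeling_less[OF that])
  ultimately show ?thesis by blast
qed

end

theorem proposition4p33:
  shows
    "(\<forall>as. as \<noteq> [] \<and> (\<forall>a\<in>set as. 0 < a) \<and> link_universe (universe (two_bridge as)) \<longrightarrow>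
        (\<exists>l. two_bridge_labeling as l \<and>
           admissible (universe (two_bridge as)) (lower_segment (two_bridge as)) l) \<and>
        (\<forall>l. two_bridge_labeling as l \<longrightarrow>
           admissible (universe (two_bridge as)) (lower_segment (two_bridge as)) l)) \<and>
     (\<forall>bs. bs \<noteq> [] \<and> (\<forall>b\<in>set bs. 0 < b) \<and> link_universe (universe (pretzel bs)) \<longrightarrow>
        (\<exists>l. pretzel_labeling bs l \<and>
           admissible (universe (pretzel bs)) (lower_segment (pretzel bs)) l) \<and>
        (\<forall>l. pretzel_labeling bs l \<longrightarrow>
           admissible (universe (pretzel bs)) (lower_segment (pretzel bs)) l)) \<and>
     (\<forall>k css. 0 < k \<and> (\<forall>cs\<in>set css. cs \<noteq> [] \<and> (\<forall>c\<in>set cs. 0 < c)) \<and>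
        link_universe (universe (montesinos k css)) \<longrightarrow>
        (\<exists>l. montesinos_labeling k css l \<and>
           admissible (universe (montesinos k css)) (lower_segment (montesinos k css)) l) \<and>
        (\<forall>l. montesinos_labeling k css l \<longrightarrow>
           admissible (universe (montesinos k css)) (lower_segment (montesinos k css)) l))"
  by (simp add: two_bridge_case pretzel_case montesinos_case)

end
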